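(* Let $P\subset\mathbb{R}^n$ be a Delzant polytope with vertices in $\mathbb{Z}^n$, with associated symplectic toric manifold $(X_P,\omega)$, moment map $\mu_P$, prequantum line bundle $L_\omega$ and singular real polarization $\mathcal{P}_{\mathbb{R}}$ defined by $\mu_P$. The space $\mathcal{Q}_{\mathbb{R}}$ of distributional sections of $L_\omega$ that are covariantly constant with respect to $\mathcal{P}_{\mathbb{R}}$ is spanned by one section $\delta^m$ for each Bohr-Sommerfeld fiber $\mu_P^{-1}(m)$, $m\in P\cap\mathbb{Z}^n$, with $$\operatorname{supp}\,\delta^m=\mu_P^{-1}(m).$$
   Context: **Toric manifold.** $P=\{x\in\mathbb{R}^n:\ell_r(x)={}^t\nu_r x-\lambda_r\ge 0,\ r=1,\dots,d\}$ is a (compact) Delzant polytope with vertices in $\mathbb{Z}^n$: $\lambda_r\in\mathbb{Z}$, $\nu_r\in\mathbb{Z}^n$ is the primitive inward-pointing normal of the $r$-th facet, and at each vertex exactly $n$ facets meet and their normals form a $\mathbb{Z}$-basis of $\mathbb{Z}^n$. $\breve P$ is the interior of $P$. $(X_P,\omega,\mathbb{T}^n,\mu_P)$ is the associated compact symplectic toric manifold, $\mathbb{T}^n=\mathbb{R}^n/2\pi\mathbb{Z}^n$, with moment map $\mu_P:X_P\to P$. On $\breve X_P=\mu_P^{-1}(\breve P)\cong\breve P\times\mathbb{T}^n$ one has coordinates $(x,\theta)$ with $\omega=\sum_i dx_i\wedge d\theta_i$ and $\mu_P(x,\theta)=x$. **Vertex charts.** For a vertex $v$ of $P$, fix an ordering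 of the $n$ facets containing $v$; let $A$ be the matrix whose rows are their normals and $\lambda$ the vector of the corresponding $\lambda_r$, and put $l=\ell(x)=Ax-\lambda$ (so $\ell(v)=0$) and $\vartheta={}^tA^{-1}\theta$. Let $\breve P_v$ be the union of the relative interiors of all faces of $P$ containing $v$ (including $\{v\}$ and $\breve P$), and $V_v=\mu_P^{-1}(\breve P_v)$, an open neighbourhood of the fixed point $\mu_P^{-1}(v)$ with smooth complex-valued coordinates $\sqrt{2l_j}\,e^{i\vartheta_j}$, $j=1,\dots,n$. The sets $V_v$ cover $X_P$. **Prequantum bundle.** $L_\omega\to X_P$ is the Hermitian line bundle with unitary trivializing sections $\mathbb{1}^{U(1)}_v$ over $V_v$, related on overlaps by $\mathbb{1}^{U(1)}_v=e^{i\,{}^t(v-\tilde v)\theta}\,\mathbb{1}^{U(1)}_{\tilde v}$, and with connection $\nabla\mathbb{1}^{U(1)}_v=-i\,{}^t(x-v)d\theta\,\mathbb{1}^{U(1)}_v=-i\,{}^tl\,d\vartheta\,\mathbb{1}^{U(1)}_v$, whose curvature is $-i\omega$. **Distributional sections.** For $U\subset X_P$ open, the distributional sections of $L_\omega$ over $U$ are $C^{-\infty}(L_\omega|_U)=(C_c^\infty(L_\omega^{-1}|_U))'$. The bundle $L_\omega^{-1}$ carries the dual connection $\nabla^{-1}$. For a smooth complex vector field $\xi$ on $U$, $\nabla''_\xi$ acts on distributional sections by $(\nabla''_\xi\sigma)(\phi)=\sigma({}^t\nabla_\xi\phi)$, where ${}^t\nabla_\xi\phi=-(\operatorname{div}\xi\,\phi+\nabla^{-1}_\xi\phi)$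 and the divergence is taken with respect to the Liouville measure $\omega^n/n!$. **Real polarization.** $\mathcal{P}_{\mathbb{R}}\subset (TX_P)_{\mathbb{C}}$ is the complexified (singular) distribution of tangent spaces to the $\mathbb{T}^n$-orbits; on $\breve X_P$ it equals $\ker d\mu_P$. $C^\infty(\mathcal{P}_{\mathbb{R}}|_W)$ is the set of smooth complex vector fields on $W$ with values in $\mathcal{P}_{\mathbb{R}}$. The space of covariantly constant distributional sections is $$\mathcal{Q}_{\mathbb{R}}=\{\sigma\in(C^\infty(L_\omega^{-1}))':\ \forall W\subset X_P\text{ open},\ \forall\xi\in C^\infty(\mathcal{P}_{\mathbb{R}}|_W),\ \nabla''_\xi(\sigma|_W)=0\}.$$ The Bohr-Sommerfeld fibers of $\mathcal{P}_{\mathbb{R}}$ are the fibers $\mu_P^{-1}(m)$ with $m\in P\cap\mathbb{Z}^n$. *)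

theory Defs
  imports "HOL-Analysis.Analysis" "HOL-Library.Function_Algebras"
begin

section \<open>Smooth functions on open subsets of Euclidean space\<close>

definition partial_deriv ::
  "'a::euclidean_space \<Rightarrow> ('a \<Rightarrow> 'b::real_normed_vector) \<Rightarrow> 'a \<Rightarrow> 'b" where
  "partial_deriv b f = (\<lambda>x. frechet_derivative f (at x) b)"

definition iter_deriv ::
  "'a::euclidean_space list \<Rightarrow> ('a \<Rightarrow> 'b::real_normed_vector) \<Rightarrow> 'a \<Rightarrow> 'b" where
  "iter_deriv bs f = foldr partial_deriv bs f"

text \<open>Only meaningful for open \<open>S\<close>: all iterated partial derivatives exist and are differentiable.\<close>

definition smooth_on ::
  "'a::euclidean_space set \<Rightarrow> ('a \<Rightarrow> 'b::real_normed_vector) \<Rightarrow> bool" where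
  "smooth_on S f \<longleftrightarrow>
     (\<forall>bs. set bs \<subseteq> Basis \<longrightarrow> (\<forall>x\<in>S. iter_deriv bs f differentiable (at x)))"


section \<open>The local model: forms and divergence in a vertex chart\<close>

text \<open>
  A vertex chart has coordinates \<open>w\<^sub>j = sqrt (2 l\<^sub>j) exp (i \<theta>\<^sub>j) = a\<^sub>j + i b\<^sub>j\<close>, so that
  \<open>l\<^sub>j = |w\<^sub>j|^2 / 2\<close>, \<open>dl\<^sub>j = Re (cnj w\<^sub>j dw\<^sub>j)\<close> and \<open>d\<theta>\<^sub>j = Im (dw\<^sub>j / w\<^sub>j)\<close> (here \<open>\<theta>\<^sub>j\<close> is the
  angle adapted to the vertex).
  Hence \<open>\<omega> = \<Sum> dx\<^sub>i \<and> d\<theta>\<^sub>i = \<Sum> dl\<^sub>j \<and> d\<theta>\<^sub>j\<close> extends over \<open>w\<^sub>j = 0\<close> as \<open>\<Sum> da\<^sub>j \<and> db\<^sub>j\<close>;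
  see the lemma \<open>omega_action_angle\<close> below.
\<close>

definition omega :: "complex^'n \<Rightarrow> complex^'n \<Rightarrow> complex^'n \<Rightarrow> real" where
  "omega w u u' = (\<Sum>j\<in>UNIV. Re (u $ j) * Im (u' $ j) - Im (u $ j) * Re (u' $ j))"

lemma omega_action_angle:
  fixes A :: "real^'n^'n" and w u u' :: "complex^'n"
  defines "dl \<equiv> \<lambda>u. (\<chi> j. Re (cnj (w $ j) * u $ j)) :: real^'n"
    and "dvt \<equiv> \<lambda>u. (\<chi> j. Im (u $ j / w $ j)) :: real^'n"
  defines "dx \<equiv> \<lambda>u. matrix_inv A *v dl u"
    and "dth \<equiv> \<lambda>u. transpose A *v dvt u"
  assumes A: "invertible A" and w: "\<And>j. w $ j \<noteq> 0"
  shows "omega w u u' = (\<Sum>i\<in>UNIV. dx u $ i * dth u' $ i - dx u' $ i * dth u $ i)"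
proof -
  have inv: "A ** matrix_inv A = mat 1"
    using A someI_ex[of "\<lambda>A'. A ** A' = mat 1 \<and> A' ** A = mat 1"]
    by (auto simp: invertible_def matrix_inv_def)
  have pair: "dx u \<bullet> dth u' = dl u \<bullet> dvt u'" for u u'
  proof -
    have "dx u \<bullet> dth u' = (A *v (matrix_inv A *v dl u)) \<bullet> dvt u'"
      unfolding dx_def dth_def by (metis dot_lmul_matrix transpose_matrix_vector inner_commute)
    then show ?thesis
      by (simp add: matrix_vector_mul_assoc inv)
  qed
  have loc: "Re (cnj z * a) * Im (b / z) - Re (cnj z * b) * Im (a / z) = Re a * Im b - Im a * Re b"
    if "z \<noteq> 0" for z a b :: complex
  proof -
    let ?N = "(Re z)\<^sup>2 + (Im z)\<^sup>2"
    have N: "?N \<noteq> 0" using that by (simp add: complex_eq_iff sum_power2_eq_zero_iff)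
    have "Re (cnj z * a) * Im (b / z) - Re (cnj z * b) * Im (a / z)
        = ((Re z * Re a + Im z * Im a) * (Im b * Re z - Re b * Im z)
           - (Re z * Re b + Im z * Im b) * (Im a * Re z - Re a * Im z)) / ?N"
      by (simp add: Im_divide diff_divide_distrib right_diff_distrib)
    also have "(Re z * Re a + Im z * Im a) * (Im b * Re z - Re b * Im z)
           - (Re z * Re b + Im z * Im b) * (Im a * Re z - Re a * Im z)
        = ?N * (Re a * Im b - Im a * Re b)"
      by (simp add: algebra_simps power2_eq_square)
    finally show ?thesis using N by (auto split: if_splits)
  qed
  have "(\<Sum>i\<in>UNIV. dx u $ i * dth u' $ i - dx u' $ i * dth u $ i)
      = dx u \<bullet> dth u' - dx u' \<bullet> dth u"
    by (simp add: inner_vec_def sum_subtractf)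
  also have "\<dots> = dl u \<bullet> dvt u' - dl u' \<bullet> dvt u"
    by (simp add: pair)
  also have "\<dots> = (\<Sum>j\<in>UNIV. dl u $ j * dvt u' $ j - dl u' $ j * dvt u $ j)"
    by (simp add: inner_vec_def sum_subtractf)
  also have "\<dots> = omega w u u'"
    unfolding omega_def dl_def dvt_def using loc[OF w] by (intro sum.cong) simp_all
  finally show ?thesis by simp
qed

text \<open>
  With respect to real coordinates, \<open>|\<omega>^n / n!|\<close> is Lebesgue measure times
  \<open>|Pf (\<omega>\<^sub>a\<^sub>b)| = sqrt |det (\<omega>\<^sub>a\<^sub>b)|\<close>.
\<close>

definition real_frame :: "'n + 'n \<Rightarrow> complex^'n" where
  "real_frame k = (case k of Inl j \<Rightarrow> axis j 1 | Inr j \<Rightarrow> axis j \<i>)"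

definition liouville_density :: "complex^'n \<Rightarrow> real" where
  "liouville_density w =
     sqrt \<bar>det ((\<chi> a b. omega w (real_frame a) (real_frame b)) :: real^('n + 'n)^('n + 'n))\<bar>"

definition divergence :: "(complex^'n \<Rightarrow> complex^'n) \<Rightarrow> complex^'n \<Rightarrow> real" where
  "divergence X w =
     (\<Sum>b\<in>Basis. partial_deriv b (\<lambda>z. liouville_density z * (X z \<bullet> b)) w) / liouville_density w"

text \<open>
  A complex tangent vector is a pair \<open>(u\<^sub>1, u\<^sub>2)\<close> of real tangent vectors, standing for
  \<open>u\<^sub>1 + i u\<^sub>2\<close>; the formal \<open>i\<close> is unrelated to multiplication by \<open>\<i>\<close> on \<^typ>\<open>complex^'n\<close>.
\<close>

definition cdivergence ::
  "(complex^'n \<Rightarrow> (complex^'n) \<times> (complex^'n)) \<Rightarrow> complex^'n \<Rightarrow> complex" where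
  "cdivergence X w = of_real (divergence (\<lambda>z. fst (X z)) w) + \<i> * of_real (divergence (\<lambda>z. snd (X z)) w)"

definition cderiv ::
  "(complex^'n) \<times> (complex^'n) \<Rightarrow> (complex^'n \<Rightarrow> complex) \<Rightarrow> complex^'n \<Rightarrow> complex" where
  "cderiv u f w = frechet_derivative f (at w) (fst u) + \<i> * frechet_derivative f (at w) (snd u)"

text \<open>The form \<open>\<Sum> l\<^sub>j d\<theta>\<^sub>j = \<Sum> (|w\<^sub>j|^2 / 2) Im (dw\<^sub>j / w\<^sub>j)\<close>, written so as to extend over \<open>w\<^sub>j = 0\<close>.\<close>

definition action_form :: "complex^'n \<Rightarrow> complex^'n \<Rightarrow> real" where
  "action_form w u = (\<Sum>j\<in>UNIV. Im (cnj (w $ j) * u $ j) / 2)"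

text \<open>\<open>\<nabla>\<^sub>u 1\<^sub>v = connection_form w u 1\<^sub>v\<close> for the unitary frame \<open>1\<^sub>v\<close> of \<open>L\<^sub>\<omega>\<close>.\<close>

definition connection_form :: "complex^'n \<Rightarrow> (complex^'n) \<times> (complex^'n) \<Rightarrow> complex" where
  "connection_form w u =
     - \<i> * (of_real (action_form w (fst u)) + \<i> * of_real (action_form w (snd u)))"


section \<open>Delzant polytopes and their toric manifolds\<close>

type_synonym 'n toric_point = "((real^'n) \<times> (real^'n)) set"

definition int_lattice :: "(real^'n) set" where
  "int_lattice = {x. \<forall>i. x $ i \<in> \<int>}"

definition real_vec :: "int^'n \<Rightarrow> real^'n" where
  "real_vec z = (\<chi> i. real_of_int (z $ i))"

text \<open>
  The data are \<open>d\<close>, the normals \<open>\<nu> r\<close> and constants \<open>lam r\<close> (with \<open>r < d\<close>), and for each vertex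
  \<open>v\<close> an ordering \<open>ord v\<close> of the facets containing \<open>v\<close>.
\<close>

locale toric_data =
  fixes d :: nat
    and \<nu> :: "nat \<Rightarrow> int^'n"
    and lam :: "nat \<Rightarrow> int"
    and ord :: "real^'n \<Rightarrow> 'n \<Rightarrow> nat"
begin

definition ell :: "nat \<Rightarrow> real^'n \<Rightarrow> real" where
  "ell r x = real_vec (\<nu> r) \<bullet> x - real_of_int (lam r)"

definition P :: "(real^'n) set" where
  "P = {x. \<forall>r<d. ell r x \<ge> 0}"

definition vertices :: "(real^'n) set" where
  "vertices = {v. v extreme_point_of P}"

definition active :: "real^'n \<Rightarrow> nat set" where
  "active x = {r. r < d \<and> ell r x = 0}"

text \<open>
  \<open>X\<^sub>P\<close> as the quotient of \<open>P \<times> T^n\<close>, \<open>T^n = \<real>^n / 2\<pi>\<int>^n\<close>, collapsing over \<open>x\<close> the subtorus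
  generated by the normals of the facets containing \<open>x\<close>.
\<close>

definition same_point :: "(((real^'n) \<times> (real^'n)) \<times> ((real^'n) \<times> (real^'n))) set" where
  "same_point = {((x, t), (x', t')). x \<in> P \<and> x' = x \<and>
     (\<exists>k :: int^'n. t' - t - (2 * pi) *\<^sub>R real_vec k \<in> span ((\<lambda>r. real_vec (\<nu> r)) ` active x))}"

definition X :: "'n toric_point set" where
  "X = (P \<times> UNIV) // same_point"

definition moment :: "'n toric_point \<Rightarrow> real^'n" where
  "moment p = fst (SOME q. q \<in> p)"

text \<open>A representative angle; it is used only in expressions that do not depend on the choice.\<close>

definition angle :: "'n toric_point \<Rightarrow> real^'n" where
  "angle p = snd (SOME q. q \<in> p)"

definition torus_act :: "real^'n \<Rightarrow> 'n toric_point \<Rightarrow> 'n toric_point" where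
  "torus_act s p = (\<lambda>(x, t). (x, t + s)) ` p"


subsection \<open>Vertex charts\<close>

definition A :: "real^'n \<Rightarrow> real^'n^'n" where
  "A v = (\<chi> j. real_vec (\<nu> (ord v j)))"

definition lam_vec :: "real^'n \<Rightarrow> real^'n" where
  "lam_vec v = (\<chi> j. real_of_int (lam (ord v j)))"

definition P_at :: "real^'n \<Rightarrow> (real^'n) set" where
  "P_at v = \<Union> {rel_interior F | F. F face_of P \<and> v \<in> F}"

definition V :: "real^'n \<Rightarrow> 'n toric_point set" where
  "V v = {p \<in> X. moment p \<in> P_at v}"

definition chart :: "real^'n \<Rightarrow> 'n toric_point \<Rightarrow> complex^'n" where
  "chart v p =
    (let l = A v *v moment p - lam_vec v;
         vt = matrix_inv (transpose (A v)) *v angle p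
     in (\<chi> j. of_real (sqrt (2 * l $ j)) * cis (vt $ j)))"

definition chart_inv :: "real^'n \<Rightarrow> complex^'n \<Rightarrow> 'n toric_point" where
  "chart_inv v = inv_into (V v) (chart v)"

text \<open>The manifold topology given by the atlas of vertex charts.\<close>

definition open_in_X :: "'n toric_point set \<Rightarrow> bool" where
  "open_in_X W \<longleftrightarrow> W \<subseteq> X \<and> (\<forall>v\<in>vertices. open {w \<in> chart v ` V v. chart_inv v w \<in> W})"

definition X_top :: "'n toric_point topology" where
  "X_top = topology open_in_X"

lemma istopology_open_in_X: "istopology open_in_X"
  unfolding istopology_def
proof (intro conjI allI impI)
  fix S T assume "open_in_X S" "open_in_X T"
  then show "open_in_X (S \<inter> T)"
    unfolding open_in_X_def
  proof (intro conjI ballI)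
    fix v assume "v \<in> vertices"
    with \<open>open_in_X S\<close> \<open>open_in_X T\<close>
    have "open ({w \<in> chart v ` V v. chart_inv v w \<in> S} \<inter> {w \<in> chart v ` V v. chart_inv v w \<in> T})"
      by (auto simp: open_in_X_def)
    moreover have "{w \<in> chart v ` V v. chart_inv v w \<in> S} \<inter> {w \<in> chart v ` V v. chart_inv v w \<in> T}
        = {w \<in> chart v ` V v. chart_inv v w \<in> S \<inter> T}" by blast
    ultimately show "open {w \<in> chart v ` V v. chart_inv v w \<in> S \<inter> T}" by simp
  qed auto
next
  fix K assume K: "\<forall>S\<in>K. open_in_X S"
  show "open_in_X (\<Union> K)"
    unfolding open_in_X_def
  proof (intro conjI ballI)
    show "\<Union> K \<subseteq> X" using K by (auto simp: open_in_X_def)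
    fix v assume "v \<in> vertices"
    with K have "open (\<Union>S\<in>K. {w \<in> chart v ` V v. chart_inv v w \<in> S})"
      by (auto simp: open_in_X_def)
    moreover have "(\<Union>S\<in>K. {w \<in> chart v ` V v. chart_inv v w \<in> S})
        = {w \<in> chart v ` V v. chart_inv v w \<in> \<Union> K}" by blast
    ultimately show "open {w \<in> chart v ` V v. chart_inv v w \<in> \<Union> K}" by simp
  qed
qed

lemma openin_X_top: "openin X_top = open_in_X"
  by (simp add: X_top_def topology_inverse'[OF istopology_open_in_X])


subsection \<open>Sections of the dual prequantum bundle and distributional sections\<close>

text \<open>
  A section \<open>\<phi>\<close> of the dual of \<open>L\<^sub>\<omega>\<close> is given by its values \<open>\<phi> v p = \<phi>(p) (1\<^sub>v(p))\<close> on the unitary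
  frames of \<open>L\<^sub>\<omega>\<close>; the relation \<open>1\<^sub>v = exp (i (v - v') \<theta>) 1\<^sub>v\<^sub>'\<close> becomes the gluing condition.
  Values outside the range of definition of a frame are set to \<open>0\<close>.
\<close>

definition smooth_sections :: "(real^'n \<Rightarrow> 'n toric_point \<Rightarrow> complex) set" where
  "smooth_sections = {\<phi>.
     (\<forall>v p. \<not> (v \<in> vertices \<and> p \<in> V v) \<longrightarrow> \<phi> v p = 0) \<and>
     (\<forall>v\<in>vertices. \<forall>v'\<in>vertices. \<forall>p \<in> V v \<inter> V v'. \<phi> v p = cis ((v - v') \<bullet> angle p) * \<phi> v' p) \<and>
     (\<forall>v\<in>vertices. smooth_on (chart v ` V v) (\<lambda>w. \<phi> v (chart_inv v w)))}"

definition section_support :: "(real^'n \<Rightarrow> 'n toric_point \<Rightarrow> complex) \<Rightarrow> 'n toric_point set" where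
  "section_support \<phi> = X_top closure_of {p \<in> X. \<exists>v\<in>vertices. p \<in> V v \<and> \<phi> v p \<noteq> 0}"

text \<open>
  Compactly supported smooth sections over \<open>U\<close>, extended by zero to \<open>X\<^sub>P\<close>. As \<open>X\<^sub>P\<close> is compact,
  \<open>test_sections X\<close> consists of all smooth sections.
\<close>

definition test_sections ::
  "'n toric_point set \<Rightarrow> (real^'n \<Rightarrow> 'n toric_point \<Rightarrow> complex) set" where
  "test_sections U =
     {\<phi> \<in> smooth_sections. compactin X_top (section_support \<phi>) \<and> section_support \<phi> \<subseteq> U}"

definition seminorm ::
  "real^'n \<Rightarrow> (complex^'n) set \<Rightarrow> (complex^'n) list \<Rightarrow>
   (real^'n \<Rightarrow> 'n toric_point \<Rightarrow> complex) \<Rightarrow> real" where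
  "seminorm v K bs \<phi> =
     Sup (insert 0 ((\<lambda>w. norm (iter_deriv bs (\<lambda>z. \<phi> v (chart_inv v z)) w)) ` K))"

definition seminorm_indices ::
  "((real^'n) \<times> (complex^'n) set \<times> (complex^'n) list) set" where
  "seminorm_indices = {(v, K, bs). v \<in> vertices \<and> compact K \<and> K \<subseteq> chart v ` V v \<and> set bs \<subseteq> Basis}"

text \<open>
  The topological dual of \<open>test_sections U\<close>: linear functionals which are continuous on the
  sections supported in each fixed compact set. Functionals are \<open>0\<close> off \<open>test_sections U\<close>, so
  that equality of distributional sections is equality of functions.
\<close>

definition distributional_sections ::
  "'n toric_point set \<Rightarrow> ((real^'n \<Rightarrow> 'n toric_point \<Rightarrow> complex) \<Rightarrow> complex) set" where
  "distributional_sections U = {\<sigma>.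
     (\<forall>\<phi>. \<phi> \<notin> test_sections U \<longrightarrow> \<sigma> \<phi> = 0) \<and>
     (\<forall>\<phi>\<in>test_sections U. \<forall>\<psi>\<in>test_sections U. \<forall>a b.
        \<sigma> (\<lambda>v p. a * \<phi> v p + b * \<psi> v p) = a * \<sigma> \<phi> + b * \<sigma> \<psi>) \<and>
     (\<forall>K. compactin X_top K \<and> K \<subseteq> U \<longrightarrow>
        (\<exists>C I. finite I \<and> I \<subseteq> seminorm_indices \<and>
           (\<forall>\<phi>\<in>test_sections U. section_support \<phi> \<subseteq> K \<longrightarrow>
              norm (\<sigma> \<phi>) \<le> C * (\<Sum>(v, K', bs)\<in>I. seminorm v K' bs \<phi>))))}"

definition restrict_dist ::
  "'n toric_point set \<Rightarrow> ((real^'n \<Rightarrow> 'n toric_point \<Rightarrow> complex) \<Rightarrow> complex) \<Rightarrow>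
   (real^'n \<Rightarrow> 'n toric_point \<Rightarrow> complex) \<Rightarrow> complex" where
  "restrict_dist W \<sigma> = (\<lambda>\<phi>. if \<phi> \<in> test_sections W then \<sigma> \<phi> else 0)"

definition dist_support ::
  "((real^'n \<Rightarrow> 'n toric_point \<Rightarrow> complex) \<Rightarrow> complex) \<Rightarrow> 'n toric_point set" where
  "dist_support \<sigma> = X - \<Union> {U. openin X_top U \<and> restrict_dist U \<sigma> = (\<lambda>_. 0)}"


subsection \<open>The real polarization and covariant constancy\<close>

text \<open>Tangent space to the torus orbit through the point with coordinates \<open>w\<close> in the chart at \<open>v\<close>.\<close>

definition orbit_tangent :: "real^'n \<Rightarrow> complex^'n \<Rightarrow> (complex^'n) set" where
  "orbit_tangent v w = {u. \<exists>s.
     ((\<lambda>t. chart v (torus_act (t *\<^sub>R s) (chart_inv v w))) has_vector_derivative u) (at 0)}"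

text \<open>
  Smooth complex vector fields on \<open>W\<close> with values in the complexified polarization, given by
  their components in all vertex charts.
\<close>

definition polarized_fields ::
  "'n toric_point set \<Rightarrow> (real^'n \<Rightarrow> 'n toric_point \<Rightarrow> (complex^'n) \<times> (complex^'n)) set" where
  "polarized_fields W = {\<xi>.
     (\<forall>v\<in>vertices. smooth_on (chart v ` (W \<inter> V v)) (\<lambda>w. \<xi> v (chart_inv v w))) \<and>
     (\<forall>v\<in>vertices. \<forall>v'\<in>vertices. \<forall>p \<in> W \<inter> V v \<inter> V v'.
        \<xi> v' p = map_prod (frechet_derivative (chart v' \<circ> chart_inv v) (at (chart v p)))
                          (frechet_derivative (chart v' \<circ> chart_inv v) (at (chart v p))) (\<xi> v p)) \<and>
     (\<forall>v\<in>vertices. \<forall>p \<in> W \<inter> V v.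
        fst (\<xi> v p) \<in> orbit_tangent v (chart v p) \<and> snd (\<xi> v p) \<in> orbit_tangent v (chart v p))}"

text \<open>The dual connection: \<open>(\<nabla>^{-1}\<^sub>\<xi> \<phi>)(1\<^sub>v) = \<xi> (\<phi>(1\<^sub>v)) - \<phi>(\<nabla>\<^sub>\<xi> 1\<^sub>v)\<close>.\<close>

definition dual_connection ::
  "(real^'n \<Rightarrow> 'n toric_point \<Rightarrow> (complex^'n) \<times> (complex^'n)) \<Rightarrow>
   (real^'n \<Rightarrow> 'n toric_point \<Rightarrow> complex) \<Rightarrow> real^'n \<Rightarrow> 'n toric_point \<Rightarrow> complex" where
  "dual_connection \<xi> \<phi> v p =
     cderiv (\<xi> v p) (\<lambda>w. \<phi> v (chart_inv v w)) (chart v p)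
     - connection_form (chart v p) (\<xi> v p) * \<phi> v p"

definition transpose_nabla ::
  "'n toric_point set \<Rightarrow> (real^'n \<Rightarrow> 'n toric_point \<Rightarrow> (complex^'n) \<times> (complex^'n)) \<Rightarrow>
   (real^'n \<Rightarrow> 'n toric_point \<Rightarrow> complex) \<Rightarrow> real^'n \<Rightarrow> 'n toric_point \<Rightarrow> complex" where
  "transpose_nabla W \<xi> \<phi> v p =
     (if v \<in> vertices \<and> p \<in> W \<inter> V v
      then - (cdivergence (\<lambda>w. \<xi> v (chart_inv v w)) (chart v p) * \<phi> v p + dual_connection \<xi> \<phi> v p)
      else 0)"

definition nabla_dist ::
  "'n toric_point set \<Rightarrow> (real^'n \<Rightarrow> 'n toric_point \<Rightarrow> (complex^'n) \<times> (complex^'n)) \<Rightarrow>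
   ((real^'n \<Rightarrow> 'n toric_point \<Rightarrow> complex) \<Rightarrow> complex) \<Rightarrow>
   (real^'n \<Rightarrow> 'n toric_point \<Rightarrow> complex) \<Rightarrow> complex" where
  "nabla_dist W \<xi> \<sigma> = (\<lambda>\<phi>. if \<phi> \<in> test_sections W then \<sigma> (transpose_nabla W \<xi> \<phi>) else 0)"

definition Q_real :: "((real^'n \<Rightarrow> 'n toric_point \<Rightarrow> complex) \<Rightarrow> complex) set" where
  "Q_real = {\<sigma> \<in> distributional_sections X.
     \<forall>W. openin X_top W \<longrightarrow>
       (\<forall>\<xi>\<in>polarized_fields W. nabla_dist W \<xi> (restrict_dist W \<sigma>) = (\<lambda>_. 0))}"

definition moment_fiber :: "real^'n \<Rightarrow> 'n toric_point set" where
  "moment_fiber m = {p \<in> X. moment p = m}"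

end


text \<open>Uniqueness of the coefficients includes linear independence of the family.\<close>

definition is_int_basis :: "(nat \<Rightarrow> int^'n) \<Rightarrow> nat set \<Rightarrow> bool" where
  "is_int_basis b S \<longleftrightarrow>
     (\<forall>z. \<exists>!c :: nat \<Rightarrow> int. (\<forall>r. r \<notin> S \<longrightarrow> c r = 0) \<and> z = (\<Sum>r\<in>S. c r *s b r))"

locale delzant_polytope = toric_data d \<nu> lam ord
  for d :: nat and \<nu> :: "nat \<Rightarrow> int^'n" and lam :: "nat \<Rightarrow> int" and ord :: "real^'n \<Rightarrow> 'n \<Rightarrow> nat" +
  assumes compact_P: "compact P"
    and full_dimensional: "interior P \<noteq> {}"
    and facets: "\<And>r. r < d \<Longrightarrow> {x \<in> P. ell r x = 0} facet_of P"
    and facets_distinct: "inj_on (\<lambda>r. {x \<in> P. ell r x = 0}) {..<d}"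
    and primitive_normals: "\<And>r. r < d \<Longrightarrow> Gcd (range (\<lambda>i. \<nu> r $ i)) = 1"
    and integral_vertices: "vertices \<subseteq> int_lattice"
    and simple_vertices: "\<And>v. v \<in> vertices \<Longrightarrow> card (active v) = CARD('n)"
    and smooth_vertices: "\<And>v. v \<in> vertices \<Longrightarrow> is_int_basis \<nu> (active v)"
    and ord_facets: "\<And>v. v \<in> vertices \<Longrightarrow> bij_betw (ord v) UNIV (active v)"

end

theory Submission
  imports Defs "HOL-Real_Asymp.Real_Asymp"
begin

text \<open>
  In the chart at a vertex, a section of the dual bundle is a function \<open>g\<close> on an open subset of
  \<open>\<complex>\<^sup>n\<close>, and the torus acts by rotations. Write \<open>l\<^sub>j = |w\<^sub>j|\<^sup>2 / 2\<close>. The generator of the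
  rotation in direction \<open>s\<close> is a polarized vector field without divergence, and its transposed
  covariant derivative is minus the operator \<open>D\<^sub>s g(w) = dg(w)(i s w) + i (s \<bullet> l) g(w)\<close> (\<open>twist\<close>).
  Hence a covariantly constant \<open>\<sigma>\<close> annihilates the image of every \<open>D\<^sub>s\<close>
  (\<open>Q_real_inf_act\<close>). The first half of the proof shows, by writing down primitives, that this
  image has a complement with one dimension for each lattice point of \<open>P\<close>.
  
  Integrating the twisted flow of \<open>s\<close> over a full period gives an operator \<open>B\<^sub>s\<close> with
  \<open>D\<^sub>s B\<^sub>s g = (exp(2 \<pi> i (s \<bullet> l)) - 1) g\<close> (\<open>twist_twist_int\<close>). The vertices are integral, so
  globally the image of the \<open>D\<^sub>s\<close> contains the ideal generated by the functions
  \<open>exp(2 \<pi> i x\<^sub>j) - 1\<close>. These have no common zero away from the lattice points, and there every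
  section lies in the ideal (\<open>sigma_away_from_lattice\<close>). Near a lattice point, where \<open>l\<close> takes the
  value \<open>k\<close>, one coordinate is treated at a time: modulo the image, \<open>g\<close> may be replaced by its
  Fourier mode of weight \<open>-k\<^sub>j\<close> in \<open>w\<^sub>j\<close> (\<open>avg_in_twist_image\<close>), and a function of this weight that
  vanishes on \<open>l\<^sub>j = k\<^sub>j\<close> is divisible by \<open>l\<^sub>j - k\<^sub>j\<close>. For \<open>k\<^sub>j > 0\<close> the division is Hadamard's lemma
  (\<open>divide_off_axis\<close>). For \<open>k\<^sub>j = 0\<close>, at the boundary of the polytope, the divisor is
  \<open>|w\<^sub>j|\<^sup>2 / 2\<close> and the quotient is a double integral of the Laplacian of the rotation invariant
  dividend (\<open>divide_on_axis\<close>); this is where derivatives of delta functions transverse to the fiber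
  are excluded. What is left of \<open>g\<close> is its average over the torus \<open>l = k\<close>, times a fixed function
  (\<open>local_reduction\<close>). So \<open>\<sigma>\<close> is a linear combination of the averages \<open>\<delta>\<^sup>m\<close> over the fibers of
  the lattice points \<open>m\<close>, taken against the parallel section along the fiber
  (\<open>Q_real_expansion\<close>).
  
  Conversely, let \<open>\<xi>\<close> be any polarized field. In coordinates the transposed covariant derivative
  along \<open>\<xi>\<close> is a sum of \<open>n\<close> terms, the \<open>j\<close>-th of which is a twisted two-dimensional divergence in
  \<open>w\<^sub>j\<close> of a field that is tangent to the circles around the origin. Its average over the circle
  \<open>l\<^sub>j = k\<^sub>j\<close> vanishes: for \<open>k\<^sub>j > 0\<close> it is the integral of the derivative of a periodic function,
  and for \<open>k\<^sub>j = 0\<close> the divergence of a tangential field is zero at the origin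
  (\<open>circle_average_zero\<close>). Hence \<open>\<delta>\<^sup>m\<close> is covariantly constant (\<open>bs_section_transpose_nabla\<close>). Its
  support is the whole fiber because a bump function at a point of the fiber, multiplied by the
  conjugate of the parallel section, has a positive average.
\<close>

section \<open>Smooth functions\<close>

text \<open>
  Smoothness is graded by the order of differentiability because the product and chain rules
  express derivatives of \<open>f * g\<close> and \<open>f \<circ> g\<close> through undifferentiated factors, which have to be
  covered by the induction hypothesis of the next lower order.
\<close>

primrec diff_upto :: "nat \<Rightarrow> 'a::euclidean_space set \<Rightarrow> ('a \<Rightarrow> 'b::real_normed_vector) \<Rightarrow> bool" where
  "diff_upto 0 S f \<longleftrightarrow> True"
| "diff_upto (Suc k) S f \<longleftrightarrow>
     (\<forall>x\<in>S. f differentiable (at x)) \<and> (\<forall>b\<in>Basis. diff_upto k S (partial_deriv b f))"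

lemma iter_deriv_snoc: "iter_deriv (bs @ [b]) f = iter_deriv bs (partial_deriv b f)"
  by (simp add: iter_deriv_def)

lemma diff_upto_iff_iter_deriv:
  "diff_upto k S f \<longleftrightarrow>
     (\<forall>bs. set bs \<subseteq> Basis \<and> length bs < k \<longrightarrow> (\<forall>x\<in>S. iter_deriv bs f differentiable (at x)))"
proof (induction k arbitrary: f)
  case (Suc k)
  show ?case
  proof
    assume L: "diff_upto (Suc k) S f"
    show "\<forall>bs. set bs \<subseteq> Basis \<and> length bs < Suc k \<longrightarrow> (\<forall>x\<in>S. iter_deriv bs f differentiable (at x))"
    proof (intro allI impI)
      fix bs :: "'a list" assume bs: "set bs \<subseteq> Basis \<and> length bs < Suc k"
      show "\<forall>x\<in>S. iter_deriv bs f differentiable (at x)"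
      proof (cases bs rule: rev_cases)
        case Nil
        then show ?thesis using L by (simp add: iter_deriv_def)
      next
        case (snoc cs b)
        then show ?thesis using L bs Suc.IH by (simp add: iter_deriv_snoc)
      qed
    qed
  next
    assume R: "\<forall>bs. set bs \<subseteq> Basis \<and> length bs < Suc k \<longrightarrow> (\<forall>x\<in>S. iter_deriv bs f differentiable (at x))"
    have "\<forall>x\<in>S. f differentiable (at x)"
      using R[rule_format, of "[]"] by (simp add: iter_deriv_def)
    moreover have "diff_upto k S (partial_deriv b f)" if "b \<in> Basis" for b
      unfolding Suc.IH using R[rule_format, of "_ @ [b]"] that by (auto simp: iter_deriv_snoc)
    ultimately show "diff_upto (Suc k) S f" by simp
  qed
qed simp

lemma smooth_on_iff_ndiff: "smooth_on S f \<longleftrightarrow> (\<forall>k. diff_upto k S f)"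
  unfolding smooth_on_def diff_upto_iff_iter_deriv by blast

lemma smooth_on_diff_uptoI: "(\<And>k. diff_upto k S f) \<Longrightarrow> smooth_on S f"
  by (simp add: smooth_on_iff_ndiff)

lemma smooth_on_diff_uptoD: "smooth_on S f \<Longrightarrow> diff_upto k S f"
  by (simp add: smooth_on_iff_ndiff)

lemma smooth_on_subset: "smooth_on S f \<Longrightarrow> T \<subseteq> S \<Longrightarrow> smooth_on T f"
  unfolding smooth_on_def by blast

lemma smooth_on_differentiable: "smooth_on S f \<Longrightarrow> x \<in> S \<Longrightarrow> f differentiable (at x)"
  using smooth_on_diff_uptoD[of S f "Suc 0"] by simp

lemma smooth_on_has_derivative:
  "smooth_on S f \<Longrightarrow> x \<in> S \<Longrightarrow> (f has_derivative frechet_derivative f (at x)) (at x)"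
  using smooth_on_differentiable frechet_derivative_works by blast

lemma smooth_on_continuous_on: "smooth_on S f \<Longrightarrow> continuous_on S f"
  using smooth_on_differentiable
  by (metis continuous_at_imp_continuous_on differentiable_imp_continuous_within)

lemma smooth_on_partial: "smooth_on S f \<Longrightarrow> b \<in> Basis \<Longrightarrow> smooth_on S (partial_deriv b f)"
  unfolding smooth_on_iff_ndiff by (metis diff_upto.simps(2))

lemma smooth_on_iter_continuous:
  "smooth_on S f \<Longrightarrow> set bs \<subseteq> Basis \<Longrightarrow> continuous_on S (iter_deriv bs f)"
  unfolding smooth_on_def
  by (metis continuous_at_imp_continuous_on differentiable_imp_continuous_within)

lemma frechet_derivative_partial:
  assumes "f differentiable (at x)"
  shows "frechet_derivative f (at x) u = (\<Sum>b\<in>Basis. (u \<bullet> b) *\<^sub>R partial_deriv b f x)"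
proof -
  interpret linear "frechet_derivative f (at x)"
    using assms by (rule linear_frechet_derivative)
  have "frechet_derivative f (at x) u = frechet_derivative f (at x) (\<Sum>b\<in>Basis. (u \<bullet> b) *\<^sub>R b)"
    by (simp add: euclidean_representation)
  then show ?thesis by (simp add: sum scaleR partial_deriv_def)
qed

lemma has_derivative_partial:
  assumes "(f has_derivative F) (at x)"
  shows "partial_deriv b f x = F b"
  using frechet_derivative_at[OF assms] by (simp add: partial_deriv_def)

lemma diff_upto_cong:
  assumes "open S" "\<And>x. x \<in> S \<Longrightarrow> f x = g x" "diff_upto k S f"
  shows "diff_upto k S g"
  using assms(2,3)
proof (induction k arbitrary: f g)
  case (Suc k)
  have 1: "(g has_derivative frechet_derivative f (at x)) (at x)" if "x \<in> S" for x
    by (rule has_derivative_transform_within_open[of f _ _ _ S])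
       (use Suc.prems that \<open>open S\<close> in \<open>auto simp: frechet_derivative_works[symmetric]\<close>)
  have "diff_upto k S (partial_deriv b g)" if "b \<in> Basis" for b
  proof (rule Suc.IH)
    show "partial_deriv b f x = partial_deriv b g x" if "x \<in> S" for x
      using has_derivative_partial[OF 1[OF that]] by (simp add: partial_deriv_def)
    show "diff_upto k S (partial_deriv b f)" using Suc.prems \<open>b \<in> Basis\<close> by simp
  qed
  then show ?case using 1 by (auto simp: differentiable_def)
qed simp

lemma smooth_on_cong:
  assumes "open S" "smooth_on S f" "\<And>x. x \<in> S \<Longrightarrow> f x = g x"
  shows "smooth_on S g"
  using assms diff_upto_cong unfolding smooth_on_iff_ndiff by blast

lemma diff_upto_SucI:
  assumes "open S" "\<And>x. x \<in> S \<Longrightarrow> (f has_derivative F x) (at x)"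
    and "\<And>b. b \<in> Basis \<Longrightarrow> diff_upto k S (\<lambda>x. F x b)"
  shows "diff_upto (Suc k) S f"
proof -
  have "diff_upto k S (partial_deriv b f)" if "b \<in> Basis" for b
    by (rule diff_upto_cong[OF \<open>open S\<close> _ assms(3)[OF that]])
       (use has_derivative_partial assms(2) in metis)
  then show ?thesis using assms(2) by (auto simp: differentiable_def)
qed

lemma diff_upto_SucD: "diff_upto (Suc k) S f \<Longrightarrow> diff_upto k S f"
  by (induction k arbitrary: f) auto

lemma diff_upto_has_derivative:
  "diff_upto (Suc k) S f \<Longrightarrow> x \<in> S \<Longrightarrow> (f has_derivative frechet_derivative f (at x)) (at x)"
  using frechet_derivative_works by auto

lemma diff_upto_const: "open S \<Longrightarrow> diff_upto k S (\<lambda>x. c)"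
proof (induction k arbitrary: c)
  case (Suc k)
  show ?case by (rule diff_upto_SucI[OF Suc.prems has_derivative_const]) (use Suc in simp)
qed simp

lemma diff_upto_bounded_linear_comp:
  assumes "bounded_linear L" "open S" "diff_upto k S f"
  shows "diff_upto k S (\<lambda>x. L (f x))"
  using assms(3)
proof (induction k arbitrary: f)
  case (Suc k)
  show ?case
  proof (rule diff_upto_SucI[OF \<open>open S\<close>])
    show "((\<lambda>x. L (f x)) has_derivative (\<lambda>u. L (frechet_derivative f (at x) u))) (at x)" if "x \<in> S" for x
      by (rule bounded_linear.has_derivative[OF assms(1) diff_upto_has_derivative[OF Suc.prems that]])
    show "diff_upto k S (\<lambda>x. L (frechet_derivative f (at x) b))" if "b \<in> Basis" for b
      using Suc.IH[of "partial_deriv b f"] Suc.prems that by (simp add: partial_deriv_def)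
  qed
qed simp

lemma diff_upto_add:
  assumes "open S" "diff_upto k S f" "diff_upto k S g"
  shows "diff_upto k S (\<lambda>x. f x + g x)"
  using assms(2,3)
proof (induction k arbitrary: f g)
  case (Suc k)
  show ?case
  proof (rule diff_upto_SucI[OF \<open>open S\<close>])
    show "((\<lambda>x. f x + g x) has_derivative
       (\<lambda>u. frechet_derivative f (at x) u + frechet_derivative g (at x) u)) (at x)" if "x \<in> S" for x
      by (intro has_derivative_add diff_upto_has_derivative[OF Suc.prems(1) that] diff_upto_has_derivative[OF Suc.prems(2) that])
    show "diff_upto k S (\<lambda>x. frechet_derivative f (at x) b + frechet_derivative g (at x) b)" if "b \<in> Basis" for b
      using Suc.IH[of "partial_deriv b f" "partial_deriv b g"] Suc.prems that by (simp add: partial_deriv_def)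
  qed
qed simp

lemma diff_upto_sum:
  assumes "open S" "\<And>i. i \<in> I \<Longrightarrow> diff_upto k S (f i)"
  shows "diff_upto k S (\<lambda>x. \<Sum>i\<in>I. f i x)"
  using assms(2)
  by (induction I rule: infinite_finite_induct) (simp_all add: diff_upto_const diff_upto_add \<open>open S\<close>)

lemma diff_upto_bilinear:
  assumes "bounded_bilinear h" "open S" "diff_upto k S f" "diff_upto k S g"
  shows "diff_upto k S (\<lambda>x. h (f x) (g x))"
  using assms(3,4)
proof (induction k arbitrary: f g)
  case (Suc k)
  show ?case
  proof (rule diff_upto_SucI[OF \<open>open S\<close>])
    show "((\<lambda>x. h (f x) (g x)) has_derivative
       (\<lambda>u. h (f x) (frechet_derivative g (at x) u) + h (frechet_derivative f (at x) u) (g x))) (at x)"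
      if "x \<in> S" for x
      by (intro bounded_bilinear.FDERIV[OF assms(1)] diff_upto_has_derivative[OF Suc.prems(1) that] diff_upto_has_derivative[OF Suc.prems(2) that])
    show "diff_upto k S (\<lambda>x. h (f x) (frechet_derivative g (at x) b) + h (frechet_derivative f (at x) b) (g x))"
      if "b \<in> Basis" for b
      using Suc.IH[of f "partial_deriv b g"] Suc.IH[of "partial_deriv b f" g] Suc.prems that
        diff_upto_SucD[OF Suc.prems(1)] diff_upto_SucD[OF Suc.prems(2)]
      by (intro diff_upto_add \<open>open S\<close>) (simp_all add: partial_deriv_def)
  qed
qed simp

lemma diff_upto_compose:
  fixes f :: "'c::euclidean_space \<Rightarrow> 'b::real_normed_vector" and g :: "'a::euclidean_space \<Rightarrow> 'c"
  assumes "open S" "open T" "\<And>x. x \<in> S \<Longrightarrow> g x \<in> T" "diff_upto k T f" "diff_upto k S g"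
  shows "diff_upto k S (\<lambda>x. f (g x))"
  using assms(4,5)
proof (induction k arbitrary: f)
  case (Suc k)
  note g' = diff_upto_has_derivative[OF Suc.prems(2)]
  show ?case
  proof (rule diff_upto_SucI[OF \<open>open S\<close>])
    show "((\<lambda>x. f (g x)) has_derivative
        (\<lambda>u. \<Sum>c\<in>Basis. (frechet_derivative g (at x) u \<bullet> c) *\<^sub>R partial_deriv c f (g x))) (at x)"
      if "x \<in> S" for x
    proof -
      have f': "(f has_derivative frechet_derivative f (at (g x))) (at (g x))"
        by (rule diff_upto_has_derivative[OF Suc.prems(1) assms(3)[OF that]])
      have "((\<lambda>x. f (g x)) has_derivative
          (\<lambda>u. frechet_derivative f (at (g x)) (frechet_derivative g (at x) u))) (at x)"
        by (rule has_derivative_compose[OF g'[OF that] f'])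
      moreover have "f differentiable (at (g x))" using f' by (auto simp: differentiable_def)
      ultimately show ?thesis by (simp add: frechet_derivative_partial)
    qed
    fix b :: 'a assume b: "b \<in> Basis"
    show "diff_upto k S (\<lambda>x. \<Sum>c\<in>Basis. (frechet_derivative g (at x) b \<bullet> c) *\<^sub>R partial_deriv c f (g x))"
    proof (intro diff_upto_sum \<open>open S\<close> diff_upto_bilinear[OF bounded_bilinear_scaleR])
      fix c :: 'c assume c: "c \<in> Basis"
      show "diff_upto k S (\<lambda>x. frechet_derivative g (at x) b \<bullet> c)"
        using diff_upto_bounded_linear_comp[OF bounded_linear_inner_left \<open>open S\<close>, of k "partial_deriv b g" c]
          Suc.prems b by (simp add: partial_deriv_def)
      show "diff_upto k S (\<lambda>x. partial_deriv c f (g x))"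
        using Suc.IH[of "partial_deriv c f"] Suc.prems c diff_upto_SucD[OF Suc.prems(2)] by simp
    qed
  qed
qed simp

lemma diff_upto_id: "open S \<Longrightarrow> diff_upto k S (\<lambda>x. x)"
  by (cases k) (auto intro!: diff_upto_SucI[where F = "\<lambda>_ u. u"] has_derivative_ident diff_upto_const simp del: diff_upto.simps(2))

named_theorems smooth_intros

lemma smooth_const [smooth_intros]: "open S \<Longrightarrow> smooth_on S (\<lambda>x. c)"
  by (simp add: smooth_on_iff_ndiff diff_upto_const)

lemma smooth_id [smooth_intros]: "open S \<Longrightarrow> smooth_on S (\<lambda>x. x)"
  by (simp add: smooth_on_iff_ndiff diff_upto_id)

lemma smooth_bounded_linear:
  "bounded_linear L \<Longrightarrow> open S \<Longrightarrow> smooth_on S f \<Longrightarrow> smooth_on S (\<lambda>x. L (f x))"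
  by (simp add: smooth_on_iff_ndiff diff_upto_bounded_linear_comp)

lemma smooth_bilinear:
  "bounded_bilinear h \<Longrightarrow> open S \<Longrightarrow> smooth_on S f \<Longrightarrow> smooth_on S g \<Longrightarrow> smooth_on S (\<lambda>x. h (f x) (g x))"
  by (simp add: smooth_on_iff_ndiff diff_upto_bilinear)

lemma smooth_add [smooth_intros]:
  "open S \<Longrightarrow> smooth_on S f \<Longrightarrow> smooth_on S g \<Longrightarrow> smooth_on S (\<lambda>x. f x + g x)"
  by (simp add: smooth_on_iff_ndiff diff_upto_add)

lemma smooth_sum [smooth_intros]:
  "open S \<Longrightarrow> (\<And>i. i \<in> I \<Longrightarrow> smooth_on S (f i)) \<Longrightarrow> smooth_on S (\<lambda>x. \<Sum>i\<in>I. f i x)"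
  by (simp add: smooth_on_iff_ndiff diff_upto_sum)

lemmas smooth_mult [smooth_intros] =
  smooth_bilinear[OF bounded_bilinear_mult]
lemmas smooth_scaleR [smooth_intros] =
  smooth_bilinear[OF bounded_bilinear_scaleR]
lemmas smooth_inner [smooth_intros] =
  smooth_bilinear[OF bounded_bilinear_inner]
lemmas smooth_minus [smooth_intros] =
  smooth_bounded_linear[OF bounded_linear_minus[OF bounded_linear_ident]]
lemmas smooth_Re [smooth_intros] = smooth_bounded_linear[OF bounded_linear_Re]
lemmas smooth_Im [smooth_intros] = smooth_bounded_linear[OF bounded_linear_Im]
lemmas smooth_cnj [smooth_intros] = smooth_bounded_linear[OF bounded_linear_cnj]
lemmas smooth_of_real [smooth_intros] = smooth_bounded_linear[OF bounded_linear_of_real]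
lemmas smooth_fst [smooth_intros] = smooth_bounded_linear[OF bounded_linear_fst]
lemmas smooth_snd [smooth_intros] = smooth_bounded_linear[OF bounded_linear_snd]
lemmas smooth_vec_nth [smooth_intros] = smooth_bounded_linear[OF bounded_linear_vec_nth]

lemma smooth_diff [smooth_intros]:
  assumes "open S" "smooth_on S f" "smooth_on S g"
  shows "smooth_on S (\<lambda>x. f x - g x)"
  using smooth_add[OF assms(1,2) smooth_minus[OF assms(1,3)]] by simp

lemma smooth_compose:
  "smooth_on T f \<Longrightarrow> open T \<Longrightarrow> open S \<Longrightarrow> smooth_on S g \<Longrightarrow> (\<And>x. x \<in> S \<Longrightarrow> g x \<in> T) \<Longrightarrow>
   smooth_on S (\<lambda>x. f (g x))"
  unfolding smooth_on_iff_ndiff by (blast intro: diff_upto_compose)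

lemma smooth_power [smooth_intros]:
  fixes f :: "'a::euclidean_space \<Rightarrow> 'b::real_normed_algebra_1"
  shows "open S \<Longrightarrow> smooth_on S f \<Longrightarrow> smooth_on S (\<lambda>x. f x ^ n)"
  by (induction n) (auto intro: smooth_intros)

lemma smooth_prod [smooth_intros]:
  fixes f :: "'i \<Rightarrow> 'a::euclidean_space \<Rightarrow> 'b::{real_normed_algebra,comm_ring_1}"
  assumes "open S" "\<And>i. i \<in> I \<Longrightarrow> smooth_on S (f i)"
  shows "smooth_on S (\<lambda>x. \<Prod>i\<in>I. f i x)"
  using assms(2)
  by (induction I rule: infinite_finite_induct) (simp_all add: smooth_intros \<open>open S\<close>)

lemma smooth_Pair [smooth_intros]:
  fixes f :: "'a::euclidean_space \<Rightarrow> 'b::real_normed_vector" and g :: "'a \<Rightarrow> 'c::real_normed_vector"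
  assumes "open S" "smooth_on S f" "smooth_on S g"
  shows "smooth_on S (\<lambda>x. (f x, g x))"
proof -
  have "bounded_linear (\<lambda>y::'b. (y, 0::'c))" "bounded_linear (\<lambda>y::'c. (0::'b, y))"
    by (intro bounded_linear_Pair bounded_linear_ident bounded_linear_zero)+
  from smooth_add[OF assms(1) smooth_bounded_linear[OF this(1) assms(1,2)]
      smooth_bounded_linear[OF this(2) assms(1,3)]]
  show ?thesis by simp
qed

lemma bounded_linear_axis: "bounded_linear (axis i :: 'b::real_normed_vector \<Rightarrow> 'b^'n)"
proof (rule bounded_linear_intro)
  show "axis i (x + y) = axis i x + axis i (y::'b)" for x y by (simp add: axis_def vec_eq_iff)
  show "axis i (r *\<^sub>R x) = r *\<^sub>R axis i (x::'b)" for r x by (simp add: axis_def vec_eq_iff)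
  show "norm (axis i x) \<le> norm (x::'b) * 1" for x
  proof -
    have "norm (axis i x) \<le> (\<Sum>j\<in>UNIV. norm ((axis i x :: 'b^'n) $ j))"
      by (simp add: norm_vec_def L2_set_le_sum)
    also have "\<dots> = (\<Sum>j\<in>UNIV. if j = i then norm x else 0)"
      by (intro sum.cong) (auto simp: axis_def)
    finally show ?thesis by simp
  qed
qed

lemma vec_sum_axis: "(\<Sum>j\<in>UNIV. axis j (f j)) = (\<chi> j. f j)" for f :: "'n::finite \<Rightarrow> 'b::comm_monoid_add"
  by (simp add: vec_eq_iff axis_def if_distrib cong: if_cong)

lemma smooth_vec [smooth_intros]:
  fixes f :: "'a::euclidean_space \<Rightarrow> 'n::finite \<Rightarrow> 'b::real_normed_vector"
  assumes "open S" "\<And>j. smooth_on S (\<lambda>x. f x j)"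
  shows "smooth_on S (\<lambda>x. \<chi> j. f x j)"
proof -
  have "smooth_on S (\<lambda>x. \<Sum>j\<in>UNIV. axis j (f x j))"
    by (intro smooth_sum smooth_bounded_linear[OF bounded_linear_axis] assms)
  then show ?thesis by (simp add: vec_sum_axis)
qed

subsection \<open>Elementary functions\<close>

lemma diff_upto_real_SucI:
  fixes f f' :: "real \<Rightarrow> 'b::real_normed_vector"
  assumes "open S" "\<And>x. x \<in> S \<Longrightarrow> (f has_vector_derivative f' x) (at x)" "diff_upto k S f'"
  shows "diff_upto (Suc k) S f"
  by (rule diff_upto_SucI[OF assms(1) assms(2)[unfolded has_vector_derivative_def]]) (use assms(3) in auto)

lemma smooth_cis: "smooth_on UNIV cis"
proof (rule smooth_on_diff_uptoI)
  fix k show "diff_upto k UNIV cis"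
  proof (induction k)
    case (Suc k)
    show ?case
    proof (rule diff_upto_real_SucI[where f' = "\<lambda>x. \<i> * cis x"])
      show "(cis has_vector_derivative \<i> * cis x) (at x)" for x
        by (auto intro!: derivative_eq_intros simp: has_vector_derivative_def scaleR_conv_of_real)
      show "diff_upto k UNIV (\<lambda>x. \<i> * cis x)"
        by (rule diff_upto_bounded_linear_comp[OF bounded_linear_mult_right open_UNIV Suc.IH])
    qed simp
  qed simp
qed

lemma smooth_cis_comp [smooth_intros]:
  "open S \<Longrightarrow> smooth_on S f \<Longrightarrow> smooth_on S (\<lambda>x. cis (f x))"
  by (rule smooth_compose[OF smooth_cis]) auto

lemma smooth_inverse_real: "smooth_on (-{0::real}) inverse"
proof (rule smooth_on_diff_uptoI)
  fix k show "diff_upto k (-{0::real}) inverse"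
  proof (induction k)
    case (Suc k)
    show ?case
    proof (rule diff_upto_real_SucI[where f' = "\<lambda>x. - (inverse x * inverse x)"])
      show "(inverse has_vector_derivative - (inverse x * inverse x)) (at x)" if "x \<in> -{0::real}" for x
        using that by (auto intro!: derivative_eq_intros simp: has_real_derivative_iff_has_vector_derivative[symmetric])
      show "diff_upto k (-{0::real}) (\<lambda>x. - (inverse x * inverse x))"
        by (rule diff_upto_bounded_linear_comp[OF bounded_linear_minus[OF bounded_linear_ident]])
           (auto intro!: diff_upto_bilinear[OF bounded_bilinear_mult] Suc.IH open_Compl)
    qed (simp add: open_Compl)
  qed simp
qed

lemma smooth_inverse_comp [smooth_intros]:
  fixes f :: "'a::euclidean_space \<Rightarrow> real"
  shows "open S \<Longrightarrow> smooth_on S f \<Longrightarrow> (\<And>x. x \<in> S \<Longrightarrow> f x \<noteq> 0) \<Longrightarrow> smooth_on S (\<lambda>x. inverse (f x))"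
  by (rule smooth_compose[OF smooth_inverse_real]) auto

lemma smooth_divide_comp [smooth_intros]:
  fixes f :: "'a::euclidean_space \<Rightarrow> real"
  shows "open S \<Longrightarrow> smooth_on S f \<Longrightarrow> smooth_on S g \<Longrightarrow> (\<And>x. x \<in> S \<Longrightarrow> g x \<noteq> 0) \<Longrightarrow> smooth_on S (\<lambda>x. f x / g x)"
  unfolding divide_inverse by (intro smooth_intros)

lemma smooth_sqrt: "smooth_on {0<..} sqrt"
proof (rule smooth_on_diff_uptoI)
  fix k show "diff_upto k {0<..} sqrt"
  proof (induction k)
    case (Suc k)
    show ?case
    proof (rule diff_upto_real_SucI[where f' = "\<lambda>x. inverse (sqrt x) *\<^sub>R (1/2)"])
      show "(sqrt has_vector_derivative inverse (sqrt x) *\<^sub>R (1/2)) (at x)" if "x \<in> {0<..}" for x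
        using that by (auto intro!: derivative_eq_intros simp: has_real_derivative_iff_has_vector_derivative[symmetric])
      show "diff_upto k {0<..} (\<lambda>x. inverse (sqrt x) *\<^sub>R (1/2))"
        by (rule diff_upto_bounded_linear_comp[OF bounded_linear_scaleR_left])
          (auto intro!: diff_upto_compose[where T = "-{0}" and f = inverse] Suc.IH
             smooth_on_diff_uptoD[OF smooth_inverse_real])
    qed simp
  qed simp
qed

lemma smooth_sqrt_comp [smooth_intros]:
  "open S \<Longrightarrow> smooth_on S f \<Longrightarrow> (\<And>x. x \<in> S \<Longrightarrow> 0 < f x) \<Longrightarrow> smooth_on S (\<lambda>x. sqrt (f x))"
  by (rule smooth_compose[OF smooth_sqrt]) auto

lemma smooth_norm_squared [smooth_intros]:
  fixes f :: "'a::euclidean_space \<Rightarrow> 'b::real_inner"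
  assumes "open S" "smooth_on S f"
  shows "smooth_on S (\<lambda>x. (norm (f x))\<^sup>2)"
  unfolding power2_norm_eq_inner by (intro smooth_intros assms)

lemma smooth_norm [smooth_intros]:
  fixes f :: "'a::euclidean_space \<Rightarrow> 'b::real_inner"
  assumes "open S" "smooth_on S f" "\<And>x. x \<in> S \<Longrightarrow> f x \<noteq> 0"
  shows "smooth_on S (\<lambda>x. norm (f x))"
  unfolding norm_eq_sqrt_inner by (intro smooth_intros assms) (use assms(3) in auto)

lemma smooth_inverse_complex [smooth_intros]:
  fixes f :: "'a::euclidean_space \<Rightarrow> complex"
  assumes "open S" "smooth_on S f" "\<And>x. x \<in> S \<Longrightarrow> f x \<noteq> 0"
  shows "smooth_on S (\<lambda>x. inverse (f x))"
proof (rule smooth_on_cong[OF assms(1)])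
  show "smooth_on S (\<lambda>x. cnj (f x) * of_real (inverse ((norm (f x))\<^sup>2)))"
    by (intro smooth_intros assms) (use assms(3) in auto)
  show "cnj (f x) * of_real (inverse ((norm (f x))\<^sup>2)) = inverse (f x)" if "x \<in> S" for x
    using assms(3)[OF that]
    by (metis complex_div_cnj divide_inverse mult.commute mult_1 of_real_inverse of_real_power)
qed

lemma smooth_divide_complex [smooth_intros]:
  fixes f :: "'a::euclidean_space \<Rightarrow> complex"
  shows "open S \<Longrightarrow> smooth_on S f \<Longrightarrow> smooth_on S g \<Longrightarrow> (\<And>x. x \<in> S \<Longrightarrow> g x \<noteq> 0) \<Longrightarrow> smooth_on S (\<lambda>x. f x / g x)"
  unfolding divide_inverse by (intro smooth_intros)

subsection \<open>Cutoff functions\<close>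

text \<open>
  The functions \<open>(1/x)\<^sup>n exp(-1/x)\<close>, extended by \<open>0\<close>, are introduced for all \<open>n\<close> at once since the
  linear span of this family is closed under differentiation; smoothness is then an induction.
\<close>

definition flat_fun :: "nat \<Rightarrow> real \<Rightarrow> real" where
  "flat_fun n x = (if x > 0 then (1 / x) ^ n * exp (- (1 / x)) else 0)"

lemma flat_fun_deriv:
  "(flat_fun n has_real_derivative flat_fun (n + 2) x - real n * flat_fun (n + 1) x) (at x)"
proof -
  consider "x > 0" | "x < 0" | "x = 0" by linarith
  then show ?thesis
  proof cases
    case 1
    have "((\<lambda>x. (1 / x) ^ n * exp (- (1 / x))) has_real_derivative
        flat_fun (n + 2) x - real n * flat_fun (n + 1) x) (at x)"
    proof (rule DERIV_cong)
      have d: "((\<lambda>x. 1 / x) has_real_derivative (- ((1 / x) ^ 2))) (at x)"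
        using 1 by (auto intro!: derivative_eq_intros simp: power2_eq_square)
      show "((\<lambda>x. (1 / x) ^ n * exp (- (1 / x))) has_real_derivative
          (real n * (- ((1 / x) ^ 2) * (1 / x) ^ (n - Suc 0))) * exp (- (1 / x))
          + (exp (- (1 / x)) * - (- ((1 / x) ^ 2))) * (1 / x) ^ n) (at x)"
        by (rule DERIV_mult[OF DERIV_power[OF d] DERIV_fun_exp[OF DERIV_minus[OF d]]])
      show "(real n * (- ((1 / x) ^ 2) * (1 / x) ^ (n - Suc 0))) * exp (- (1 / x))
          + (exp (- (1 / x)) * - (- ((1 / x) ^ 2))) * (1 / x) ^ n
          = flat_fun (n + 2) x - real n * flat_fun (n + 1) x"
        using 1 by (cases n) (simp_all add: flat_fun_def power2_eq_square algebra_simps)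
    qed
    then show ?thesis
      by (rule has_field_derivative_transform_within_open[where S = "{0<..}"]) (use 1 in \<open>auto simp: flat_fun_def\<close>)
  next
    case 2
    have "((\<lambda>x. 0) has_real_derivative flat_fun (n + 2) x - real n * flat_fun (n + 1) x) (at x)"
      using 2 by (auto simp: flat_fun_def)
    then show ?thesis
      by (rule has_field_derivative_transform_within_open[where S = "{..<0}"]) (use 2 in \<open>auto simp: flat_fun_def\<close>)
  next
    case 3
    have R: "((\<lambda>h. (1 / h) ^ n * exp (- (1 / h)) / h) \<longlongrightarrow> 0) (at_right (0::real))"
      by real_asymp
    have "((\<lambda>h. flat_fun n h / h) \<longlongrightarrow> 0) (at_right 0)"
      by (rule Lim_transform_eventually[OF R])
         (auto simp: flat_fun_def eventually_at_right_field intro!: exI[of _ 1])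
    moreover have "((\<lambda>h. flat_fun n h / h) \<longlongrightarrow> 0) (at_left 0)"
      by (rule Lim_transform_eventually[OF tendsto_const])
         (auto simp: flat_fun_def eventually_at_left_field intro!: exI[of _ "-1"])
    ultimately have "((\<lambda>h. flat_fun n h / h) \<longlongrightarrow> 0) (at 0)"
      by (simp add: filterlim_split_at)
    then show ?thesis
      using 3 by (simp add: has_field_derivative_iff flat_fun_def)
  qed
qed

lemma smooth_flat_fun: "smooth_on UNIV (flat_fun n)"
proof (rule smooth_on_diff_uptoI)
  fix k show "diff_upto k UNIV (flat_fun n)"
  proof (induction k arbitrary: n)
    case (Suc k)
    show ?case
    proof (rule diff_upto_real_SucI)
      show "(flat_fun n has_vector_derivative flat_fun (n + 2) x + (- real n) * flat_fun (n + 1) x) (at x)" for x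
        using flat_fun_deriv[of n x] by (simp add: has_real_derivative_iff_has_vector_derivative)
      show "diff_upto k UNIV (\<lambda>x. flat_fun (n + 2) x + (- real n) * flat_fun (n + 1) x)"
        by (intro diff_upto_add diff_upto_bounded_linear_comp[OF bounded_linear_mult_right] Suc.IH) auto
    qed simp
  qed simp
qed

definition cutoff :: "real \<Rightarrow> real" where
  "cutoff x = flat_fun 0 (1 - x) / (flat_fun 0 (1 - x) + flat_fun 0 (x - 1/2))"

lemma flat_fun0_pos: "x > 0 \<Longrightarrow> flat_fun 0 x > 0"
  and flat_fun0_nonneg: "flat_fun 0 x \<ge> 0"
  and flat_fun0_zero: "x \<le> 0 \<Longrightarrow> flat_fun 0 x = 0"
  by (simp_all add: flat_fun_def)

lemma cutoff_denominator: "flat_fun 0 (1 - x) + flat_fun 0 (x - 1/2) > 0"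
proof (cases "x < 1")
  case True
  then show ?thesis using flat_fun0_pos[of "1 - x"] flat_fun0_nonneg[of "x - 1/2"] by linarith
next
  case False
  then show ?thesis using flat_fun0_nonneg[of "1 - x"] flat_fun0_pos[of "x - 1/2"] by linarith
qed

lemma smooth_cutoff: "smooth_on UNIV cutoff"
  unfolding cutoff_def [abs_def]
  by (intro smooth_intros smooth_compose[OF smooth_flat_fun] open_UNIV UNIV_I)
     (use cutoff_denominator in \<open>simp_all add: less_imp_neq[symmetric]\<close>)

lemma smooth_cutoff_comp [smooth_intros]:
  "open S \<Longrightarrow> smooth_on S f \<Longrightarrow> smooth_on S (\<lambda>x. cutoff (f x))"
  by (rule smooth_compose[OF smooth_cutoff]) auto

lemma cutoff_one: "x \<le> 1/2 \<Longrightarrow> cutoff x = 1"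
  using cutoff_denominator[of x] by (simp add: cutoff_def flat_fun0_zero)

lemma cutoff_zero: "x \<ge> 1 \<Longrightarrow> cutoff x = 0"
  by (simp add: cutoff_def flat_fun0_zero)

lemma cutoff_nonneg: "cutoff x \<ge> 0"
  by (simp add: cutoff_def flat_fun0_nonneg)

subsection \<open>Integrals depending on a parameter\<close>

lemma partial_deriv_slice:
  fixes F :: "real \<times> 'a::euclidean_space \<Rightarrow> 'b::real_normed_vector"
  assumes "F differentiable (at (t, w))"
  shows "((\<lambda>w. F (t, w)) has_derivative (\<lambda>u. \<Sum>b\<in>Basis. (u \<bullet> b) *\<^sub>R partial_deriv (0, b) F (t, w))) (at w)"
proof -
  interpret linear "frechet_derivative F (at (t, w))"
    using assms by (rule linear_frechet_derivative)
  have "((\<lambda>w. F (t, w)) has_derivative (\<lambda>u. frechet_derivative F (at (t, w)) (0, u))) (at w)"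
    by (rule has_derivative_compose[OF has_derivative_Pair[OF has_derivative_const has_derivative_ident]])
       (use assms frechet_derivative_works in blast)
  moreover have "frechet_derivative F (at (t, w)) (0, u) = (\<Sum>b\<in>Basis. (u \<bullet> b) *\<^sub>R partial_deriv (0, b) F (t, w))" for u
  proof -
    have "(0::real, u) = (\<Sum>b\<in>Basis. (u \<bullet> b) *\<^sub>R (0, b))"
      by (simp add: prod_eq_iff fst_sum snd_sum euclidean_representation)
    then have "frechet_derivative F (at (t, w)) (0, u)
        = frechet_derivative F (at (t, w)) (\<Sum>b\<in>Basis. (u \<bullet> b) *\<^sub>R (0, b))" by (rule arg_cong)
    then show ?thesis by (simp add: sum scaleR partial_deriv_def del: scaleR_Pair)
  qed
  ultimately show ?thesis by simp
qed

text \<open>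
  The Leibniz rule in several variables. The partial derivatives of a parameter integral are again
  parameter integrals of smooth integrands, whence \<open>smooth_integral_param\<close> by induction on the
  order.
\<close>

lemma integral_param_has_derivative:
  fixes F :: "real \<times> 'a::euclidean_space \<Rightarrow> 'b::banach"
  assumes "open S" "smooth_on (UNIV \<times> S) F" "w \<in> S"
  shows "((\<lambda>w. integral {a..b} (\<lambda>t. F (t, w))) has_derivative
     (\<lambda>u. \<Sum>c\<in>Basis. (u \<bullet> c) *\<^sub>R integral {a..b} (\<lambda>t. partial_deriv (0, c) F (t, w)))) (at w)"
proof -
  obtain e where e: "e > 0" "ball w e \<subseteq> S" using assms(1,3) openE by blast
  define fx :: "'a \<Rightarrow> real \<Rightarrow> 'a \<Rightarrow>\<^sub>L 'b" where "fx x t = (\<Sum>c\<in>Basis. blinfun_scaleR_left (partial_deriv (0, c) F (t, x)) o\<^sub>L blinfun_inner_left c)" for x t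
  have bl: "bounded_linear (\<lambda>v::'b. blinfun_scaleR_left v o\<^sub>L blinfun_inner_left (c::'a))" for c
    by (rule bounded_linear_compose[OF bounded_bilinear.bounded_linear_left[OF bounded_bilinear_blinfun_compose]
          bounded_linear_blinfun_scaleR_left])
  have cont: "continuous_on (UNIV \<times> S) G" if "smooth_on (UNIV \<times> S) G" for G :: "real \<times> 'a \<Rightarrow> 'b"
    using that by (rule smooth_on_continuous_on)
  have pd: "smooth_on (UNIV \<times> S) (partial_deriv (0, c) F)" if "c \<in> Basis" for c
    by (rule smooth_on_partial[OF assms(2)]) (use that in \<open>auto simp: Basis_prod_def\<close>)
  have slice: "(\<lambda>t. G (t, x)) integrable_on {a..b}" if "x \<in> S" "smooth_on (UNIV \<times> S) G" for x and G :: "real \<times> 'a \<Rightarrow> 'b"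
    by (rule integrable_continuous_real, rule continuous_on_compose2[OF cont[OF that(2)]])
       (use that in \<open>auto intro!: continuous_intros\<close>)
  have "((\<lambda>x. integral (cbox a b) (\<lambda>t. F (t, x))) has_derivative blinfun_apply (integral (cbox a b) (fx w)))
    (at w within ball w e)"
  proof (rule leibniz_rule)
    fix x t assume x: "x \<in> ball w e"
    have "F differentiable (at (t, x))"
      by (rule smooth_on_differentiable[OF assms(2)]) (use x e in auto)
    then have "((\<lambda>x. F (t, x)) has_derivative (\<lambda>u. \<Sum>c\<in>Basis. (u \<bullet> c) *\<^sub>R partial_deriv (0, c) F (t, x))) (at x)"
      by (rule partial_deriv_slice)
    moreover have "blinfun_apply (fx x t) = (\<lambda>u. \<Sum>c\<in>Basis. (u \<bullet> c) *\<^sub>R partial_deriv (0, c) F (t, x))"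
      by (rule ext) (simp add: fx_def blinfun.sum_left blinfun_inner_left.rep_eq)
    ultimately show "((\<lambda>x. F (t, x)) has_derivative blinfun_apply (fx x t)) (at x within ball w e)"
      by (simp add: has_derivative_at_withinI)
  next
    fix x assume "x \<in> ball w e"
    then show "(\<lambda>t. F (t, x)) integrable_on cbox a b"
      using slice[OF _ assms(2)] e by auto
  next
    have "continuous_on (ball w e \<times> cbox a b) (\<lambda>z. partial_deriv (0, c) F (snd z, fst z))" if "c \<in> Basis" for c
      by (rule continuous_on_compose2[OF cont[OF pd[OF that]]])
         (use e in \<open>auto intro!: continuous_intros\<close>)
    then show "continuous_on (ball w e \<times> cbox a b) (\<lambda>(x, t). fx x t)"
      unfolding fx_def split_beta
      by (intro continuous_on_sum bounded_linear.continuous_on[OF bl]) auto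
  qed (use e in auto)
  moreover have "blinfun_apply (integral (cbox a b) (fx w)) u
      = (\<Sum>c\<in>Basis. (u \<bullet> c) *\<^sub>R integral {a..b} (\<lambda>t. partial_deriv (0, c) F (t, w)))" for u
  proof -
    have int: "fx w integrable_on {a..b}"
      unfolding fx_def
      by (intro integrable_sum finite_Basis integrable_continuous_real
            bounded_linear.continuous_on[OF bl]
            continuous_on_compose2[OF cont[OF pd]])
         (use assms(3) in \<open>auto intro!: continuous_intros\<close>)
    have "blinfun_apply (integral {a..b} (fx w)) u = integral {a..b} (\<lambda>t. blinfun_apply (fx w t) u)"
      using integral_linear[OF int, of "\<lambda>f. blinfun_apply f u"]
      by (simp add: o_def bounded_linear_intros)
    also have "\<dots> = integral {a..b} (\<lambda>t. \<Sum>c\<in>Basis. (u \<bullet> c) *\<^sub>R partial_deriv (0, c) F (t, w))"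
      by (simp add: fx_def blinfun.sum_left blinfun_inner_left.rep_eq)
    also have "\<dots> = (\<Sum>c\<in>Basis. (u \<bullet> c) *\<^sub>R integral {a..b} (\<lambda>t. partial_deriv (0, c) F (t, w)))"
      by (subst integral_sum) (auto intro!: integrable_cmul slice pd assms(3))
    finally show ?thesis by simp
  qed
  then have "blinfun_apply (integral (cbox a b) (fx w))
      = (\<lambda>u. \<Sum>c\<in>Basis. (u \<bullet> c) *\<^sub>R integral {a..b} (\<lambda>t. partial_deriv (0, c) F (t, w)))" ..
  ultimately have "((\<lambda>w. integral {a..b} (\<lambda>t. F (t, w))) has_derivative
     (\<lambda>u. \<Sum>c\<in>Basis. (u \<bullet> c) *\<^sub>R integral {a..b} (\<lambda>t. partial_deriv (0, c) F (t, w)))) (at w within ball w e)"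
    by simp
  then show ?thesis
    using e at_within_open[of w "ball w e"] by simp
qed

lemma smooth_integral_param:
  fixes F :: "real \<times> 'a::euclidean_space \<Rightarrow> 'b::banach"
  assumes "open S" "smooth_on (UNIV \<times> S) F"
  shows "smooth_on S (\<lambda>w. integral {a..b} (\<lambda>t. F (t, w)))"
proof (rule smooth_on_diff_uptoI)
  fix k show "diff_upto k S (\<lambda>w. integral {a..b} (\<lambda>t. F (t, w)))"
    using assms(2)
  proof (induction k arbitrary: F)
    case (Suc k)
    show ?case
    proof (rule diff_upto_SucI[OF assms(1) integral_param_has_derivative[OF assms(1) Suc.prems]])
      fix b' :: 'a assume b: "b' \<in> Basis"
      have "diff_upto k S (\<lambda>w. integral {a..b} (\<lambda>t. partial_deriv (0, c) F (t, w)))" if "c \<in> Basis" for c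
        by (rule Suc.IH[OF smooth_on_partial[OF Suc.prems]])
           (use that in \<open>auto simp: Basis_prod_def\<close>)
      then show "diff_upto k S (\<lambda>w. \<Sum>c\<in>Basis. (b' \<bullet> c) *\<^sub>R integral {a..b} (\<lambda>t. partial_deriv (0, c) F (t, w)))"
        by (intro diff_upto_sum assms(1) diff_upto_bounded_linear_comp[OF bounded_linear_scaleR_right])
    qed
  qed simp
qed

lemma smooth_integral_param' [smooth_intros]:
  fixes F :: "real \<Rightarrow> 'a::euclidean_space \<Rightarrow> 'b::banach"
  assumes "open S" "smooth_on (UNIV \<times> S) (\<lambda>z. F (fst z) (snd z))"
  shows "smooth_on S (\<lambda>w. integral {a..b} (\<lambda>t. F t w))"
  using smooth_integral_param[OF assms] by simp

section \<open>Twisted rotations of \<open>\<complex>\<^sup>n\<close>\<close>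

text \<open>
  The action coordinate conjugate to the angle of \<open>w\<^sub>j\<close>.
\<close>

definition act :: "'n \<Rightarrow> complex^'n \<Rightarrow> real" where
  "act j w = (cmod (w $ j))\<^sup>2 / 2"

definition actv :: "complex^'n \<Rightarrow> real^'n" where
  "actv w = (\<chi> j. act j w)"

definition rot :: "real^'n \<Rightarrow> complex^'n \<Rightarrow> complex^'n" where
  "rot s w = (\<chi> j. cis (s $ j) * w $ j)"

definition rot_field :: "real^'n \<Rightarrow> complex^'n \<Rightarrow> complex^'n" where
  "rot_field s w = (\<chi> j. \<i> * of_real (s $ j) * w $ j)"

definition upd :: "'n \<Rightarrow> complex \<Rightarrow> complex^'n \<Rightarrow> complex^'n" where
  "upd j z w = (\<chi> i. if i = j then z else w $ i)"

text \<open>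
  The dual connection along the generator of the rotation \<open>s\<close>, in the unitary frame of a vertex
  chart; see \<open>transpose_nabla_generator_field\<close>.
\<close>

definition twist :: "real^'n \<Rightarrow> (complex^'n \<Rightarrow> complex) \<Rightarrow> complex^'n \<Rightarrow> complex" where
  "twist s g w = frechet_derivative g (at w) (rot_field s w) + \<i> * of_real (s \<bullet> actv w) * g w"

definition twist_int :: "real^'n \<Rightarrow> (complex^'n \<Rightarrow> complex) \<Rightarrow> complex^'n \<Rightarrow> complex" where
  "twist_int s g w = integral {0..2*pi} (\<lambda>t. cis (t * (s \<bullet> actv w)) * g (rot (t *\<^sub>R s) w))"

lemma act_nonneg: "act j w \<ge> 0"
  by (simp add: act_def)

lemma rot_nth [simp]: "rot s w $ j = cis (s $ j) * w $ j"
  by (simp add: rot_def)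

lemma upd_nth [simp]: "upd j z w $ i = (if i = j then z else w $ i)"
  by (simp add: upd_def)

lemma actv_nth [simp]: "actv w $ j = act j w"
  by (simp add: actv_def)

lemma act_rot [simp]: "act j (rot s w) = act j w"
  by (simp add: act_def norm_mult)

lemma actv_rot [simp]: "actv (rot s w) = actv w"
  by (simp add: vec_eq_iff)

lemma act_upd: "act i (upd j z w) = (if i = j then (cmod z)\<^sup>2 / 2 else act i w)"
  by (simp add: act_def)

lemma bounded_act:
  fixes S :: "(complex^'n) set"
  assumes "\<And>w j. w \<in> S \<Longrightarrow> act j w \<le> b j"
  shows "bounded S"
proof -
  have "norm w \<le> (\<Sum>j\<in>UNIV. sqrt (2 * b j))" if "w \<in> S" for w
  proof -
    have "norm w \<le> (\<Sum>j\<in>UNIV. norm (w $ j))" by (simp add: norm_vec_def L2_set_le_sum)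
    also have "\<dots> \<le> (\<Sum>j\<in>UNIV. sqrt (2 * b j))"
      using assms[OF that] by (intro sum_mono real_le_rsqrt) (simp add: act_def mult.commute)
    finally show ?thesis .
  qed
  then show ?thesis unfolding bounded_iff by blast
qed

lemma rot_rot: "rot s (rot t w) = rot (s + t) w"
  by (simp add: vec_eq_iff cis_mult[symmetric] mult.assoc)

lemma rot_zero [simp]: "rot 0 w = w"
  by (simp add: vec_eq_iff)

lemma upd_eq: "upd j z w = w + axis j (z - w $ j)"
  by (simp add: vec_eq_iff axis_def)

lemma rot_field_axis: "rot_field (axis j 1) w = axis j (\<i> * w $ j)"
  by (simp add: rot_field_def vec_eq_iff axis_def)

lemma inner_axis_actv [simp]: "axis j 1 \<bullet> actv w = act j w"
  by (simp add: inner_axis')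

lemma smooth_act [smooth_intros]:
  "open S \<Longrightarrow> smooth_on S f \<Longrightarrow> smooth_on S (\<lambda>x. act j (f x))"
  unfolding act_def by (intro smooth_intros) auto

lemma smooth_actv [smooth_intros]:
  "open S \<Longrightarrow> smooth_on S f \<Longrightarrow> smooth_on S (\<lambda>x. actv (f x))"
  unfolding actv_def by (intro smooth_intros) auto

lemma smooth_rot [smooth_intros]:
  "open S \<Longrightarrow> smooth_on S f \<Longrightarrow> smooth_on S g \<Longrightarrow> smooth_on S (\<lambda>x. rot (f x) (g x))"
  unfolding rot_def by (intro smooth_intros) auto

lemma smooth_rot_field [smooth_intros]:
  "open S \<Longrightarrow> smooth_on S g \<Longrightarrow> smooth_on S (\<lambda>x. rot_field s (g x))"
  unfolding rot_field_def by (intro smooth_intros) auto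

lemma smooth_upd [smooth_intros]:
  "open S \<Longrightarrow> smooth_on S f \<Longrightarrow> smooth_on S g \<Longrightarrow> smooth_on S (\<lambda>x. upd j (f x) (g x))"
  unfolding upd_eq by (intro smooth_intros smooth_bounded_linear[OF bounded_linear_axis]) auto

lemma smooth_frechet [smooth_intros]:
  assumes "open S" "smooth_on S g" "smooth_on S X"
  shows "smooth_on S (\<lambda>w. frechet_derivative g (at w) (X w))"
proof (rule smooth_on_cong[OF assms(1)])
  show "smooth_on S (\<lambda>w. \<Sum>b\<in>Basis. (X w \<bullet> b) *\<^sub>R partial_deriv b g w)"
    by (intro smooth_intros smooth_on_partial assms) auto
  show "(\<Sum>b\<in>Basis. (X w \<bullet> b) *\<^sub>R partial_deriv b g w) = frechet_derivative g (at w) (X w)" if "w \<in> S" for w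
    by (rule frechet_derivative_partial[symmetric, OF smooth_on_differentiable[OF assms(2) that]])
qed

lemma smooth_twist [smooth_intros]:
  "open S \<Longrightarrow> smooth_on S g \<Longrightarrow> smooth_on S (twist s g)"
  unfolding twist_def[abs_def] by (intro smooth_intros) auto

lemma linear_rot: "bounded_linear (rot s)"
proof -
  have "linear (rot s)"
    by (rule linearI) (auto simp: vec_eq_iff algebra_simps)
  then show ?thesis by (rule linear_conv_bounded_linear[THEN iffD1])
qed

lemma rot_rot_field: "rot r (rot_field s w) = rot_field s (rot r w)"
  by (simp add: vec_eq_iff rot_field_def)

lemma rot_has_vector_derivative:
  "((\<lambda>t. rot (t *\<^sub>R s) w) has_vector_derivative rot_field s (rot (t *\<^sub>R s) w)) (at t)"
proof -
  have "((\<lambda>t. cis (t * s $ j) * w $ j) has_vector_derivative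
        \<i> * of_real (s $ j) * (cis (t * s $ j) * w $ j)) (at t)" for j
    unfolding has_vector_derivative_def
    by (auto intro!: derivative_eq_intros simp: scaleR_conv_of_real)
  then have "((\<lambda>t. \<Sum>j\<in>UNIV. axis j (cis (t * s $ j) * w $ j)) has_vector_derivative
      (\<Sum>j\<in>UNIV. axis j (\<i> * of_real (s $ j) * (cis (t * s $ j) * w $ j)))) (at t)"
    by (intro has_vector_derivative_sum bounded_linear.has_vector_derivative[OF bounded_linear_axis])
  then show ?thesis by (simp add: rot_def rot_field_def vec_sum_axis)
qed

lemma chain_vector_derivative:
  fixes g :: "'a::real_normed_vector \<Rightarrow> 'b::real_normed_vector"
  assumes "(c has_vector_derivative u) (at t)" "g differentiable (at (c t))"
  shows "((\<lambda>t. g (c t)) has_vector_derivative frechet_derivative g (at (c t)) u) (at t)"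
proof -
  have g: "(g has_derivative frechet_derivative g (at (c t))) (at (c t))"
    using assms(2) frechet_derivative_works by blast
  interpret linear "frechet_derivative g (at (c t))"
    using assms(2) by (rule linear_frechet_derivative)
  show ?thesis
    using has_derivative_compose[OF assms(1)[unfolded has_vector_derivative_def] g]
    by (simp add: has_vector_derivative_def scaleR)
qed

text \<open>
  \<open>twist s\<close> generates the parallel transport along the orbits: the factor \<open>cis (t * (s \<bullet> actv w))\<close> is
  the holonomy of the connection form, which is constant along the flow since rotations preserve the
  action coordinates.
\<close>

lemma flow_derivative:
  assumes "g differentiable (at (rot (t *\<^sub>R s) w))"
  shows "((\<lambda>t. cis (t * (s \<bullet> actv w)) * g (rot (t *\<^sub>R s) w)) has_vector_derivative
     cis (t * (s \<bullet> actv w)) * twist s g (rot (t *\<^sub>R s) w)) (at t)"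
proof -
  let ?c = "s \<bullet> actv w"
  have "((\<lambda>t. cis (t * ?c)) has_vector_derivative \<i> * of_real ?c * cis (t * ?c)) (at t)"
    unfolding has_vector_derivative_def
    by (auto intro!: derivative_eq_intros simp: scaleR_conv_of_real)
  from has_vector_derivative_mult[OF this chain_vector_derivative[OF rot_has_vector_derivative assms]]
  show ?thesis by (simp add: twist_def algebra_simps)
qed

lemma flow_derivative_0:
  assumes "g differentiable (at w)"
  shows "((\<lambda>t. cis (t * (s \<bullet> actv w)) * g (rot (t *\<^sub>R s) w)) has_vector_derivative twist s g w) (at 0)"
  using flow_derivative[of g 0 s w] assms by simp

lemma invariant_frechet:
  assumes "g differentiable (at w)" "\<And>t. g (rot (t *\<^sub>R s) w) = g w"
  shows "frechet_derivative g (at w) (rot_field s w) = 0"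
proof -
  have "((\<lambda>t. g (rot (t *\<^sub>R s) w)) has_vector_derivative frechet_derivative g (at w) (rot_field s w)) (at 0)"
    using chain_vector_derivative[OF rot_has_vector_derivative[of s w 0], of g] assms(1) by simp
  then have "((\<lambda>t. g w) has_vector_derivative frechet_derivative g (at w) (rot_field s w)) (at (0::real))"
    by (simp add: assms(2))
  then show ?thesis
    using has_vector_derivative_const vector_derivative_unique_at by blast
qed

lemma twist_mult_invariant:
  assumes "a differentiable (at w)" "g differentiable (at w)" "\<And>t. a (rot (t *\<^sub>R s) w) = a w"
  shows "twist s (\<lambda>w. a w * g w) w = a w * twist s g w"
proof -
  have "((\<lambda>w. a w * g w) has_derivative
      (\<lambda>h. a w * frechet_derivative g (at w) h + frechet_derivative a (at w) h * g w)) (at w)"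
    by (rule has_derivative_mult[OF assms(1,2)[unfolded frechet_derivative_works]])
  then have "frechet_derivative (\<lambda>w. a w * g w) (at w)
     = (\<lambda>h. a w * frechet_derivative g (at w) h + frechet_derivative a (at w) h * g w)"
    by (rule frechet_derivative_at[symmetric])
  then show ?thesis
    by (simp add: twist_def invariant_frechet[OF assms(1,3)] algebra_simps)
qed

lemma twist_rot:
  assumes "g differentiable (at (rot r w))"
  shows "twist s (\<lambda>w. g (rot r w)) w = twist s g (rot r w)"
proof -
  have "((\<lambda>w. g (rot r w)) has_derivative (\<lambda>h. frechet_derivative g (at (rot r w)) (rot r h))) (at w)"
    by (rule has_derivative_compose[OF bounded_linear_imp_has_derivative[OF linear_rot]])
       (rule assms[unfolded frechet_derivative_works])
  then have "frechet_derivative (\<lambda>w. g (rot r w)) (at w) = (\<lambda>h. frechet_derivative g (at (rot r w)) (rot r h))"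
    by (rule frechet_derivative_at[symmetric])
  then show ?thesis by (simp add: twist_def rot_rot_field)
qed

lemma twist_integral:
  fixes F :: "real \<times> (complex^'n) \<Rightarrow> complex"
  assumes "open S" "smooth_on (UNIV \<times> S) F" "w \<in> S"
  shows "twist s (\<lambda>w. integral {a..b} (\<lambda>t. F (t, w))) w = integral {a..b} (\<lambda>t. twist s (\<lambda>w. F (t, w)) w)"
proof -
  let ?u = "rot_field s w" and ?c = "\<i> * of_real (s \<bullet> actv w) :: complex"
  have int: "(\<lambda>t. G (t, w)) integrable_on {a..b}" if "smooth_on (UNIV \<times> S) G" for G :: "_ \<Rightarrow> complex"
    by (rule integrable_continuous_real, rule continuous_on_compose2[OF smooth_on_continuous_on[OF that]])
       (use assms in \<open>auto intro!: continuous_intros\<close>)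
  have pd: "smooth_on (UNIV \<times> S) (partial_deriv (0, c) F)" if "c \<in> Basis" for c
    by (rule smooth_on_partial[OF assms(2)]) (use that in \<open>auto simp: Basis_prod_def\<close>)
  have fr: "frechet_derivative (\<lambda>w. F (t, w)) (at w) ?u
      = (\<Sum>c\<in>Basis. (?u \<bullet> c) *\<^sub>R partial_deriv (0, c) F (t, w))" for t
  proof -
    have "F differentiable (at (t, w))"
      by (rule smooth_on_differentiable[OF assms(2)]) (use assms(3) in auto)
    from frechet_derivative_at[OF partial_deriv_slice[OF this], symmetric] show ?thesis by (rule fun_cong)
  qed
  have "twist s (\<lambda>w. integral {a..b} (\<lambda>t. F (t, w))) w =
      (\<Sum>c\<in>Basis. (?u \<bullet> c) *\<^sub>R integral {a..b} (\<lambda>t. partial_deriv (0, c) F (t, w)))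
      + ?c * integral {a..b} (\<lambda>t. F (t, w))"
    unfolding twist_def frechet_derivative_at[OF integral_param_has_derivative[OF assms, of a b], symmetric] ..
  also have "\<dots> = integral {a..b} (\<lambda>t. \<Sum>c\<in>Basis. (?u \<bullet> c) *\<^sub>R partial_deriv (0, c) F (t, w))
      + integral {a..b} (\<lambda>t. ?c * F (t, w))"
    by (subst integral_sum) (auto intro!: integrable_cmul int[OF pd])
  also have "\<dots> = integral {a..b} (\<lambda>t. (\<Sum>c\<in>Basis. (?u \<bullet> c) *\<^sub>R partial_deriv (0, c) F (t, w)) + ?c * F (t, w))"
    by (rule integral_add[symmetric])
       (auto intro!: integrable_sum integrable_cmul integrable_on_mult_right int[OF pd] int[OF assms(2)])
  finally show ?thesis by (simp add: twist_def fr)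
qed

lemma smooth_twist_int_joint:
  assumes "open S" "smooth_on S g" "\<And>w r. w \<in> S \<Longrightarrow> rot r w \<in> S"
  shows "smooth_on (UNIV \<times> S) (\<lambda>z. cis (fst z * (s \<bullet> actv (snd z))) * g (rot (fst z *\<^sub>R s) (snd z)))"
  by (intro smooth_intros smooth_compose[OF assms(2)]) (auto intro!: assms open_Times)

lemma smooth_twist_int:
  assumes "open S" "smooth_on S g" "\<And>w r. w \<in> S \<Longrightarrow> rot r w \<in> S"
  shows "smooth_on S (twist_int s g)"
  unfolding twist_int_def[abs_def] by (intro smooth_integral_param' smooth_twist_int_joint assms)

text \<open>
  Applying the generator of a flow to the integral of the flow over a period gives the difference of
  the end points. The two end points differ by the holonomy around the orbit, so the result measures
  the failure of the orbit to satisfy the Bohr-Sommerfeld condition.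
\<close>

lemma twist_twist_int:
  assumes "open S" "smooth_on S g" "\<And>w r. w \<in> S \<Longrightarrow> rot r w \<in> S" "w \<in> S"
  shows "twist s (twist_int s g) w = cis (2 * pi * (s \<bullet> actv w)) * g (rot ((2 * pi) *\<^sub>R s) w) - g w"
proof -
  let ?F = "\<lambda>z. cis (fst z * (s \<bullet> actv (snd z))) * g (rot (fst z *\<^sub>R s) (snd z))"
  let ?c = "s \<bullet> actv w"
  have gd: "g differentiable (at (rot r w))" for r
    using smooth_on_differentiable assms by blast
  have "twist s (twist_int s g) w = integral {0..2*pi} (\<lambda>t. twist s (\<lambda>w. ?F (t, w)) w)"
    using twist_integral[OF assms(1) smooth_twist_int_joint[OF assms(1-3)] assms(4), of s 0 "2*pi"]
    by (simp add: twist_int_def[abs_def])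
  also have "\<dots> = integral {0..2*pi} (\<lambda>t. cis (t * ?c) * twist s g (rot (t *\<^sub>R s) w))"
  proof (intro arg_cong2[where f = integral] refl ext)
    fix t
    have "(\<lambda>w. cis (t * (s \<bullet> actv w))) differentiable (at w)"
      by (rule smooth_on_differentiable[of UNIV]) (auto intro!: smooth_intros)
    moreover have "(\<lambda>w. g (rot (t *\<^sub>R s) w)) differentiable (at w)"
      by (rule smooth_on_differentiable[of S])
         (auto intro!: smooth_intros smooth_compose[OF assms(2)] assms)
    ultimately show "twist s (\<lambda>w. ?F (t, w)) w = cis (t * ?c) * twist s g (rot (t *\<^sub>R s) w)"
      by (simp add: twist_mult_invariant twist_rot gd)
  qed
  also have "\<dots> = cis (2 * pi * ?c) * g (rot ((2 * pi) *\<^sub>R s) w) - cis (0 * ?c) * g (rot (0 *\<^sub>R s) w)"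
    by (rule integral_unique, rule fundamental_theorem_of_calculus)
       (use gd in \<open>auto intro!: has_vector_derivative_at_within flow_derivative\<close>)
  finally show ?thesis by simp
qed

section \<open>Reduction modulo twisted derivatives near a lattice point\<close>

lemma periodic_integral_shift:
  fixes f :: "real \<Rightarrow> complex"
  assumes "continuous_on UNIV f" "\<And>t. f (t + 2 * pi) = f t"
  shows "integral {0..2*pi} (\<lambda>t. f (t + a)) = integral {0..2*pi} f"
proof -
  define a' where "a' = a - 2 * pi * of_int \<lfloor>a / (2 * pi)\<rfloor>"
  have a': "0 \<le> a'" "a' \<le> 2 * pi"
  proof -
    have "a' = 2 * pi * frac (a / (2 * pi))" by (simp add: a'_def frac_def algebra_simps)
    then show "0 \<le> a'" "a' \<le> 2 * pi"
      using frac_ge_0[of "a / (2*pi)"] frac_lt_1[of "a / (2*pi)"] by (auto simp: mult_le_cancel_left1)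
  qed
  have nat: "f (t + 2 * pi * of_nat k) = f t" for t k
  proof (induction k)
    case (Suc k)
    then show ?case using assms(2)[of "t + 2 * pi * of_nat k"] by (simp add: algebra_simps)
  qed simp
  have int: "f (t + 2 * pi * of_int k) = f t" for t k
  proof (cases "k \<ge> 0")
    case True
    then show ?thesis using nat[of t "nat k"] by simp
  next
    case False
    then show ?thesis using nat[of "t + 2 * pi * of_int k" "nat (-k)"] by simp
  qed
  have fint: "f integrable_on {x..y}" for x y
    by (rule integrable_continuous_real, rule continuous_on_subset[OF assms(1)]) simp
  have sh: "integral {x..y} (\<lambda>t. f (t + b)) = integral {x + b..y + b} f" for x y b
    using integral_shift[of x b y f] continuous_on_subset[OF assms(1)]
    by (simp add: o_def add.commute)
  have "f (t + a) = f (t + a')" for t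
    using int[of "t + a'" "\<lfloor>a / (2 * pi)\<rfloor>"] by (simp add: a'_def)
  then have "integral {0..2*pi} (\<lambda>t. f (t + a)) = integral {0 + a'..2*pi + a'} f"
    by (simp add: sh)
  also have "\<dots> = integral {a'..2*pi} f + integral {2*pi..2*pi + a'} f"
    using Henstock_Kurzweil_Integration.integral_combine[of a' "2*pi" "2*pi+a'" f] a' fint by (simp add: add.commute)
  also have "integral {2*pi..2*pi + a'} f = integral {0..a'} f"
    using sh[of 0 a' "2*pi"] assms(2) by (simp add: add.commute)
  also have "integral {a'..2*pi} f + integral {0..a'} f = integral {0..2*pi} f"
    using Henstock_Kurzweil_Integration.integral_combine[of 0 a' "2*pi" f] a' fint by (simp add: add.commute)
  finally show ?thesis .
qed

text \<open>
  For functions that are given by a formula on one open set and vanish on another.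
\<close>

lemma smooth_on_zero_off:
  assumes "open U" "open V" "U \<union> V = S" "smooth_on U f" "\<And>w. w \<in> V \<Longrightarrow> f w = 0"
  shows "smooth_on S f"
proof -
  have "smooth_on V f"
    by (rule smooth_on_cong[OF assms(2) smooth_const[OF assms(2), of 0]]) (simp add: assms(5))
  then show ?thesis using assms(3,4) unfolding smooth_on_def by auto
qed

lemma partial_deriv_zero:
  assumes "open U" "w \<in> U" "\<And>w. w \<in> U \<Longrightarrow> f w = 0"
  shows "partial_deriv b f w = 0"
proof -
  have "(f has_derivative (\<lambda>_. 0)) (at w)"
    by (rule has_derivative_transform_within_open[OF has_derivative_const assms(1,2)]) (simp add: assms(3))
  from has_derivative_partial[OF this] show ?thesis .
qed

lemma continuous_act [continuous_intros]: "continuous_on S (act j)"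
  unfolding act_def[abs_def] by (intro continuous_intros) simp

text \<open>
  Smooth functions supported where all action coordinates are within \<open>e\<close> of the lattice point \<open>k\<close>.
\<close>

definition near :: "('n \<Rightarrow> nat) \<Rightarrow> real \<Rightarrow> (complex^'n \<Rightarrow> complex) set" where
  "near k e = {g. smooth_on UNIV g \<and> (\<forall>w. g w \<noteq> 0 \<longrightarrow> (\<forall>j. \<bar>act j w - real (k j)\<bar> \<le> e))}"

lemma nearD: "g \<in> near k e \<Longrightarrow> smooth_on UNIV g"
  by (simp add: near_def)

lemma near_zero: "g \<in> near k e \<Longrightarrow> \<bar>act j w - real (k j)\<bar> > e \<Longrightarrow> g w = 0"
  unfolding near_def using linorder_not_less by blast

lemma nearI:
  assumes "smooth_on UNIV g" "\<And>w j. \<bar>act j w - real (k j)\<bar> > e \<Longrightarrow> g w = 0"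
  shows "g \<in> near k e"
  using assms unfolding near_def by (auto simp: not_le[symmetric])

lemma near_lincomb:
  assumes "f \<in> near k e" "g \<in> near k e"
  shows "(\<lambda>w. a * f w + b * g w) \<in> near k e"
  by (rule nearI) (auto intro!: smooth_intros nearD[OF assms(1)] nearD[OF assms(2)]
      simp: near_zero[OF assms(1)] near_zero[OF assms(2)])

text \<open>
  The function \<open>(exp(2 \<pi> i s) - 1) / s\<close>, written as an integral so that it is visibly smooth
  at \<open>0\<close>. It has no zero in \<open>|s| < 1\<close>; there the ideals of \<open>exp(2 \<pi> i s) - 1\<close> and of \<open>s\<close> agree.
\<close>

definition expquot :: "real \<Rightarrow> complex" where
  "expquot s = integral {0..1} (\<lambda>t. 2 * pi * \<i> * cis (2 * pi * s * t))"

lemma smooth_expquot: "smooth_on UNIV expquot"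
  unfolding expquot_def[abs_def]
  by (intro smooth_intros) (auto intro!: open_Times)

lemma expquot_eq: "of_real s * expquot s = cis (2 * pi * s) - 1"
proof -
  have "integral {0..1} (\<lambda>t. of_real s * (2 * pi * \<i> * cis (2 * pi * s * t)))
    = cis (2 * pi * s * 1) - cis (2 * pi * s * 0)"
    by (rule integral_unique, rule fundamental_theorem_of_calculus)
       (auto intro!: derivative_eq_intros simp: has_vector_derivative_def scaleR_conv_of_real)
  then show ?thesis by (simp add: expquot_def)
qed

lemma expquot_nonzero:
  assumes "\<bar>s\<bar> < 1" shows "expquot s \<noteq> 0"
proof
  assume 0: "expquot s = 0"
  show False
  proof (cases "s = 0")
    case True
    then show False using 0 by (simp add: expquot_def)
  next
    case False
    have "cis (2 * pi * s) = 1" using expquot_eq[of s] 0 by simp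
    then have "cos (2 * pi * s) = 1" by (metis cis.sel(1) one_complex.sel(1))
    then obtain n :: int where "2 * pi * s = of_int n * 2 * pi" by (auto simp: cos_one_2pi_int)
    then have "s = of_int n" by simp
    then show False using assms False by simp
  qed
qed

lemma rot_axis_2pi: "rot ((2 * pi) *\<^sub>R axis j 1) w = w"
  by (simp add: vec_eq_iff axis_def)

lemma rot_axis: "rot (t *\<^sub>R axis j 1) w = upd j (cis t * w $ j) w"
  by (simp add: vec_eq_iff axis_def)

text \<open>
  Since \<open>k j\<close> is an integer, \<open>twist_twist_int\<close> multiplies by \<open>exp(2 \<pi> i (act j w - k j)) - 1\<close>,
  which is \<open>act j w - k j\<close> up to an invertible factor. The primitive is the period integral of the
  quotient by that factor.
\<close>

lemma ideal_in_twist_image: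
  assumes \<eta>: "\<eta> \<in> near k e" and e: "e < 1"
  shows "\<exists>\<psi> \<in> near k e. \<forall>w. twist (axis j 1) \<psi> w = of_real (act j w - real (k j)) * \<eta> w"
proof -
  define f where "f w = \<eta> w / expquot (act j w - real (k j))" for w
  have sf: "smooth_on UNIV f"
  proof (rule smooth_on_zero_off)
    show "open {w. \<bar>act j w - real (k j)\<bar> < 1}" "open {w. \<bar>act j w - real (k j)\<bar> > e}"
      by (intro open_Collect_less continuous_intros)+
    then show "smooth_on {w. \<bar>act j w - real (k j)\<bar> < 1} f"
      unfolding f_def[abs_def]
      by (intro smooth_divide_complex smooth_compose[OF smooth_expquot] smooth_intros
          smooth_on_subset[OF nearD[OF \<eta>]]) (auto dest: expquot_nonzero)
    show "f w = 0" if "w \<in> {w. \<bar>act j w - real (k j)\<bar> > e}" for w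
      using near_zero[OF \<eta>] that by (simp add: f_def)
  qed (use e in auto)
  have fz: "f w = 0" if "\<bar>act i w - real (k i)\<bar> > e" for w i
    using near_zero[OF \<eta> that] by (simp add: f_def)
  let ?\<psi> = "twist_int (axis j 1) f"
  have "?\<psi> \<in> near k e"
    by (rule nearI) (auto intro!: smooth_twist_int sf simp: twist_int_def fz)
  moreover have "twist (axis j 1) ?\<psi> w = of_real (act j w - real (k j)) * \<eta> w" for w
  proof -
    have "twist (axis j 1) ?\<psi> w = (cis (2 * pi * act j w) - 1) * f w"
      by (subst twist_twist_int[OF open_UNIV sf]) (simp_all add: rot_axis_2pi left_diff_distrib)
    also have "cis (2 * pi * act j w) = cis (2 * pi * (act j w - real (k j)))"
    proof -
      have "cis (2 * pi * (act j w - real (k j))) = cis (2 * pi * act j w) / cis (2 * pi * real (k j))"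
        by (simp add: cis_divide algebra_simps)
      then show ?thesis by (simp add: cis_multiple_2pi)
    qed
    also have "(cis (2 * pi * (act j w - real (k j))) - 1) * f w = of_real (act j w - real (k j)) * \<eta> w"
    proof (cases "\<bar>act j w - real (k j)\<bar> \<le> e")
      case True
      then show ?thesis
        using expquot_nonzero[of "act j w - real (k j)"] e by (simp add: f_def expquot_eq[symmetric])
    next
      case False
      then show ?thesis using near_zero[OF \<eta>, of j w] fz[of j w] by simp
    qed
    finally show ?thesis .
  qed
  ultimately show ?thesis by blast
qed

text \<open>
  The projection to functions of weight \<open>-k\<close> under rotations of the \<open>j\<close>-th coordinate; compare
  \<open>avg_rot\<close>.
\<close>

definition avg :: "nat \<Rightarrow> 'n \<Rightarrow> (complex^'n \<Rightarrow> complex) \<Rightarrow> complex^'n \<Rightarrow> complex" where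
  "avg k j g w = (1 / (2 * pi)) * integral {0..2*pi} (\<lambda>t. cis (real k * t) * g (rot (t *\<^sub>R axis j 1) w))"

lemma smooth_avg:
  assumes "smooth_on UNIV g" shows "smooth_on UNIV (avg k j g)"
  unfolding avg_def[abs_def]
  by (intro smooth_intros smooth_compose[OF assms]) (auto intro!: open_Times)

lemma avg_near: "g \<in> near k e \<Longrightarrow> avg (k j) j g \<in> near k e"
  by (rule nearI) (auto intro!: smooth_avg[OF nearD] simp: avg_def near_zero)

lemma avg_rot:
  assumes "smooth_on UNIV g"
  shows "avg k j g (rot (s *\<^sub>R axis j 1) w) = cis (- (real k * s)) * avg k j g w"
proof -
  let ?f = "\<lambda>t. cis (real k * t) * g (rot (t *\<^sub>R axis j 1) w)"
  have cont: "continuous_on UNIV ?f"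
    by (intro smooth_on_continuous_on smooth_intros smooth_compose[OF assms]) auto
  have period: "?f (t + 2 * pi) = ?f t" for t
  proof -
    have "cis (real k * (t + 2 * pi)) = cis (real k * t) * cis (2 * pi * real k)"
      by (simp add: cis_mult algebra_simps)
    moreover have "rot ((t + 2 * pi) *\<^sub>R axis j 1) w = rot (t *\<^sub>R axis j 1) w"
      by (simp add: scaleR_add_left rot_rot[symmetric] rot_axis_2pi)
    ultimately show ?thesis by (simp add: cis_multiple_2pi)
  qed
  have "integral {0..2*pi} ?f = integral {0..2*pi} (\<lambda>t. ?f (t + s))"
    by (rule periodic_integral_shift[symmetric, OF cont period])
  also have "\<dots> = integral {0..2*pi} (\<lambda>t. cis (real k * s) *
      (cis (real k * t) * g (rot (t *\<^sub>R axis j 1) (rot (s *\<^sub>R axis j 1) w))))"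
    by (simp add: rot_rot scaleR_add_left[symmetric] cis_mult[symmetric] distrib_left mult.commute mult.left_commute)
  finally have "avg k j g w = cis (real k * s) * avg k j g (rot (s *\<^sub>R axis j 1) w)"
    by (simp add: avg_def)
  moreover have "cis (- (real k * s)) * cis (real k * s) = 1"
    by (simp add: cis_mult)
  ultimately show ?thesis by (simp add: mult.assoc[symmetric])
qed

text \<open>
  On the level \<open>act j w = k j\<close> the twisted flow is \<open>R\<^sub>t g(w) = exp(i k t) g(rot(t) w)\<close>, which has
  period \<open>2 \<pi>\<close>. Integration by parts of \<open>t (d/dt) R\<^sub>t g\<close> over a period shows that the difference of
  \<open>g\<close> and its average is the derivative of \<open>\<psi> = (1 / 2 \<pi>) \<integral> t R\<^sub>t g dt\<close>; off that level the error is a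
  multiple of \<open>act j w - k j\<close>.
\<close>

lemma avg_in_twist_image:
  assumes g: "g \<in> near k e"
  shows "\<exists>\<psi> \<in> near k e. \<forall>w. g w - avg (k j) j g w
      = twist (axis j 1) \<psi> w - \<i> * (of_real (act j w - real (k j)) * \<psi> w)"
proof -
  note sg = nearD[OF g]
  define F where "F z = of_real (fst z) * (cis (real (k j) * fst z) * g (rot (fst z *\<^sub>R axis j 1) (snd z)))" for z
  define I where "I w = integral {0..2*pi} (\<lambda>t. F (t, w))" for w
  define \<psi> where "\<psi> w = (1 / (2 * pi)) * I w" for w
  have sF: "smooth_on (UNIV \<times> UNIV) F"
    unfolding F_def[abs_def] by (intro smooth_intros smooth_compose[OF sg]) (auto intro!: open_Times)
  have sI: "smooth_on UNIV I"
    unfolding I_def[abs_def] by (intro smooth_integral_param sF open_UNIV)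
  have "\<psi> \<in> near k e"
    unfolding \<psi>_def[abs_def]
  proof (rule nearI)
    show "smooth_on UNIV (\<lambda>w. (1 / (2 * pi)) * I w)" by (intro smooth_intros sI) auto
  qed (simp add: I_def F_def near_zero[OF g])
  moreover have "g w - avg (k j) j g w
      = twist (axis j 1) \<psi> w - \<i> * (of_real (act j w - real (k j)) * \<psi> w)" for w
  proof -
    let ?s = "axis j 1 :: real^'a" and ?c = "act j w"
    let ?h = "\<lambda>t. cis (real (k j) * t) * g (rot (t *\<^sub>R ?s) w)"
    let ?h' = "\<lambda>t. \<i> * real (k j) * ?h t + cis (real (k j) * t) * frechet_derivative g (at (rot (t *\<^sub>R ?s) w)) (rot_field ?s (rot (t *\<^sub>R ?s) w))"
    have gd: "g differentiable (at w)" for w by (rule smooth_on_differentiable[OF sg]) simp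
    have "((\<lambda>t. cis (real (k j) * t)) has_vector_derivative \<i> * real (k j) * cis (real (k j) * t)) (at t)" for t
      unfolding has_vector_derivative_def
      by (auto intro!: derivative_eq_intros simp: scaleR_conv_of_real)
    from has_vector_derivative_mult[OF this chain_vector_derivative[OF rot_has_vector_derivative gd]]
    have h': "(?h has_vector_derivative ?h' t) (at t)" for t
      by (simp add: algebra_simps)
    have ch: "continuous_on UNIV ?h"
      by (intro smooth_on_continuous_on smooth_intros smooth_compose[OF sg]) auto
    have ch': "continuous_on UNIV ?h'"
      by (intro smooth_on_continuous_on smooth_intros smooth_compose[OF sg]
           smooth_compose[OF smooth_frechet[OF open_UNIV sg smooth_rot_field[OF open_UNIV smooth_id[OF open_UNIV]]]]) auto
    have ii: "f integrable_on {0..2*pi}" if "continuous_on UNIV f" for f :: "real \<Rightarrow> complex"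
      by (rule integrable_continuous_real, rule continuous_on_subset[OF that]) simp
    have parts: "integral {0..2*pi} (\<lambda>t. of_real t * ?h' t + ?h t) = 2 * pi * g w"
    proof -
      have "integral {0..2*pi} (\<lambda>t. of_real t * ?h' t + ?h t) = of_real (2*pi) * ?h (2*pi) - of_real 0 * ?h 0"
      proof (rule integral_unique, rule fundamental_theorem_of_calculus)
        fix t assume "t \<in> {0..2*pi}"
        have "((\<lambda>t. of_real t :: complex) has_vector_derivative 1) (at t)"
          unfolding has_vector_derivative_def by (auto intro!: derivative_eq_intros simp: scaleR_conv_of_real)
        from has_vector_derivative_mult[OF this h']
        show "((\<lambda>t. of_real t * ?h t) has_vector_derivative (of_real t * ?h' t + ?h t)) (at t within {0..2*pi})"
          by (simp add: has_vector_derivative_at_within)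
      qed simp
      moreover have "?h (2*pi) = g w"
      proof -
        have "cis (real (k j) * (2 * pi)) = 1"
          using cis_multiple_2pi[of "real (k j)"] by (simp add: mult.commute)
        then show ?thesis by (simp only: rot_axis_2pi mult_1)
      qed
      ultimately show ?thesis by simp
    qed
    have "twist ?s I w = integral {0..2*pi} (\<lambda>t. twist ?s (\<lambda>w. F (t, w)) w)"
      unfolding I_def[abs_def] by (rule twist_integral[OF open_UNIV sF]) simp
    also have "\<dots> = integral {0..2*pi} (\<lambda>t. (of_real t * ?h' t + \<i> * of_real (?c - real (k j)) * F (t, w)))"
    proof (intro arg_cong2[where f = integral] refl ext)
      fix t
      let ?a = "of_real t * cis (real (k j) * t) :: complex"
      have gr: "(\<lambda>w. g (rot (t *\<^sub>R ?s) w)) differentiable (at w)"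
        by (rule smooth_on_differentiable[of UNIV])
           (auto intro!: smooth_intros smooth_compose[OF sg])
      have "(\<lambda>w. F (t, w)) = (\<lambda>w. ?a * g (rot (t *\<^sub>R ?s) w))"
        by (simp add: F_def fun_eq_iff)
      then have "twist ?s (\<lambda>w. F (t, w)) w = ?a * twist ?s g (rot (t *\<^sub>R ?s) w)"
        using twist_mult_invariant[of "\<lambda>_. ?a" w "\<lambda>w. g (rot (t *\<^sub>R ?s) w)" ?s] gr
        by (simp add: twist_rot gd)
      then show "twist ?s (\<lambda>w. F (t, w)) w = of_real t * ?h' t + \<i> * of_real (?c - real (k j)) * F (t, w)"
        by (simp add: twist_def F_def algebra_simps)
    qed
    also have "\<dots> = integral {0..2*pi} (\<lambda>t. (of_real t * ?h' t + ?h t) - ?h t + \<i> * of_real (?c - real (k j)) * F (t, w))"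
      by simp
    also have "\<dots> = 2 * pi * g w - integral {0..2*pi} ?h + \<i> * of_real (?c - real (k j)) * I w"
    proof -
      have i1: "(\<lambda>t. of_real t * ?h' t + ?h t) integrable_on {0..2*pi}"
        by (rule ii) (intro continuous_on_add continuous_on_mult continuous_on_of_real continuous_on_id ch ch')
      have i2: "(\<lambda>t. \<i> * of_real (?c - real (k j)) * F (t, w)) integrable_on {0..2*pi}"
        unfolding F_def fst_conv snd_conv
        by (rule ii) (intro continuous_on_mult continuous_on_of_real continuous_on_id continuous_on_const ch)
      have "integral {0..2*pi} (\<lambda>t. (of_real t * ?h' t + ?h t) - ?h t + \<i> * of_real (?c - real (k j)) * F (t, w))
        = integral {0..2*pi} (\<lambda>t. of_real t * ?h' t + ?h t) - integral {0..2*pi} ?h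
          + integral {0..2*pi} (\<lambda>t. \<i> * of_real (?c - real (k j)) * F (t, w))"
        by (subst integral_add[OF integrable_diff[OF i1 ii[OF ch]] i2], subst integral_diff[OF i1 ii[OF ch]]) simp
      then show ?thesis by (simp only: parts I_def integral_mult_right)
    qed
    finally have tI: "twist ?s I w = 2 * pi * g w - integral {0..2*pi} ?h + \<i> * of_real (?c - real (k j)) * I w" .
    have "twist ?s \<psi> w = (1 / (2 * pi)) * twist ?s I w"
      unfolding \<psi>_def[abs_def]
      by (rule twist_mult_invariant) (auto intro: smooth_on_differentiable[OF sI])
    then show ?thesis
      unfolding tI by (simp add: avg_def \<psi>_def field_simps)
  qed
  ultimately show ?thesis by blast
qed

text \<open>
  The value of \<open>avg k j g\<close> on the circle \<open>act j w = k\<close>, made independent of the \<open>j\<close>-th coordinate by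
  taking the positive point of the circle.
\<close>

definition circ_avg :: "nat \<Rightarrow> 'n \<Rightarrow> (complex^'n \<Rightarrow> complex) \<Rightarrow> complex^'n \<Rightarrow> complex" where
  "circ_avg k j g w = (1 / (2 * pi)) * integral {0..2*pi}
     (\<lambda>t. cis (real k * t) * g (upd j (of_real (sqrt (2 * real k)) * cis t) w))"

lemma smooth_circ_avg:
  assumes "smooth_on UNIV g" shows "smooth_on UNIV (circ_avg k j g)"
  unfolding circ_avg_def[abs_def]
  by (intro smooth_intros smooth_compose[OF assms]) (auto intro!: open_Times)

lemma circ_avg_eq_avg: "circ_avg k j g w = avg k j g (upd j (of_real (sqrt (2 * real k))) w)"
proof -
  have "rot (t *\<^sub>R axis j 1) (upd j z w) = upd j (z * cis t) w" for t z
    by (simp add: rot_axis vec_eq_iff mult.commute)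
  then show ?thesis by (simp add: circ_avg_def avg_def)
qed

text \<open>
  A function of weight \<open>-k\<close> is determined on the circle by its value at one point. The formula
  covers \<open>k = 0\<close>, where the circle is the origin, because \<open>0 ^ 0 = 1\<close>.
\<close>

lemma avg_on_ring:
  assumes "smooth_on UNIV g" "act j w = real k"
  shows "avg k j g w = (cnj (w $ j)) ^ k / of_real (sqrt (2 * real k)) ^ k * circ_avg k j g w"
proof -
  define \<rho> where "\<rho> = cmod (w $ j)"
  have \<rho>: "\<rho> = sqrt (2 * real k)"
  proof -
    have "\<rho>\<^sup>2 = 2 * real k" using assms(2) by (simp add: act_def \<rho>_def)
    then show ?thesis by (metis \<rho>_def norm_ge_zero real_sqrt_abs abs_of_nonneg)
  qed
  obtain \<alpha> where \<alpha>: "w $ j = of_real \<rho> * cis \<alpha>"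
    using rcis_cmod_Arg[of "w $ j"] that[of "Arg (w $ j)"] by (simp add: rcis_def \<rho>_def)
  have w: "w = rot (\<alpha> *\<^sub>R axis j 1) (upd j (of_real \<rho>) w)"
    using \<alpha> by (simp add: rot_axis vec_eq_iff mult.commute)
  have "avg k j g w = cis (- (real k * \<alpha>)) * avg k j g (upd j (of_real \<rho>) w)"
    using avg_rot[OF assms(1), of k j \<alpha> "upd j (of_real \<rho>) w"] w by simp
  moreover have "(cnj (w $ j)) ^ k / of_real (sqrt (2 * real k)) ^ k = cis (- (real k * \<alpha>))"
  proof (cases "k = 0")
    case False
    then have "\<rho> \<noteq> 0" by (simp add: \<rho>)
    then show ?thesis
      unfolding \<rho>[symmetric] \<alpha> using Complex.DeMoivre[of "-\<alpha>" k]
      by (simp add: power_mult_distrib cis_cnj)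
  qed simp
  ultimately show ?thesis by (simp add: circ_avg_eq_avg \<rho>)
qed

lemma axis_Basis [simp]: "axis j 1 \<in> (Basis :: (complex^'n) set)" "axis j \<i> \<in> (Basis :: (complex^'n) set)"
  by (auto simp: Basis_vec_def Basis_complex_def)

lemma frechet_axis:
  assumes "h differentiable (at w)"
  shows "frechet_derivative h (at w) (axis j z)
    = Re z *\<^sub>R partial_deriv (axis j 1) h w + Im z *\<^sub>R partial_deriv (axis j \<i>) h w"
proof -
  interpret linear "frechet_derivative h (at w)"
    using assms by (rule linear_frechet_derivative)
  have "axis j z = Re z *\<^sub>R axis j 1 + Im z *\<^sub>R axis j \<i>"
    by (simp add: vec_eq_iff axis_def complex_eq_iff)
  then show ?thesis by (simp add: add scaleR partial_deriv_def)
qed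

lemma upd_has_vector_derivative:
  assumes "(c has_vector_derivative c') (at t)"
  shows "((\<lambda>t. upd j (c t) w) has_vector_derivative axis j c') (at t)"
proof -
  have "((\<lambda>t. w + axis j (c t - w $ j)) has_vector_derivative (0 + axis j (c' - 0))) (at t)"
    by (intro has_vector_derivative_add has_vector_derivative_const
        bounded_linear.has_vector_derivative[OF bounded_linear_axis] has_vector_derivative_diff assms)
  then show ?thesis by (simp add: upd_eq)
qed

lemma open_far: "open {w. \<bar>act i w - real (k i)\<bar> > e}"
  by (intro open_Collect_less continuous_intros)

lemma near_partial_zero:
  assumes "h \<in> near k e" "\<bar>act i w - real (k i)\<bar> > e"
  shows "partial_deriv b h w = 0"
  by (rule partial_deriv_zero[OF open_far]) (use assms near_zero in auto)

lemma near_partial: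
  assumes "h \<in> near k e" "b \<in> Basis"
  shows "partial_deriv b h \<in> near k e"
  by (rule nearI[OF smooth_on_partial[OF nearD[OF assms(1)] assms(2)]])
     (rule near_partial_zero[OF assms(1)])

text \<open>
  Hadamard's lemma: integrate the derivative of \<open>h\<close> along the radial segment from the circle
  \<open>act j w = k j\<close> to \<open>w\<close>. The length of the segment is a multiple of \<open>act j w - k j\<close>. The formula makes
  sense for \<open>w $ j \<noteq> 0\<close>, and the support condition takes care of the axis.
\<close>

lemma divide_off_axis:
  assumes h: "h \<in> near k e" and e: "0 < e" "e < 1" and k: "k j > 0"
    and z: "\<And>w. act j w = real (k j) \<Longrightarrow> h w = 0"
  shows "\<exists>\<eta> \<in> near k e. \<forall>w. h w = of_real (act j w - real (k j)) * \<eta> w"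
proof -
  note sh = nearD[OF h]
  define \<rho> where "\<rho> = sqrt (2 * real (k j))"
  have \<rho>: "\<rho> > 0" "\<rho>\<^sup>2 = 2 * real (k j)" using k by (simp_all add: \<rho>_def)
  define p where "p s w = upd j (((1 - s) * (\<rho> / cmod (w $ j)) + s) *\<^sub>R (w $ j)) w" for s w
  define G where "G s w = Re (w $ j) *\<^sub>R partial_deriv (axis j 1) h (p s w)
      + Im (w $ j) *\<^sub>R partial_deriv (axis j \<i>) h (p s w)" for s w
  \<comment> \<open>Division by zero makes the quotient vanish on the axis, as it should.\<close>
  define \<eta> where "\<eta> w = of_real (2 / (cmod (w $ j) * (cmod (w $ j) + \<rho>))) * integral {0..1} (\<lambda>s. G s w)" for w
  let ?U = "{w :: complex^'a. w $ j \<noteq> 0}"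
  have oU: "open ?U" by (intro open_Collect_neq continuous_intros)
  have sp: "smooth_on (UNIV \<times> ?U) (\<lambda>z. p (fst z) (snd z))"
    unfolding p_def by (intro smooth_intros open_Times oU) (auto intro!: open_Times oU)
  have sG: "smooth_on (UNIV \<times> ?U) (\<lambda>z. G (fst z) (snd z))"
    unfolding G_def
    by (intro smooth_intros smooth_compose[OF smooth_on_partial[OF sh]] sp) (auto intro!: open_Times oU)
  have eq: "h w = of_real (act j w - real (k j)) * \<eta> w" for w
  proof (cases "w $ j = 0")
    case True
    then have "act j w = 0" by (simp add: act_def)
    then have "h w = 0" using near_zero[OF h, of j w] e k by simp
    then show ?thesis using True by (simp add: \<eta>_def)
  next
    case False
    define r where "r = cmod (w $ j)"
    have r: "r > 0" using False by (simp add: r_def)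
    have hd: "h differentiable (at v)" for v by (rule smooth_on_differentiable[OF sh]) simp
    have "((\<lambda>s. h (p s w)) has_vector_derivative (1 - \<rho> / r) *\<^sub>R G s w) (at s)" for s
    proof -
      have "((\<lambda>s. ((1 - s) * (\<rho> / cmod (w $ j)) + s) *\<^sub>R (w $ j)) has_vector_derivative (1 - \<rho> / r) *\<^sub>R (w $ j)) (at s)"
        using False by (auto intro!: derivative_eq_intros simp: has_vector_derivative_def r_def algebra_simps)
      from chain_vector_derivative[OF upd_has_vector_derivative[OF this, of j w] hd]
      show ?thesis by (simp add: p_def frechet_axis[OF hd] G_def scaleR_add_right)
    qed
    then have "((\<lambda>s. (1 - \<rho> / r) *\<^sub>R G s w) has_integral h (p 1 w) - h (p 0 w)) {0..1}"
      by (intro fundamental_theorem_of_calculus) (auto intro: has_vector_derivative_at_within)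
    then have "integral {0..1} (\<lambda>s. (1 - \<rho> / r) *\<^sub>R G s w) = h (p 1 w) - h (p 0 w)"
      by (rule integral_unique)
    moreover have "p 1 w = w" by (simp add: p_def vec_eq_iff)
    moreover have "h (p 0 w) = 0"
      by (rule z) (use r \<rho> in \<open>simp add: p_def act_upd r_def[symmetric]\<close>)
    ultimately have "h w = (1 - \<rho> / r) *\<^sub>R integral {0..1} (\<lambda>s. G s w)"
      unfolding integral_cmul[symmetric] by simp
    moreover have "1 - \<rho> / r = (act j w - real (k j)) * (2 / (r * (r + \<rho>)))"
    proof -
      have "act j w - real (k j) = (r - \<rho>) * (r + \<rho>) / 2"
        using \<rho> by (simp add: act_def r_def[symmetric] algebra_simps power2_eq_square)
      moreover have "r + \<rho> \<noteq> 0" using r \<rho> by simp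
      then have "(r - \<rho>) * (r + \<rho>) / 2 * (2 / (r * (r + \<rho>))) = (r - \<rho>) / r" by simp
      moreover have "1 - \<rho> / r = (r - \<rho>) / r" using r by (simp add: diff_divide_distrib)
      ultimately show ?thesis by simp
    qed
    ultimately have "h w = ((act j w - real (k j)) * (2 / (r * (r + \<rho>)))) *\<^sub>R integral {0..1} (\<lambda>s. G s w)"
      by (simp only:)
    then show ?thesis by (simp only: \<eta>_def r_def scaleR_conv_of_real of_real_mult mult.assoc)
  qed
  have far: "\<eta> w = 0" if "\<bar>act i w - real (k i)\<bar> > e" for w i
  proof (cases "i = j")
    case True
    then have "h w = 0" "of_real (act j w - real (k j)) \<noteq> (0::complex)"
      using near_zero[OF h that] that e by (auto simp del: of_real_diff)
    then show ?thesis using eq[of w] by simp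
  next
    case False
    then have "G s w = 0" for s
      using near_partial_zero[OF h, of i "p s w"] that by (simp add: G_def p_def act_upd)
    then show ?thesis by (simp add: \<eta>_def)
  qed
  have "\<eta> \<in> near k e"
  proof (rule nearI[OF _ far])
    show "smooth_on UNIV \<eta>"
    proof (rule smooth_on_zero_off[OF oU open_far[where i = j and k = k and e = e]])
      show "?U \<union> {w. e < \<bar>act j w - real (k j)\<bar>} = UNIV"
        using e k Suc_leI[of 0 "k j"] by (auto simp: act_def)
      show "smooth_on ?U \<eta>"
        unfolding \<eta>_def[abs_def]
      proof (intro smooth_intros sG oU)
        fix w assume "w \<in> ?U"
        then show "w $ j \<noteq> 0" "cmod (w $ j) * (cmod (w $ j) + \<rho>) \<noteq> 0" 
          using \<open>w \<in> ?U\<close> \<rho> add_nonneg_pos[of "cmod (w $ j)" \<rho>] by auto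
      qed auto
    qed (use far in auto)
  qed
  then show ?thesis using eq by blast
qed

lemma partial_linear_scaleR:
  assumes "bounded_linear L" "q differentiable (at w)"
  shows "partial_deriv (axis j c) (\<lambda>w. L (w $ j) *\<^sub>R q w) w
      = L c *\<^sub>R q w + L (w $ j) *\<^sub>R partial_deriv (axis j c) q w"
proof -
  have "((\<lambda>w. L (w $ j) *\<^sub>R q w) has_derivative
      (\<lambda>u. L (w $ j) *\<^sub>R frechet_derivative q (at w) u + L (u $ j) *\<^sub>R q w)) (at w)"
    by (intro has_derivative_scaleR bounded_linear.has_derivative[OF assms(1)]
        bounded_linear.has_derivative[OF bounded_linear_vec_nth] has_derivative_ident)
       (rule assms(2)[unfolded frechet_derivative_works])
  from has_derivative_partial[OF this] show ?thesis by (simp add: partial_deriv_def add.commute)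
qed

lemmas partial_Re_scaleR = partial_linear_scaleR[OF bounded_linear_Re]
lemmas partial_Im_scaleR = partial_linear_scaleR[OF bounded_linear_Im]

lemma partial_add:
  assumes "f differentiable (at w)" "g differentiable (at w)"
  shows "partial_deriv b (\<lambda>w. f w + g w) w = partial_deriv b f w + partial_deriv b g w"
  using has_derivative_partial[OF has_derivative_add[OF assms[unfolded frechet_derivative_works]]]
  by (simp add: partial_deriv_def)

lemma partial_diff:
  assumes "f differentiable (at w)" "g differentiable (at w)"
  shows "partial_deriv b (\<lambda>w. f w - g w) w = partial_deriv b f w - partial_deriv b g w"
  using has_derivative_partial[OF has_derivative_diff[OF assms[unfolded frechet_derivative_works]]]
  by (simp add: partial_deriv_def)

text \<open>
  In polar coordinates of the \<open>j\<close>-th plane the left side is \<open>r \<partial>\<^sub>r (r \<partial>\<^sub>r h)\<close>, which for a rotation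
  invariant function is \<open>r\<^sup>2\<close> times the Laplacian. The proof in Cartesian coordinates differentiates
  the equation \<open>x h\<^sub>y - y h\<^sub>x = 0\<close> that expresses the invariance.
\<close>

lemma radial_laplacian:
  fixes h :: "complex^'n \<Rightarrow> complex"
  assumes sh: "smooth_on UNIV h" and inv: "\<And>t w. h (rot (t *\<^sub>R axis j 1) w) = h w"
  defines "h1 \<equiv> partial_deriv (axis j 1) h" and "h2 \<equiv> partial_deriv (axis j \<i>) h"
  defines "E \<equiv> \<lambda>w. Re (w $ j) *\<^sub>R h1 w + Im (w $ j) *\<^sub>R h2 w"
  shows "frechet_derivative E (at w) (axis j (w $ j))
    = (cmod (w $ j))\<^sup>2 *\<^sub>R (partial_deriv (axis j 1) h1 w + partial_deriv (axis j \<i>) h2 w)"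
proof -
  have s1: "smooth_on UNIV h1" and s2: "smooth_on UNIV h2"
    unfolding h1_def h2_def by (intro smooth_on_partial sh; simp)+
  have d: "h differentiable (at w)" "h1 differentiable (at w)" "h2 differentiable (at w)" for w
    by (rule smooth_on_differentiable[OF sh] smooth_on_differentiable[OF s1] smooth_on_differentiable[OF s2]; simp)+
  have sR: "smooth_on UNIV (\<lambda>w. Re (w $ j) *\<^sub>R q w)" "smooth_on UNIV (\<lambda>w. Im (w $ j) *\<^sub>R q w)"
    if "smooth_on UNIV q" for q :: "complex^'n \<Rightarrow> complex"
    by (intro smooth_intros that; simp)+
  have dR: "(\<lambda>w. Re (w $ j) *\<^sub>R q w) differentiable (at w)" "(\<lambda>w. Im (w $ j) *\<^sub>R q w) differentiable (at w)"
    if "smooth_on UNIV q" for q :: "complex^'n \<Rightarrow> complex" and w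
    by (rule smooth_on_differentiable[OF sR(1)[OF that]] smooth_on_differentiable[OF sR(2)[OF that]]; simp)+
  have pde: "Re (w $ j) *\<^sub>R h2 w - Im (w $ j) *\<^sub>R h1 w = 0" for w
    using invariant_frechet[OF d(1) inv, of w] by (simp add: rot_field_axis frechet_axis d h1_def h2_def)
  have pde': "partial_deriv (axis j c) (\<lambda>w. Re (w $ j) *\<^sub>R h2 w - Im (w $ j) *\<^sub>R h1 w) w = 0" for c
    unfolding pde by (rule has_derivative_partial[OF has_derivative_const])
  have 1: "h2 w + Re (w $ j) *\<^sub>R partial_deriv (axis j 1) h2 w - Im (w $ j) *\<^sub>R partial_deriv (axis j 1) h1 w = 0"
    using pde'[of 1] by (simp add: partial_diff dR s1 s2 partial_Re_scaleR partial_Im_scaleR d)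
  have 2: "Re (w $ j) *\<^sub>R partial_deriv (axis j \<i>) h2 w - (h1 w + Im (w $ j) *\<^sub>R partial_deriv (axis j \<i>) h1 w) = 0"
    using pde'[of \<i>] by (simp add: partial_diff dR s1 s2 partial_Re_scaleR partial_Im_scaleR d)
  have "E differentiable (at w)"
    by (rule smooth_on_differentiable[of UNIV]) (auto simp: E_def intro!: smooth_add sR s1 s2)
  then have "frechet_derivative E (at w) (axis j (w $ j))
    = Re (w $ j) *\<^sub>R partial_deriv (axis j 1) E w + Im (w $ j) *\<^sub>R partial_deriv (axis j \<i>) E w"
    by (rule frechet_axis)
  also have "partial_deriv (axis j 1) E w = h1 w + Re (w $ j) *\<^sub>R partial_deriv (axis j 1) h1 w
      + Im (w $ j) *\<^sub>R partial_deriv (axis j 1) h2 w"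
    unfolding E_def by (simp add: partial_add dR s1 s2 partial_Re_scaleR partial_Im_scaleR d)
  also have "partial_deriv (axis j \<i>) E w = Re (w $ j) *\<^sub>R partial_deriv (axis j \<i>) h1 w
      + (h2 w + Im (w $ j) *\<^sub>R partial_deriv (axis j \<i>) h2 w)"
    unfolding E_def by (simp add: partial_add dR s1 s2 partial_Re_scaleR partial_Im_scaleR d)
  also have "h1 w = Re (w $ j) *\<^sub>R partial_deriv (axis j \<i>) h2 w - Im (w $ j) *\<^sub>R partial_deriv (axis j \<i>) h1 w"
    using 2 by (simp add: algebra_simps)
  also have "h2 w = Im (w $ j) *\<^sub>R partial_deriv (axis j 1) h1 w - Re (w $ j) *\<^sub>R partial_deriv (axis j 1) h2 w"
    using 1 by (simp add: algebra_simps)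
  also have "Re (w $ j) *\<^sub>R (Re (w $ j) *\<^sub>R partial_deriv (axis j \<i>) h2 w - Im (w $ j) *\<^sub>R partial_deriv (axis j \<i>) h1 w
       + Re (w $ j) *\<^sub>R partial_deriv (axis j 1) h1 w + Im (w $ j) *\<^sub>R partial_deriv (axis j 1) h2 w)
      + Im (w $ j) *\<^sub>R (Re (w $ j) *\<^sub>R partial_deriv (axis j \<i>) h1 w
       + (Im (w $ j) *\<^sub>R partial_deriv (axis j 1) h1 w - Re (w $ j) *\<^sub>R partial_deriv (axis j 1) h2 w
       + Im (w $ j) *\<^sub>R partial_deriv (axis j \<i>) h2 w))
      = (cmod (w $ j))\<^sup>2 *\<^sub>R (partial_deriv (axis j 1) h1 w + partial_deriv (axis j \<i>) h2 w)"
    unfolding cmod_power2 by (simp add: scaleR_conv_of_real algebra_simps power2_eq_square)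
  finally show ?thesis .
qed

text \<open>
  By \<open>radial_laplacian\<close>, the function \<open>\<phi>(t) = h(t w\<^sub>j)\<close> satisfies \<open>(t \<phi>')' = t |w\<^sub>j|\<^sup>2 \<Delta>h(t w\<^sub>j)\<close>.
  Integrating twice and using \<open>h = 0\<close> on the axis displays \<open>h\<close> as \<open>|w\<^sub>j|\<^sup>2\<close> times the integral of
  \<open>u t \<Delta>h(u t w\<^sub>j)\<close> over the unit square. The invariance is essential: \<open>h = Re w\<^sub>j\<close> vanishes on the
  axis, but is not divisible.
\<close>

lemma divide_on_axis:
  assumes h: "h \<in> near k e" and e: "0 < e" and k: "k j = 0"
    and inv: "\<And>t w. h (rot (t *\<^sub>R axis j 1) w) = h w"
    and z: "\<And>w. w $ j = 0 \<Longrightarrow> h w = 0"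
  shows "\<exists>\<eta> \<in> near k e. \<forall>w. h w = of_real (act j w - real (k j)) * \<eta> w"
proof -
  note sh = nearD[OF h]
  define h1 h2 where "h1 = partial_deriv (axis j 1) h" and "h2 = partial_deriv (axis j \<i>) h"
  define E where "E w = Re (w $ j) *\<^sub>R h1 w + Im (w $ j) *\<^sub>R h2 w" for w
  define L where "L w = partial_deriv (axis j 1) h1 w + partial_deriv (axis j \<i>) h2 w" for w
  define p where "p t w = upd j (t *\<^sub>R (w $ j)) w" for t :: real and w
  define I where "I t w = integral {0..1} (\<lambda>u. u *\<^sub>R L (p (u * t) w))" for t w
  define \<eta> where "\<eta> w = 2 * integral {0..1} (\<lambda>t. t *\<^sub>R I t w)" for w
  have n1: "h1 \<in> near k e" and n2: "h2 \<in> near k e"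
    unfolding h1_def h2_def by (intro near_partial h; simp)+
  have sL: "smooth_on UNIV L"
    unfolding L_def[abs_def] by (intro smooth_intros smooth_on_partial nearD[OF n1] nearD[OF n2]) auto
  have sE: "smooth_on UNIV E"
    unfolding E_def[abs_def] by (intro smooth_intros nearD[OF n1] nearD[OF n2]) auto
  have sp: "smooth_on S (\<lambda>z. p (a z) (b z))" if "open S" "smooth_on S a" "smooth_on S b"
    for S :: "'c::euclidean_space set" and a b
    unfolding p_def by (intro smooth_intros that)
  have sI: "smooth_on (UNIV \<times> UNIV) (\<lambda>z. I (fst z) (snd z))"
    unfolding I_def
    by (intro smooth_integral_param' smooth_intros smooth_compose[OF sL] sp) (auto intro!: open_Times)
  have s\<eta>: "smooth_on UNIV \<eta>"
    unfolding \<eta>_def[abs_def] by (intro smooth_intros sI) (auto intro!: open_Times)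
  have d: "h differentiable (at w)" "E differentiable (at w)" for w
    by (rule smooth_on_differentiable[OF sh] smooth_on_differentiable[OF sE]; simp)+
  have eq: "h w = of_real (act j w - real (k j)) * \<eta> w" for w
  proof -
    let ?r = "cmod (w $ j)"
    have dp: "((\<lambda>t. p (t * a) w) has_vector_derivative axis j (a *\<^sub>R w $ j)) (at t)" for t a
      unfolding p_def
      by (rule upd_has_vector_derivative) (auto intro!: derivative_eq_intros simp: has_vector_derivative_def)
    have pj: "p t w $ j = t *\<^sub>R (w $ j)" for t by (simp add: p_def)
    have lin: "frechet_derivative q (at v) (axis j (t *\<^sub>R c)) = t *\<^sub>R frechet_derivative q (at v) (axis j c)"
      if "q differentiable (at v)" for q :: "complex^'a \<Rightarrow> complex" and v t c
      using that by (simp add: frechet_axis scaleR_add_right)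
    have rad: "frechet_derivative E (at v) (axis j (v $ j)) = (cmod (v $ j))\<^sup>2 *\<^sub>R L v" for v
      using radial_laplacian[OF sh inv, of v]
      by (simp add: E_def[abs_def] L_def h1_def[symmetric] h2_def[symmetric])
    have E: "E (p t w) = (t\<^sup>2 * ?r\<^sup>2) *\<^sub>R I t w" if "t > 0" for t
    proof -
      have "((\<lambda>u. (t\<^sup>2 * ?r\<^sup>2) *\<^sub>R (u *\<^sub>R L (p (u * t) w))) has_integral E (p (1 * t) w) - E (p (0 * t) w)) {0..1}"
      proof (rule fundamental_theorem_of_calculus_interior)
        show "continuous_on {0..1} (\<lambda>u. E (p (u * t) w))"
          by (rule continuous_on_subset[OF smooth_on_continuous_on[OF smooth_compose[OF sE _ open_UNIV sp]]])
             (auto intro!: smooth_intros)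
        fix u :: real assume u: "u \<in> {0<..<1}"
        have "u *\<^sub>R (frechet_derivative E (at (p (u * t) w)) (axis j (t *\<^sub>R w $ j)))
          = u *\<^sub>R ((t\<^sup>2 * ?r\<^sup>2) *\<^sub>R (u *\<^sub>R L (p (u * t) w)))"
          using rad[of "p (u * t) w"] u that
          by (simp add: pj lin[OF d(2), symmetric] norm_mult power2_eq_square mult_ac)
        then have "frechet_derivative E (at (p (u * t) w)) (axis j (t *\<^sub>R w $ j))
          = (t\<^sup>2 * ?r\<^sup>2) *\<^sub>R (u *\<^sub>R L (p (u * t) w))"
          by (rule scaleR_left_imp_eq[rotated]) (use u in simp)
        then show "((\<lambda>u. E (p (u * t) w)) has_vector_derivative (t\<^sup>2 * ?r\<^sup>2) *\<^sub>R (u *\<^sub>R L (p (u * t) w))) (at u)"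
          using chain_vector_derivative[OF dp d(2), of t u] by simp
      qed simp
      then have "integral {0..1} (\<lambda>u. (t\<^sup>2 * ?r\<^sup>2) *\<^sub>R (u *\<^sub>R L (p (u * t) w))) = E (p (1 * t) w) - E (p (0 * t) w)"
        by (rule integral_unique)
      moreover have "E (p 0 w) = 0" by (simp add: E_def p_def)
      ultimately show ?thesis unfolding I_def integral_cmul[symmetric] by simp
    qed
    have "((\<lambda>t. ?r\<^sup>2 *\<^sub>R (t *\<^sub>R I t w)) has_integral h (p (1 * 1) w) - h (p (0 * 1) w)) {0..1}"
    proof (rule fundamental_theorem_of_calculus_interior)
      show "continuous_on {0..1} (\<lambda>u. h (p (u * 1) w))"
        by (rule continuous_on_subset[OF smooth_on_continuous_on[OF smooth_compose[OF sh _ open_UNIV sp]]])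
           (auto intro!: smooth_intros)
      fix t :: real assume t: "t \<in> {0<..<1}"
      have "t *\<^sub>R (frechet_derivative h (at (p t w)) (axis j (w $ j))) = E (p t w)"
        by (simp add: lin[OF d(1), symmetric]) (simp add: frechet_axis[OF d(1)] E_def pj h1_def h2_def)
      also have "\<dots> = t *\<^sub>R (?r\<^sup>2 *\<^sub>R (t *\<^sub>R I t w))"
        using t by (simp add: E power2_eq_square mult_ac)
      finally have "frechet_derivative h (at (p t w)) (axis j (w $ j)) = ?r\<^sup>2 *\<^sub>R (t *\<^sub>R I t w)"
        by (rule scaleR_left_imp_eq[rotated]) (use t in simp)
      then show "((\<lambda>u. h (p (u * 1) w)) has_vector_derivative ?r\<^sup>2 *\<^sub>R (t *\<^sub>R I t w)) (at t)"
        using chain_vector_derivative[OF dp d(1), of 1 t] by simp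
    qed simp
    then have "integral {0..1} (\<lambda>t. ?r\<^sup>2 *\<^sub>R (t *\<^sub>R I t w)) = h (p (1 * 1) w) - h (p (0 * 1) w)"
      by (rule integral_unique)
    moreover have "p 1 w = w" by (simp add: p_def vec_eq_iff)
    moreover have "h (p 0 w) = 0" by (rule z) (simp add: p_def)
    ultimately have "h w = ?r\<^sup>2 *\<^sub>R integral {0..1} (\<lambda>t. t *\<^sub>R I t w)"
      unfolding integral_cmul[symmetric] by simp
    then show ?thesis by (simp add: \<eta>_def act_def k scaleR_conv_of_real)
  qed
  have "\<eta> \<in> near k e"
  proof (rule nearI[OF s\<eta>])
    fix w i assume far: "\<bar>act i w - real (k i)\<bar> > e"
    show "\<eta> w = 0"
    proof (cases "i = j")
      case True
      then have "h w = 0" "of_real (act j w - real (k j)) \<noteq> (0::complex)"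
        using near_zero[OF h far] far e by (auto simp del: of_real_diff)
      then show ?thesis using eq[of w] by simp
    next
      case False
      then have "L (p t w) = 0" for t
        using near_partial_zero[OF n1, of i "p t w"] near_partial_zero[OF n2, of i "p t w"] far
        by (simp add: L_def p_def act_upd)
      then show ?thesis by (simp add: \<eta>_def I_def)
    qed
  qed
  then show ?thesis using eq by blast
qed

text \<open>
  A cut-off function of weight \<open>-k\<close> that has the value \<open>1\<close> at the positive point of the circle.
\<close>

definition profile :: "real \<Rightarrow> nat \<Rightarrow> complex \<Rightarrow> complex" where
  "profile e k z = of_real (cutoff (((cmod z)\<^sup>2 / 2 - real k)\<^sup>2 / e\<^sup>2)) * (cnj z ^ k / of_real (sqrt (2 * real k)) ^ k)"

lemma smooth_profile:
  assumes "e > 0" shows "smooth_on UNIV (\<lambda>w :: complex^'n. profile e k (w $ j))"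
  unfolding profile_def divide_inverse by (intro smooth_intros) auto

lemma profile_zero:
  assumes "\<bar>act j w - real k\<bar> > e" "e > 0" shows "profile e k (w $ j) = 0"
proof -
  have "e\<^sup>2 \<le> (act j w - real k)\<^sup>2" using assms power_mono[of e "\<bar>act j w - real k\<bar>" 2] by simp
  then have "((cmod (w $ j))\<^sup>2 / 2 - real k)\<^sup>2 / e\<^sup>2 \<ge> 1" using assms by (simp add: act_def)
  then show ?thesis by (simp add: profile_def cutoff_zero)
qed

lemma twist_near:
  assumes "\<psi> \<in> near k e" shows "twist s \<psi> \<in> near k e"
proof (rule nearI)
  fix w j assume far: "\<bar>act j w - real (k j)\<bar> > e"
  have "\<psi> differentiable (at w)" by (rule smooth_on_differentiable[OF nearD[OF assms]]) simp
  then show "twist s \<psi> w = 0"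
    by (simp add: twist_def frechet_derivative_partial near_partial_zero[OF assms far] near_zero[OF assms far])
qed (auto intro!: smooth_twist nearD[OF assms])

lemma profile_circ_avg_near:
  assumes g: "g \<in> near k e" and e: "0 < e"
  shows "(\<lambda>w. profile e (k j) (w $ j) * circ_avg (k j) j g w) \<in> near k e"
proof (rule nearI)
  show "smooth_on UNIV (\<lambda>w. profile e (k j) (w $ j) * circ_avg (k j) j g w)"
    by (intro smooth_intros smooth_profile e smooth_circ_avg nearD[OF g]) auto
  fix w i assume far: "\<bar>act i w - real (k i)\<bar> > e"
  show "profile e (k j) (w $ j) * circ_avg (k j) j g w = 0"
  proof (cases "i = j")
    case True
    then show ?thesis using profile_zero[of e j w "k j"] far e by simp
  next
    case False
    then have "g (upd j z w) = 0" for z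
      using near_zero[OF g, of i "upd j z w"] far by (simp add: act_upd)
    then show ?thesis by (simp add: circ_avg_def)
  qed
qed

text \<open>
  The average of \<open>g\<close> and \<open>profile * circ_avg g\<close> have the same weight and agree on the circle, so their
  difference is divisible by \<open>act j w - k j\<close>. All three differences between \<open>g\<close> and
  \<open>profile * circ_avg g\<close> are thus in the image of \<open>twist (axis j 1)\<close>.
\<close>

lemma one_variable_reduction:
  assumes g: "g \<in> near k e" and e: "0 < e" "e < 1"
  shows "\<exists>\<psi>1 \<in> near k e. \<exists>\<psi>2 \<in> near k e. \<forall>w.
     g w = profile e (k j) (w $ j) * circ_avg (k j) j g w
       + (1 * twist (axis j 1) \<psi>1 w + (-\<i>) * twist (axis j 1) \<psi>2 w)"
proof -
  define h where "h w = avg (k j) j g w - profile e (k j) (w $ j) * circ_avg (k j) j g w" for w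
  have hn: "h \<in> near k e"
    using near_lincomb[OF avg_near[OF g, of j] profile_circ_avg_near[OF g e(1), of j], of 1 "-1"]
    by (simp add: h_def[abs_def])
  have ring: "h w = 0" if "act j w = real (k j)" for w
    using that avg_on_ring[OF nearD[OF g] that]
    by (simp add: h_def profile_def act_def cutoff_one)
  have "\<exists>\<eta> \<in> near k e. \<forall>w. h w = of_real (act j w - real (k j)) * \<eta> w"
  proof (cases "k j = 0")
    case False
    then show ?thesis by (intro divide_off_axis hn e ring) auto
  next
    case True
    have "circ_avg 0 j g (rot (t *\<^sub>R axis j 1) w) = circ_avg 0 j g w" for t w
      by (simp add: circ_avg_def rot_axis upd_def vec_eq_iff cong: if_cong)
    then have "h (rot (t *\<^sub>R axis j 1) w) = h w" for t w
      using True avg_rot[OF nearD[OF g], of 0 j t w] by (simp add: h_def profile_def norm_mult)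
    then show ?thesis
      by (intro divide_on_axis hn e True ring) (auto simp: act_def True)
  qed
  then obtain \<eta> where \<eta>: "\<eta> \<in> near k e" "\<And>w. h w = of_real (act j w - real (k j)) * \<eta> w" by blast
  from ideal_in_twist_image[OF \<eta>(1) e(2), of j] obtain \<psi>3 where
    3: "\<psi>3 \<in> near k e" "\<And>w. twist (axis j 1) \<psi>3 w = of_real (act j w - real (k j)) * \<eta> w" by blast
  from avg_in_twist_image[OF g, of j] obtain \<psi> where
    1: "\<psi> \<in> near k e" "\<And>w. g w - avg (k j) j g w
      = twist (axis j 1) \<psi> w - \<i> * (of_real (act j w - real (k j)) * \<psi> w)" by blast
  from ideal_in_twist_image[OF 1(1) e(2), of j] obtain \<psi>2 where
    2: "\<psi>2 \<in> near k e" "\<And>w. twist (axis j 1) \<psi>2 w = of_real (act j w - real (k j)) * \<psi> w" by blast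
  have n: "(\<lambda>w. 1 * \<psi> w + 1 * \<psi>3 w) \<in> near k e" by (rule near_lincomb[OF 1(1) 3(1)])
  have d: "\<psi> differentiable (at w)" "\<psi>3 differentiable (at w)" for w
    by (rule smooth_on_differentiable[OF nearD[OF 1(1)]] smooth_on_differentiable[OF nearD[OF 3(1)]]; simp)+
  have add: "twist s (\<lambda>w. 1 * \<psi> w + 1 * \<psi>3 w) w = twist s \<psi> w + twist s \<psi>3 w" for s w
  proof -
    have "frechet_derivative (\<lambda>w. \<psi> w + \<psi>3 w) (at w)
        = (\<lambda>u. frechet_derivative \<psi> (at w) u + frechet_derivative \<psi>3 (at w) u)"
      by (rule frechet_derivative_at[symmetric], rule has_derivative_add)
         (rule d[unfolded frechet_derivative_works])+
    then show ?thesis by (simp add: twist_def algebra_simps)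
  qed
  show ?thesis
  proof (rule bexI[OF _ n], rule bexI[OF _ 2(1)], rule allI)
    fix w
    have "g w = profile e (k j) (w $ j) * circ_avg (k j) j g w + h w + (g w - avg (k j) j g w)"
      by (simp add: h_def)
    then show "g w = profile e (k j) (w $ j) * circ_avg (k j) j g w
       + (1 * twist (axis j 1) (\<lambda>w. 1 * \<psi> w + 1 * \<psi>3 w) w + (-\<i>) * twist (axis j 1) \<psi>2 w)"
      unfolding add 1(2) 2(2) 3(2) \<eta>(2) by simp
  qed
qed

fun torus_avg :: "('n \<Rightarrow> nat) \<Rightarrow> 'n list \<Rightarrow> (complex^'n \<Rightarrow> complex) \<Rightarrow> complex^'n \<Rightarrow> complex" where
  "torus_avg k [] g = g"
| "torus_avg k (j # js) g = circ_avg (k j) j (torus_avg k js g)"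

lemma torus_avg_indep:
  assumes "\<And>i. i \<notin> set js \<Longrightarrow> w $ i = w' $ i"
  shows "torus_avg k js g w = torus_avg k js g w'"
  using assms
proof (induction js arbitrary: w w')
  case Nil
  then have "w = w'" by (simp add: vec_eq_iff)
  then show ?case by simp
next
  case (Cons j js)
  have "torus_avg k js g (upd j z w) = torus_avg k js g (upd j z w')" for z
    by (rule Cons.IH) (use Cons.prems in auto)
  then show ?case by (simp add: circ_avg_def)
qed

text \<open>
  \<open>one_variable_reduction\<close> is applied to the coordinates in turn. Each step keeps the profiles of the
  coordinates already treated and leaves a function independent of them, so that a constant remains
  at the end.
\<close>

theorem local_reduction:
  fixes \<tau> :: "(complex^'n \<Rightarrow> complex) \<Rightarrow> complex"
  assumes lin: "\<And>f g a b. f \<in> near k e \<Longrightarrow> g \<in> near k e \<Longrightarrow> \<tau> (\<lambda>w. a * f w + b * g w) = a * \<tau> f + b * \<tau> g"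
    and kill: "\<And>\<psi> j. \<psi> \<in> near k e \<Longrightarrow> \<tau> (twist (axis j 1) \<psi>) = 0"
    and g: "g \<in> near k e" and e: "0 < e" "e < 1"
    and js: "distinct js" "set js = UNIV"
  shows "\<tau> g = torus_avg k js g w0 * \<tau> (\<lambda>w. \<Prod>j\<in>UNIV. profile e (k j) (w $ j))"
proof -
  have step: "\<tau> g = \<tau> (\<lambda>w. profile e (k j) (w $ j) * circ_avg (k j) j g w)" if g: "g \<in> near k e" for g j
  proof -
    from one_variable_reduction[OF g e, of j] obtain \<psi>1 \<psi>2 where
      \<psi>: "\<psi>1 \<in> near k e" "\<psi>2 \<in> near k e" and
      eq: "\<And>w. g w = profile e (k j) (w $ j) * circ_avg (k j) j g w
       + (1 * twist (axis j 1) \<psi>1 w + (-\<i>) * twist (axis j 1) \<psi>2 w)" by blast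
    let ?T = "\<lambda>w. profile e (k j) (w $ j) * circ_avg (k j) j g w"
    let ?R = "\<lambda>w. 1 * twist (axis j 1) \<psi>1 w + (-\<i>) * twist (axis j 1) \<psi>2 w"
    have R: "?R \<in> near k e" by (intro near_lincomb twist_near \<psi>)
    have "\<tau> ?R = 0" by (subst lin[OF twist_near[OF \<psi>(1)] twist_near[OF \<psi>(2)]]) (simp add: kill \<psi>)
    moreover have "g = (\<lambda>w. 1 * ?T w + 1 * ?R w)" using eq by (intro ext) simp
    then have "\<tau> g = \<tau> (\<lambda>w. 1 * ?T w + 1 * ?R w)" by (rule arg_cong)
    then have "\<tau> g = \<tau> ?T + \<tau> ?R"
      by (subst (asm) lin[OF profile_circ_avg_near[OF g e(1)] R]) simp
    ultimately show ?thesis by simp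
  qed
  have "(\<lambda>w. (\<Prod>j\<in>set js. profile e (k j) (w $ j)) * torus_avg k js g w) \<in> near k e \<and>
      \<tau> g = \<tau> (\<lambda>w. (\<Prod>j\<in>set js. profile e (k j) (w $ j)) * torus_avg k js g w)"
    using js(1)
  proof (induction js)
    case Nil
    then show ?case using g by simp
  next
    case (Cons j js)
    let ?h = "\<lambda>w. (\<Prod>j\<in>set js. profile e (k j) (w $ j)) * torus_avg k js g w"
    have hn: "?h \<in> near k e" and \<tau>h: "\<tau> g = \<tau> ?h" using Cons by auto
    have "circ_avg (k j) j ?h w = (\<Prod>j\<in>set js. profile e (k j) (w $ j)) * circ_avg (k j) j (torus_avg k js g) w" for w
    proof -
      have "(\<Prod>i\<in>set js. profile e (k i) (upd j z w $ i)) = (\<Prod>i\<in>set js. profile e (k i) (w $ i))" for z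
        using Cons.prems by (intro prod.cong) auto
      then show ?thesis
        by (simp only: circ_avg_def mult.left_commute[of _ "\<Prod>i\<in>set js. profile e (k i) (w $ i)"] integral_mult_right)
    qed
    then have "(\<lambda>w. profile e (k j) (w $ j) * circ_avg (k j) j ?h w)
      = (\<lambda>w. (\<Prod>j\<in>set (j # js). profile e (k j) (w $ j)) * torus_avg k (j # js) g w)"
      using Cons.prems by (simp add: fun_eq_iff mult.assoc)
    then show ?case using profile_circ_avg_near[OF hn e(1), of j] step[OF hn, of j] \<tau>h by simp
  qed
  then have "\<tau> g = \<tau> (\<lambda>w. (\<Prod>j\<in>UNIV. profile e (k j) (w $ j)) * torus_avg k js g w)"
    by (simp add: js)
  also have "(\<lambda>w. (\<Prod>j\<in>UNIV. profile e (k j) (w $ j)) * torus_avg k js g w)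
      = (\<lambda>w. (\<Prod>j\<in>UNIV. profile e (k j) (w $ j)) * torus_avg k js g w0)"
    by (intro ext arg_cong2[where f = "(*)"] refl torus_avg_indep) (simp add: js)
  finally have "\<tau> g = \<tau> (\<lambda>w. (\<Prod>j\<in>UNIV. profile e (k j) (w $ j)) * torus_avg k js g w0)" .
  also have "\<dots> = \<tau> (\<lambda>w. torus_avg k js g w0 * (\<Prod>j\<in>UNIV. profile e (k j) (w $ j)) + 0 * g w)"
    by (simp add: mult.commute)
  also have "\<dots> = torus_avg k js g w0 * \<tau> (\<lambda>w. \<Prod>j\<in>UNIV. profile e (k j) (w $ j)) + 0 * \<tau> g"
  proof (rule lin[OF _ g], rule nearI)
    show "smooth_on UNIV (\<lambda>w :: complex^'n. \<Prod>j\<in>UNIV. profile e (k j) (w $ j))"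
      by (intro smooth_intros smooth_profile e) auto
    show "(\<Prod>j\<in>UNIV. profile e (k j) (w $ j)) = 0" if "\<bar>act i w - real (k i)\<bar> > e" for w i
      using profile_zero[OF that e(1)] by (auto simp: prod_zero_iff)
  qed
  finally show ?thesis by simp
qed

section \<open>Vertex charts of the toric manifold\<close>

lemma int_lattice_iff: "x \<in> int_lattice \<longleftrightarrow> (\<exists>k. x = real_vec k)"
proof
  assume "x \<in> int_lattice"
  then have "x = real_vec (\<chi> i. \<lfloor>x $ i\<rfloor>)"
    by (auto simp: int_lattice_def real_vec_def vec_eq_iff Ints_def)
  then show "\<exists>k. x = real_vec k" ..
qed (auto simp: int_lattice_def real_vec_def)

lemma real_vec_nth [simp]: "real_vec z $ i = real_of_int (z $ i)"
  by (simp add: real_vec_def)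

lemma real_vec_in [simp]: "real_vec k \<in> int_lattice"
  by (auto simp: int_lattice_iff)

lemma int_lattice_add: "x \<in> int_lattice \<Longrightarrow> y \<in> int_lattice \<Longrightarrow> x + y \<in> int_lattice"
  and int_lattice_diff: "x \<in> int_lattice \<Longrightarrow> y \<in> int_lattice \<Longrightarrow> x - y \<in> int_lattice"
  and int_lattice_minus: "x \<in> int_lattice \<Longrightarrow> - x \<in> int_lattice"
  by (auto simp: int_lattice_def)

lemma int_lattice_mult:
  assumes "\<And>i j. M $ i $ j \<in> \<int>" "x \<in> int_lattice"
  shows "M *v x \<in> int_lattice"
  using assms by (auto simp: int_lattice_def matrix_vector_mult_def intro!: Ints_sum Ints_mult)

lemma int_lattice_inner: "x \<in> int_lattice \<Longrightarrow> y \<in> int_lattice \<Longrightarrow> x \<bullet> y \<in> \<int>"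
  by (auto simp: int_lattice_def inner_vec_def intro!: Ints_sum Ints_mult)

lemma matrix_inv_both:
  assumes "invertible M"
  shows "M ** matrix_inv M = mat 1" "matrix_inv M ** M = mat 1"
  using assms someI_ex[of "\<lambda>A'. M ** A' = mat 1 \<and> A' ** M = mat 1"]
  by (auto simp: invertible_def matrix_inv_def)

lemma cis_int: "n \<in> \<int> \<Longrightarrow> cis (2 * pi * n) = 1"
  by (rule cis_multiple_2pi)

text \<open>
  \<open>Arg\<close> jumps, but \<open>cis (n * Arg z)\<close> for an integer \<open>n\<close> is a power of \<open>z / |z|\<close> or of its conjugate.
\<close>

lemma smooth_cis_Arg [smooth_intros]:
  fixes f :: "'a::euclidean_space \<Rightarrow> complex"
  assumes "open S" "smooth_on S f" "\<And>x. x \<in> S \<Longrightarrow> f x \<noteq> 0" "r \<in> \<int>"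
  shows "smooth_on S (\<lambda>x. cis (r * Arg (f x)))"
proof -
  obtain n where r: "r = of_int n" using assms(4) by (auto elim: Ints_cases)
  have u: "cis (Arg z) = z / of_real (cmod z)" if "z \<noteq> 0" for z
    using rcis_cmod_Arg[of z] that by (simp add: rcis_def field_simps)
  show ?thesis
  proof (cases "n \<ge> 0")
    case True
    have "smooth_on S (\<lambda>x. (f x / of_real (cmod (f x))) ^ nat n)"
      by (intro smooth_intros assms) (use assms in auto)
    then show ?thesis
      by (rule smooth_on_cong[OF assms(1)])
         (use True assms(3) Complex.DeMoivre[of "Arg _" "nat n"] in \<open>simp add: u[symmetric] r\<close>)
  next
    case False
    have "smooth_on S (\<lambda>x. (cnj (f x) / of_real (cmod (f x))) ^ nat (-n))"
      by (intro smooth_intros assms) (use assms in auto)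
    then show ?thesis
    proof (rule smooth_on_cong[OF assms(1)])
      fix x assume "x \<in> S"
      then have "cnj (f x) / of_real (cmod (f x)) = cis (- Arg (f x))"
        using u[OF assms(3)] by (metis cis_cnj complex_cnj_complex_of_real complex_cnj_divide)
      then show "(cnj (f x) / of_real (cmod (f x))) ^ nat (-n) = cis (r * Arg (f x))"
        using False Complex.DeMoivre[of "- Arg (f x)" "nat (-n)"] by (simp add: r)
    qed
  qed
qed

context delzant_polytope
begin

definition T :: "real^'n \<Rightarrow> real^'n^'n" where "T v = transpose (A v)"
abbreviation nu :: "nat \<Rightarrow> real^'n" where "nu r \<equiv> real_vec (\<nu> r)"

lemma A_row: "A v $ j = nu (ord v j)"
  by (simp add: A_def)

lemma T_mult: "T v *v c = (\<Sum>j\<in>UNIV. (c $ j) *\<^sub>R nu (ord v j))"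
  unfolding T_def matrix_vector_mult_def transpose_def A_def by (simp add: vec_eq_iff mult.commute)

lemma T_axis: "T v *v axis j 1 = nu (ord v j)"
proof -
  have "T v *v axis j 1 = (\<Sum>i\<in>UNIV. if i = j then nu (ord v i) else 0)"
    unfolding T_mult by (intro sum.cong) (auto simp: axis_def)
  then show ?thesis by simp
qed

text \<open>
  The Delzant condition: the normals at a vertex form a basis of the integral lattice, hence their
  matrix has an integral inverse.
\<close>

lemma ex_T_inverse:
  assumes "v \<in> vertices"
  obtains C where "T v ** C = mat 1" "\<And>i j. C $ i $ j \<in> \<int>"
proof -
  have "\<exists>c. (\<forall>j. c $ j \<in> \<int>) \<and> T v *v c = axis i 1" for i
  proof -
    obtain c where c: "(axis i 1 :: int^'n) = (\<Sum>r\<in>active v. c r *s \<nu> r)"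
      using smooth_vertices[OF assms] unfolding is_int_basis_def by metis
    also have "\<dots> = (\<Sum>j\<in>UNIV. c (ord v j) *s \<nu> (ord v j))"
      by (rule sum.reindex_bij_betw[OF ord_facets[OF assms], symmetric])
    finally have eq: "(axis i 1 :: int^'n) $ k = (\<Sum>j\<in>UNIV. c (ord v j) * \<nu> (ord v j) $ k)" for k
      by simp
    have "T v *v (\<chi> j. real_of_int (c (ord v j))) = axis i 1"
    proof -
      have "(axis i 1 :: real^'n) $ k = real_of_int ((axis i 1 :: int^'n) $ k)" for k
        by (simp add: axis_def)
      then show ?thesis by (simp add: vec_eq_iff T_mult eq)
    qed
    then show ?thesis by (intro exI[of _ "\<chi> j. real_of_int (c (ord v j))"]) simp
  qed
  then obtain c where c: "\<And>i j. c i $ j \<in> \<int>" "\<And>i. T v *v c i = axis i 1" by metis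
  have "T v ** (\<chi> j i. c i $ j) = mat 1"
  proof (rule vec_eq_iff[THEN iffD2], rule allI, rule vec_eq_iff[THEN iffD2], rule allI)
    fix a b
    have "(T v ** (\<chi> j i. c i $ j)) $ a $ b = (T v *v c b) $ a"
      by (simp add: matrix_matrix_mult_def matrix_vector_mult_def)
    then show "(T v ** (\<chi> j i. c i $ j)) $ a $ b = (mat 1 :: real^'n^'n) $ a $ b"
      by (simp add: c mat_def axis_def)
  qed
  then show ?thesis using that c(1) by auto
qed

text \<open>
  The direction in the standard torus of the chart that corresponds to the direction \<open>s\<close> of
  \<open>\<real>\<^sup>n / 2 \<pi> \<int>\<^sup>n\<close>.
\<close>

abbreviation chart_dir :: "real^'n \<Rightarrow> real^'n \<Rightarrow> real^'n" where "chart_dir v s \<equiv> matrix_inv (T v) *v s"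

lemma invertible_T: assumes "v \<in> vertices" shows "invertible (T v)"
  using ex_T_inverse[OF assms] by (metis invertible_right_inverse)

lemma invertible_A: assumes "v \<in> vertices" shows "invertible (A v)"
  using transpose_invertible[OF invertible_T[OF assms]] by (simp add: T_def)

lemma T_chart_dir [simp]: "v \<in> vertices \<Longrightarrow> T v *v chart_dir v s = s"
  by (simp add: matrix_vector_mul_assoc matrix_inv_both invertible_T)

lemma chart_dir_T [simp]: "v \<in> vertices \<Longrightarrow> chart_dir v (T v *v s) = s"
  by (simp add: matrix_vector_mul_assoc matrix_inv_both invertible_T)

lemma chart_dir_lattice:
  assumes "v \<in> vertices" "s \<in> int_lattice" shows "chart_dir v s \<in> int_lattice"
proof -
  obtain C where C: "T v ** C = mat 1" "\<And>i j. C $ i $ j \<in> \<int>" using ex_T_inverse[OF assms(1)] by blast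
  have "matrix_inv (T v) = matrix_inv (T v) ** (T v ** C)" by (simp add: C)
  also have "\<dots> = C"
    unfolding matrix_mul_assoc by (simp add: matrix_inv_both invertible_T[OF assms(1)])
  finally show ?thesis using int_lattice_mult[OF C(2) assms(2)] by simp
qed

lemma T_lattice: "s \<in> int_lattice \<Longrightarrow> T v *v s \<in> int_lattice"
  by (rule int_lattice_mult) (simp_all add: T_def transpose_def A_def)

lemma A_inv [simp]: "v \<in> vertices \<Longrightarrow> A v *v (matrix_inv (A v) *v y) = y"
  "v \<in> vertices \<Longrightarrow> matrix_inv (A v) *v (A v *v y) = y"
  by (simp_all add: matrix_vector_mul_assoc matrix_inv_both invertible_A)

lemma A_T_inner: "(A v *v y) \<bullet> c = y \<bullet> (T v *v c)"
  unfolding T_def by (metis dot_lmul_matrix transpose_matrix_vector inner_commute)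

lemma A_chart_dir_inner: "v \<in> vertices \<Longrightarrow> (A v *v y) \<bullet> chart_dir v s = y \<bullet> s"
  by (simp add: A_T_inner)

lemma ell_ord: "(A v *v x - lam_vec v) $ j = ell (ord v j) x"
  by (simp add: ell_def lam_vec_def matrix_vector_mul_component A_row)

lemma active_d: "r \<in> active x \<Longrightarrow> r < d"
  by (simp add: active_def)

lemma ord_active: "v \<in> vertices \<Longrightarrow> ord v j \<in> active v"
  using ord_facets bij_betwE by blast

lemma ord_ex: "v \<in> vertices \<Longrightarrow> r \<in> active v \<Longrightarrow> \<exists>j. ord v j = r"
  using ord_facets[of v] by (metis bij_betw_imp_surj_on imageE)

lemma ord_inj: "v \<in> vertices \<Longrightarrow> ord v i = ord v j \<Longrightarrow> i = j"
  using ord_facets[of v] by (auto simp: bij_betw_def inj_on_def)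

lemma ell_ord_vertex: "v \<in> vertices \<Longrightarrow> ell (ord v j) v = 0"
  using ord_active[of v j] by (simp add: active_def)

lemma A_vertex: "v \<in> vertices \<Longrightarrow> A v *v v = lam_vec v"
  using ell_ord[of v v] ell_ord_vertex by (simp add: vec_eq_iff)

lemma chart_dir_nu: "v \<in> vertices \<Longrightarrow> chart_dir v (nu (ord v j)) = axis j 1"
  using chart_dir_T[of v "axis j 1"] by (simp add: T_axis)

lemma ell_affine: "ell r ((1 - u) *\<^sub>R x + u *\<^sub>R y) = (1 - u) * ell r x + u * ell r y"
  by (simp add: ell_def inner_add_right algebra_simps)

lemma continuous_ell [continuous_intros]: "continuous_on S f \<Longrightarrow> continuous_on S (\<lambda>x. ell r (f x))"
  unfolding ell_def by (intro continuous_intros)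

lemma open_ell_pos:
  assumes "finite R" "continuous_on UNIV f"
  shows "open {w. \<forall>r\<in>R. 0 < ell r (f w)}"
proof -
  have "{w. \<forall>r\<in>R. 0 < ell r (f w)} = (\<Inter>r\<in>R. {w. 0 < ell r (f w)})" by auto
  moreover have "open (\<Inter>r\<in>R. {w. 0 < ell r (f w)})"
    by (intro open_INT assms(1) ballI open_Collect_less continuous_intros assms(2))
  ultimately show ?thesis by simp
qed

lemma smooth_ell [smooth_intros]: "open S \<Longrightarrow> smooth_on S f \<Longrightarrow> smooth_on S (\<lambda>x. ell r (f x))"
  unfolding ell_def by (intro smooth_intros)

subsection \<open>Faces\<close>

lemma P_ge: "x \<in> P \<Longrightarrow> r < d \<Longrightarrow> 0 \<le> ell r x"
  by (simp add: P_def)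

lemma active_subset_iff:
  assumes "\<And>r. r < d \<Longrightarrow> r \<in> R \<Longrightarrow> 0 \<le> ell r x"
  shows "x \<in> P \<and> active x \<subseteq> R \<longleftrightarrow> (\<forall>r<d. r \<notin> R \<longrightarrow> 0 < ell r x)"
proof
  assume L: "x \<in> P \<and> active x \<subseteq> R"
  show "\<forall>r<d. r \<notin> R \<longrightarrow> 0 < ell r x"
  proof (intro allI impI)
    fix r assume "r < d" "r \<notin> R"
    then have "0 \<le> ell r x" "r \<notin> active x" using L P_ge by auto
    then show "0 < ell r x" using \<open>r < d\<close> by (simp add: active_def)
  qed
next
  assume R: "\<forall>r<d. r \<notin> R \<longrightarrow> 0 < ell r x"
  have "0 \<le> ell r x" if "r < d" for r
    using assms[OF that] R that by (cases "r \<in> R") (auto simp: less_imp_le)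
  moreover have "r \<in> R" if "r \<in> active x" for r
    using R that by (auto simp: active_def)
  ultimately show "x \<in> P \<and> active x \<subseteq> R" by (auto simp: P_def)
qed

lemma convex_P: "convex P"
proof -
  have "P = (\<Inter>r\<in>{..<d}. {x. nu r \<bullet> x \<ge> real_of_int (lam r)})"
    by (auto simp: P_def ell_def)
  then show ?thesis by (simp add: convex_INT convex_halfspace_ge)
qed

lemma face_of_active:
  assumes "R \<subseteq> {..<d}"
  shows "{y\<in>P. \<forall>r\<in>R. ell r y = 0} face_of P"
  unfolding face_of_def
proof (intro conjI ballI impI)
  show "convex {y \<in> P. \<forall>r\<in>R. ell r y = 0}"
    unfolding convex_alt using convex_P[unfolded convex_alt] by (auto simp: ell_affine)
  fix a b x assume ab: "a \<in> P" "b \<in> P" and x: "x \<in> {y \<in> P. \<forall>r\<in>R. ell r y = 0}" "x \<in> open_segment a b"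
  obtain u where u: "0 < u" "u < 1" "x = (1 - u) *\<^sub>R a + u *\<^sub>R b"
    using x(2) by (auto simp: in_segment)
  have "ell r a = 0 \<and> ell r b = 0" if "r \<in> R" for r
  proof -
    have "ell r a \<ge> 0" "ell r b \<ge> 0" using ab that assms by (auto simp: P_def)
    moreover have "(1 - u) * ell r a + u * ell r b = 0"
      using x(1) that u(3) by (simp add: ell_affine)
    ultimately show ?thesis
      using u add_nonneg_eq_0_iff[of "(1 - u) * ell r a" "u * ell r b"] by simp
  qed
  then show "a \<in> {y \<in> P. \<forall>r\<in>R. ell r y = 0}" "b \<in> {y \<in> P. \<forall>r\<in>R. ell r y = 0}"
    using ab by auto
qed auto

lemma vertex_in_P: "v \<in> vertices \<Longrightarrow> v \<in> P"
  by (simp add: vertices_def extreme_point_of_def)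

text \<open>
  A point lies in the relative interior of the face cut out by its active facets. Conversely, a
  facet function that vanishes at a relative interior point of a face, where it is nonnegative,
  vanishes on the face: otherwise it would become negative beyond that point.
\<close>

lemma P_at_eq:
  assumes v: "v \<in> vertices"
  shows "P_at v = {x \<in> P. active x \<subseteq> active v}"
proof (intro equalityI subsetI)
  fix x assume "x \<in> P_at v"
  then obtain F where F: "F face_of P" "v \<in> F" "x \<in> rel_interior F" by (auto simp: P_at_def)
  have FP: "F \<subseteq> P" using F(1) by (rule face_of_imp_subset)
  have xF: "x \<in> F" using F(3) rel_interior_subset by blast
  have "r \<in> active v" if r: "r \<in> active x" for r
  proof (rule ccontr)
    assume "r \<notin> active v"
    then have pos: "ell r v > 0"
      using r vertex_in_P[OF v] by (auto simp: active_def P_def less_le)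
    have "v \<noteq> x" using pos r by (auto simp: active_def)
    then obtain e where e: "e > 1" "(1 - e) *\<^sub>R v + e *\<^sub>R x \<in> F"
      using convex_rel_interior_if[OF face_of_imp_convex[OF F(1)] F(3)] hull_inc[OF F(2)] by blast
    have "ell r ((1 - e) *\<^sub>R v + e *\<^sub>R x) = (1 - e) * ell r v"
      using r by (simp add: ell_affine active_def)
    also have "\<dots> < 0" using e pos by (simp add: mult_neg_pos)
    finally have "ell r ((1 - e) *\<^sub>R v + e *\<^sub>R x) < 0" .
    then show False using P_ge[OF subsetD[OF FP e(2)] active_d[OF r]] by linarith
  qed
  then show "x \<in> {x \<in> P. active x \<subseteq> active v}" using xF FP by auto
next
  fix x assume x: "x \<in> {x \<in> P. active x \<subseteq> active v}"
  let ?F = "{y\<in>P. \<forall>r\<in>active x. ell r y = 0}"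
  have F: "?F face_of P" by (rule face_of_active) (auto simp: active_def)
  have vF: "v \<in> ?F" using x vertex_in_P[OF v] by (auto simp: active_def)
  have "x \<in> rel_interior ?F"
    unfolding mem_rel_interior
  proof (intro exI conjI)
    let ?T = "{y. \<forall>r\<in>{..<d} - active x. 0 < ell r y}"
    show "open ?T" by (rule open_ell_pos) simp_all
    show "x \<in> ?T \<inter> ?F" using x by (auto simp: active_def P_def less_le)
    have aff: "affine hull ?F \<subseteq> {y. \<forall>r\<in>active x. ell r y = 0}"
    proof (rule hull_minimal)
      have "affine (\<Inter>r\<in>active x. {y. nu r \<bullet> y = real_of_int (lam r)})"
        by (intro affine_Inter) (auto simp: affine_hyperplane)
      moreover have "(\<Inter>r\<in>active x. {y. nu r \<bullet> y = real_of_int (lam r)}) = {y. \<forall>r\<in>active x. ell r y = 0}"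
        by (auto simp: ell_def)
      ultimately show "affine {y. \<forall>r\<in>active x. ell r y = 0}" by simp
    qed auto
    show "?T \<inter> affine hull ?F \<subseteq> ?F"
    proof
      fix y assume y: "y \<in> ?T \<inter> affine hull ?F"
      have "ell r y \<ge> 0" if "r < d" for r
        using y aff that by (cases "r \<in> active x") (auto simp: less_imp_le)
      then show "y \<in> ?F" using y aff by (auto simp: P_def)
    qed
  qed
  then show "x \<in> P_at v" using F vF by (auto simp: P_at_def)
qed

text \<open>
  The face cut out by the active facets of \<open>x\<close> has an extreme point.
\<close>

lemma ex_vertex:
  assumes "x \<in> P"
  shows "\<exists>v\<in>vertices. x \<in> P_at v"
proof -
  let ?F = "{y\<in>P. \<forall>r\<in>active x. ell r y = 0}"
  have F: "?F face_of P" by (rule face_of_active) (auto simp: active_def)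
  have "compact ?F" by (rule face_of_imp_compact[OF convex_P compact_P F])
  moreover have "x \<in> ?F" using assms by (auto simp: active_def)
  ultimately obtain v where "v extreme_point_of ?F"
    using extreme_point_exists_convex[of ?F] face_of_imp_convex[OF F] by blast
  then have "v extreme_point_of P" "v \<in> ?F"
    using extreme_point_of_face[OF F] by auto
  then have "v \<in> vertices" "active x \<subseteq> active v" by (auto simp: vertices_def active_def)
  then show ?thesis using assms by (auto simp: P_at_eq)
qed

subsection \<open>Points of the toric manifold\<close>

text \<open>
  The relation \<open>same_point\<close> within the fiber over \<open>x\<close>.
\<close>

definition same_angle :: "real^'n \<Rightarrow> real^'n \<Rightarrow> real^'n \<Rightarrow> bool" where
  "same_angle x t t' \<longleftrightarrow> (\<exists>k \<in> int_lattice. t' - t - (2 * pi) *\<^sub>R k \<in> span (nu ` active x))"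

lemma same_point_iff: "((x, t), (x', t')) \<in> same_point \<longleftrightarrow> x \<in> P \<and> x' = x \<and> same_angle x t t'"
  by (auto simp: same_point_def same_angle_def int_lattice_iff Bex_def)

lemma same_angle_refl: "same_angle x t t"
  unfolding same_angle_def by (rule bexI[of _ 0]) (auto simp: span_zero int_lattice_def)

lemma same_angle_sym: "same_angle x t t' \<Longrightarrow> same_angle x t' t"
  unfolding same_angle_def
proof (elim bexE)
  fix k assume "k \<in> int_lattice" "t' - t - (2 * pi) *\<^sub>R k \<in> span (nu ` active x)"
  then show "\<exists>k\<in>int_lattice. t - t' - (2 * pi) *\<^sub>R k \<in> span (nu ` active x)"
    using span_neg[of "t' - t - (2 * pi) *\<^sub>R k"]
    by (intro bexI[of _ "-k"]) (simp_all add: int_lattice_minus algebra_simps)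
qed

lemma same_angle_trans: "same_angle x t t' \<Longrightarrow> same_angle x t' t'' \<Longrightarrow> same_angle x t t''"
  unfolding same_angle_def
proof (elim bexE)
  fix k k' assume "k \<in> int_lattice" "t' - t - (2 * pi) *\<^sub>R k \<in> span (nu ` active x)"
    "k' \<in> int_lattice" "t'' - t' - (2 * pi) *\<^sub>R k' \<in> span (nu ` active x)"
  then show "\<exists>k\<in>int_lattice. t'' - t - (2 * pi) *\<^sub>R k \<in> span (nu ` active x)"
    using span_add[of "t' - t - (2 * pi) *\<^sub>R k" _ "t'' - t' - (2 * pi) *\<^sub>R k'"]
    by (intro bexI[of _ "k + k'"]) (simp_all add: int_lattice_add algebra_simps)
qed

lemma same_angle_shift: "same_angle x (t + s) (t' + s) \<longleftrightarrow> same_angle x t t'"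
  by (simp add: same_angle_def)

definition torus_class :: "real^'n \<Rightarrow> real^'n \<Rightarrow> 'n toric_point" where
  "torus_class x t = {(x, t') | t'. same_angle x t t'}"

lemma X_eq: "X = {torus_class x t | x t. x \<in> P}"
proof -
  have "same_point `` {(x, t)} = torus_class x t" if "x \<in> P" for x t
    using that by (auto simp: same_point_iff torus_class_def)
  then show ?thesis unfolding X_def quotient_def by fastforce
qed

lemma torus_class_eq: "same_angle x t t' \<Longrightarrow> torus_class x t = torus_class x t'"
  unfolding torus_class_def using same_angle_sym same_angle_trans by blast

lemma torus_class_self: "(x, t) \<in> torus_class x t"
  by (simp add: torus_class_def same_angle_refl)

lemma some_torus_class: "\<exists>t'. (SOME q. q \<in> torus_class x t) = (x, t') \<and> same_angle x t t'"
  using someI[of "\<lambda>q. q \<in> torus_class x t", OF torus_class_self] by (auto simp: torus_class_def)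

lemma moment_torus_class [simp]: "moment (torus_class x t) = x"
  using some_torus_class[of x t] by (auto simp: moment_def)

lemma angle_torus_class: "same_angle x t (angle (torus_class x t))"
  using some_torus_class[of x t] by (auto simp: angle_def)

lemma X_cases:
  assumes "p \<in> X" obtains x t where "p = torus_class x t" "x \<in> P"
  using assms by (auto simp: X_eq)

lemma moment_P: "p \<in> X \<Longrightarrow> moment p \<in> P"
  by (auto simp: X_eq)

lemma torus_class_X [simp]: "torus_class x t \<in> X \<longleftrightarrow> x \<in> P"
  by (auto simp: X_eq) (metis moment_torus_class)

lemma torus_act_torus_class: "torus_act s (torus_class x t) = torus_class x (t + s)"
proof -
  have "(\<lambda>(x, t). (x, t + s)) ` {(x, t') | t'. same_angle x t t'} = {(x, t') | t'. same_angle x (t + s) t'}"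
  proof (intro equalityI subsetI)
    fix q assume "q \<in> {(x, t') | t'. same_angle x (t + s) t'}"
    then obtain t' where t': "q = (x, t')" "same_angle x (t + s) t'" by blast
    then have "same_angle x t (t' - s)" using same_angle_shift[of x t s "t' - s"] by simp
    then show "q \<in> (\<lambda>(x, t). (x, t + s)) ` {(x, t') | t'. same_angle x t t'}"
      using t' by (auto intro!: image_eqI[of _ _ "(x, t' - s)"])
  qed (auto simp: same_angle_shift)
  then show ?thesis by (simp add: torus_act_def torus_class_def)
qed

lemma torus_act_X [simp]: "p \<in> X \<Longrightarrow> torus_act s p \<in> X"
  by (auto simp: torus_act_torus_class elim!: X_cases)

lemma moment_torus_act [simp]: "p \<in> X \<Longrightarrow> moment (torus_act s p) = moment p"
  by (auto simp: torus_act_torus_class elim!: X_cases)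

lemma V_iff: "v \<in> vertices \<Longrightarrow> p \<in> V v \<longleftrightarrow> p \<in> X \<and> active (moment p) \<subseteq> active v"
  using moment_P by (auto simp: V_def P_at_eq)

lemma V_X: "p \<in> V v \<Longrightarrow> p \<in> X"
  by (simp add: V_def)

lemma V_cases:
  assumes "p \<in> V v" "v \<in> vertices"
  obtains x t where "p = torus_class x t" "x \<in> P" "active x \<subseteq> active v"
  using assms by (auto simp: V_iff elim!: X_cases)

lemma torus_act_V [simp]: "p \<in> V v \<Longrightarrow> torus_act s p \<in> V v"
  by (auto simp: V_def)

text \<open>
  Only the coordinates that vanish at \<open>x\<close> see the collapsed subtorus. This makes the charts well
  defined.
\<close>

lemma chart_dir_span:
  assumes "v \<in> vertices" "active x \<subseteq> active v" "ell (ord v j) x \<noteq> 0" "s \<in> span (nu ` active x)"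
  shows "chart_dir v s $ j = 0"
  using assms(4)
proof (induction rule: span_induct_alt)
  case base
  then show ?case by (simp add: matrix_vector_mult_0_right)
next
  case (step c y s)
  then obtain r where r: "r \<in> active x" "y = nu r" by blast
  then obtain i where i: "ord v i = r" using ord_ex assms by blast
  then have "i \<noteq> j" using assms(3) r by (auto simp: active_def)
  then have "chart_dir v y $ j = 0" using chart_dir_nu[OF assms(1), of i] r i by (simp add: axis_def)
  then show ?case using step by (simp add: matrix_vector_right_distrib vector_scalar_commute matrix_vector_mult_scaleR)
qed

lemma chart_torus_class:
  assumes v: "v \<in> vertices" and x: "active x \<subseteq> active v"
  shows "chart v (torus_class x t) = (\<chi> j. of_real (sqrt (2 * ell (ord v j) x)) * cis (chart_dir v t $ j))"
proof -
  obtain k where k: "k \<in> int_lattice" "angle (torus_class x t) - t - (2 * pi) *\<^sub>R k \<in> span (nu ` active x)"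
    using angle_torus_class[of x t] by (auto simp: same_angle_def)
  define s where "s = angle (torus_class x t) - t - (2 * pi) *\<^sub>R k"
  have eq: "chart_dir v (angle (torus_class x t)) = chart_dir v t + (2 * pi) *\<^sub>R chart_dir v k + chart_dir v s"
    by (simp add: s_def matrix_vector_right_distrib[symmetric] matrix_vector_mult_scaleR[symmetric])
  have "of_real (sqrt (2 * ell (ord v j) x)) * cis (chart_dir v (angle (torus_class x t)) $ j)
      = of_real (sqrt (2 * ell (ord v j) x)) * cis (chart_dir v t $ j)" for j
  proof (cases "ell (ord v j) x = 0")
    case False
    then have "chart_dir v s $ j = 0" using chart_dir_span[OF v x False k(2)] by (simp add: s_def)
    moreover have "chart_dir v k $ j \<in> \<int>" using chart_dir_lattice[OF v k(1)] by (simp add: int_lattice_def)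
    ultimately show ?thesis by (simp add: eq cis_mult[symmetric] cis_int)
  qed simp
  then show ?thesis unfolding chart_def Let_def moment_torus_class ell_ord T_def[symmetric] by (simp add: vec_eq_iff)
qed

lemma act_chart_torus_class:
  assumes "v \<in> vertices" "x \<in> P" "active x \<subseteq> active v"
  shows "act j (chart v (torus_class x t)) = ell (ord v j) x"
proof -
  have "ell (ord v j) x \<ge> 0" using assms ord_active[of v j] by (auto simp: P_def active_def)
  then show ?thesis using assms by (simp add: chart_torus_class act_def norm_mult)
qed

text \<open>
  The moment map in the chart at \<open>v\<close>, extended to all of \<open>\<complex>\<^sup>n\<close>.
\<close>

definition moment_at :: "real^'n \<Rightarrow> complex^'n \<Rightarrow> real^'n" where
  "moment_at v w = matrix_inv (A v) *v (actv w + lam_vec v)"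

lemma ell_moment_at: "v \<in> vertices \<Longrightarrow> ell (ord v j) (moment_at v w) = act j w"
  using ell_ord[of v "moment_at v w" j] by (simp add: moment_at_def)

lemma smooth_moment_at [smooth_intros]:
  assumes "open S" "smooth_on S f" shows "smooth_on S (\<lambda>x. moment_at v (f x))"
proof -
  have "bounded_linear ((*v) (matrix_inv (A v)))" by simp
  then show ?thesis
    unfolding moment_at_def by (rule smooth_bounded_linear[OF _ assms(1)]) (intro smooth_intros assms)
qed

lemma continuous_moment_at [continuous_intros]: "continuous_on S f \<Longrightarrow> continuous_on S (\<lambda>x. moment_at v (f x))"
  by (rule continuous_on_compose2[OF smooth_on_continuous_on[OF smooth_moment_at[OF open_UNIV smooth_id[OF open_UNIV]]]]) auto

lemma moment_at_chart:
  assumes "v \<in> vertices" "p \<in> V v"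
  shows "moment_at v (chart v p) = moment p"
proof -
  obtain x t where p: "p = torus_class x t" "x \<in> P" "active x \<subseteq> active v" using V_cases assms by blast
  have "actv (chart v p) + lam_vec v = A v *v x"
    using ell_ord[of v x] assms p by (simp add: vec_eq_iff act_chart_torus_class algebra_simps)
  then show ?thesis using assms p by (simp add: moment_at_def)
qed

lemma moment_at_rot [simp]: "moment_at v (rot s w) = moment_at v w"
  by (simp add: moment_at_def)

text \<open>
  The image of the chart: membership in \<open>P\<close> and \<open>P_at v\<close> only constrains the facets that do not
  contain \<open>v\<close>, because the others are the action coordinates.
\<close>

definition Omega :: "real^'n \<Rightarrow> (complex^'n) set" where
  "Omega v = {w. \<forall>r<d. r \<notin> active v \<longrightarrow> ell r (moment_at v w) > 0}"

lemma moment_at_P_at: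
  assumes "v \<in> vertices"
  shows "moment_at v w \<in> P_at v \<longleftrightarrow> w \<in> Omega v"
proof -
  have "ell r (moment_at v w) \<ge> 0" if "r \<in> active v" for r
    using ord_ex[OF assms that] ell_moment_at[OF assms] act_nonneg by metis
  then show ?thesis
    using active_subset_iff[of "active v" "moment_at v w"] by (simp add: P_at_eq[OF assms] Omega_def)
qed

lemma open_Omega [simp]: "open (Omega v)"
proof -
  have "Omega v = {w. \<forall>r\<in>{r. r < d \<and> r \<notin> active v}. ell r (moment_at v w) > 0}" by (auto simp: Omega_def)
  then show ?thesis using open_ell_pos[of "{r. r < d \<and> r \<notin> active v}" "moment_at v"]
    by (simp add: continuous_moment_at[OF continuous_on_id])
qed

lemma Omega_rot [simp]: "rot s w \<in> Omega v \<longleftrightarrow> w \<in> Omega v"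
  by (simp add: Omega_def)

definition pt :: "real^'n \<Rightarrow> complex^'n \<Rightarrow> 'n toric_point" where
  "pt v w = torus_class (moment_at v w) (T v *v (\<chi> j. Arg (w $ j)))"

lemma chart_pt:
  assumes "v \<in> vertices" "w \<in> Omega v"
  shows "pt v w \<in> V v" "chart v (pt v w) = w"
proof -
  have x: "moment_at v w \<in> P" "active (moment_at v w) \<subseteq> active v"
    using assms moment_at_P_at[of v w] by (auto simp: P_at_eq)
  then show "pt v w \<in> V v" using assms by (simp add: pt_def V_iff)
  have "of_real (sqrt (2 * act j w)) * cis (Arg (w $ j)) = w $ j" for j
    using rcis_cmod_Arg[of "w $ j"] by (simp add: act_def rcis_def)
  then show "chart v (pt v w) = w"
    using assms x by (simp add: pt_def chart_torus_class ell_moment_at vec_eq_iff)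
qed

lemma chart_Omega:
  assumes "v \<in> vertices" "p \<in> V v" shows "chart v p \<in> Omega v"
  using assms moment_at_P_at[of v "chart v p"] by (simp add: moment_at_chart V_def)

text \<open>
  Equal coordinates determine the angles \<open>chart_dir v t\<close> modulo \<open>2 \<pi>\<close> where the radius is positive and
  leave them free where it is zero; the latter directions span the collapsed subtorus.
\<close>

lemma inj_chart:
  assumes v: "v \<in> vertices" shows "inj_on (chart v) (V v)"
proof (rule inj_onI)
  fix p q assume p: "p \<in> V v" and q: "q \<in> V v" and eq: "chart v p = chart v q"
  obtain x t where pt: "p = torus_class x t" "x \<in> P" "active x \<subseteq> active v" using V_cases p v by blast
  obtain x' t' where qt: "q = torus_class x' t'" "x' \<in> P" using V_cases q v by blast
  have x': "x' = x" using moment_at_chart[OF v p] moment_at_chart[OF v q] eq by (simp add: pt qt)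
  have "\<exists>k. (k \<in> \<int>) \<and> (ell (ord v j) x \<noteq> 0 \<longrightarrow> chart_dir v t' $ j - chart_dir v t $ j = 2 * pi * k)" for j
  proof (cases "ell (ord v j) x = 0")
    case False
    then have "cis (chart_dir v t $ j) = cis (chart_dir v t' $ j)"
      using arg_cong[OF eq, of "\<lambda>w. w $ j"] pt v by (simp add: x' qt chart_torus_class)
    then have "cis (chart_dir v t' $ j - chart_dir v t $ j) = 1" by (simp add: cis_divide[symmetric])
    then have "cos (chart_dir v t' $ j - chart_dir v t $ j) = 1" by (metis cis.sel(1) one_complex.sel(1))
    then obtain n :: int where "chart_dir v t' $ j - chart_dir v t $ j = of_int n * 2 * pi" by (auto simp: cos_one_2pi_int)
    then show ?thesis by (intro exI[of _ "of_int n"]) auto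
  qed (auto intro: exI[of _ 0])
  then obtain k where k: "\<And>j. k j \<in> \<int>" "\<And>j. ell (ord v j) x \<noteq> 0 \<Longrightarrow> chart_dir v t' $ j - chart_dir v t $ j = 2 * pi * k j"
    by metis
  \<comment> \<open>What remains after removing the multiples of the period points in the collapsed directions.\<close>
  define s where "s = chart_dir v t' - chart_dir v t - (2 * pi) *\<^sub>R (\<chi> j. k j)"
  have "T v *v s \<in> span (nu ` active x)"
    unfolding T_mult
  proof (rule span_sum)
    fix j
    show "(s $ j) *\<^sub>R nu (ord v j) \<in> span (nu ` active x)"
    proof (cases "ell (ord v j) x = 0")
      case True
      then have "ord v j \<in> active x" using ord_active[OF v, of j] by (simp add: active_def)
      then show ?thesis by (intro span_scale span_base) auto
    next
      case False
      then show ?thesis using k(2)[OF False] by (simp add: s_def span_zero)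
    qed
  qed
  moreover have "T v *v s = t' - t - (2 * pi) *\<^sub>R (T v *v (\<chi> j. k j))"
    by (simp add: s_def matrix_vector_mult_diff_distrib matrix_vector_mult_scaleR v)
  moreover have "T v *v (\<chi> j. k j) \<in> int_lattice"
    by (rule T_lattice) (simp add: int_lattice_def k)
  ultimately have "same_angle x t t'" unfolding same_angle_def by metis
  then show "p = q" unfolding pt(1) qt(1) x' by (rule torus_class_eq)
qed

lemma chart_image: assumes "v \<in> vertices" shows "chart v ` V v = Omega v"
proof (intro equalityI subsetI)
  fix w assume "w \<in> Omega v"
  then show "w \<in> chart v ` V v" using chart_pt[OF assms] by (intro image_eqI[of _ _ "pt v w"]) auto
qed (use chart_Omega[OF assms] in auto)

lemma chart_inv_chart [simp]: "v \<in> vertices \<Longrightarrow> p \<in> V v \<Longrightarrow> chart_inv v (chart v p) = p"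
  unfolding chart_inv_def by (rule inv_into_f_f[OF inj_chart])

lemma chart_inv_eq: "v \<in> vertices \<Longrightarrow> w \<in> Omega v \<Longrightarrow> chart_inv v w = pt v w"
  using chart_inv_chart[of v "pt v w"] chart_pt by simp

lemma chart_inv_V [simp]: "v \<in> vertices \<Longrightarrow> w \<in> Omega v \<Longrightarrow> chart_inv v w \<in> V v"
  and chart_chart_inv [simp]: "v \<in> vertices \<Longrightarrow> w \<in> Omega v \<Longrightarrow> chart v (chart_inv v w) = w"
  by (simp_all add: chart_inv_eq chart_pt)

lemma chart_inv_X [simp]: "v \<in> vertices \<Longrightarrow> w \<in> Omega v \<Longrightarrow> chart_inv v w \<in> X"
  by (rule V_X[OF chart_inv_V])

lemma moment_chart_inv [simp]: "v \<in> vertices \<Longrightarrow> w \<in> Omega v \<Longrightarrow> moment (chart_inv v w) = moment_at v w"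
  using moment_at_chart[of v "chart_inv v w"] by simp

lemma chart_image_Int: "v \<in> vertices \<Longrightarrow> chart v ` (W \<inter> V v) = {w \<in> Omega v. chart_inv v w \<in> W}"
proof (intro equalityI subsetI)
  assume v: "v \<in> vertices"
  {
    fix w assume "w \<in> chart v ` (W \<inter> V v)"
    then show "w \<in> {w \<in> Omega v. chart_inv v w \<in> W}" using v chart_Omega by auto
  next
    fix w assume "w \<in> {w \<in> Omega v. chart_inv v w \<in> W}"
    then show "w \<in> chart v ` (W \<inter> V v)"
      using v by (intro image_eqI[of _ _ "chart_inv v w"]) auto
  }
qed

lemma chart_torus_act:
  assumes "v \<in> vertices" "p \<in> V v"
  shows "chart v (torus_act s p) = rot (chart_dir v s) (chart v p)"
proof -
  obtain x t where p: "p = torus_class x t" "x \<in> P" "active x \<subseteq> active v" using V_cases assms by blast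
  then show ?thesis
    using assms by (simp add: torus_act_torus_class chart_torus_class vec_eq_iff matrix_vector_right_distrib cis_mult[symmetric])
qed

lemma chart_inv_rot:
  assumes "v \<in> vertices" "w \<in> Omega v"
  shows "chart_inv v (rot (chart_dir v s) w) = torus_act s (chart_inv v w)"
  using chart_inv_chart[of v "torus_act s (chart_inv v w)"] assms by (simp add: chart_torus_act)

lemma orbit_tangent_eq:
  assumes "v \<in> vertices" "w \<in> Omega v"
  shows "orbit_tangent v w = range (\<lambda>s. rot_field s w)"
proof -
  have eq: "(\<lambda>t. chart v (torus_act (t *\<^sub>R s) (chart_inv v w))) = (\<lambda>t. rot (t *\<^sub>R chart_dir v s) w)" for s
    using assms by (simp add: chart_torus_act matrix_vector_mult_scaleR)
  have "((\<lambda>t. rot (t *\<^sub>R chart_dir v s) w) has_vector_derivative u) (at 0) \<longleftrightarrow> u = rot_field (chart_dir v s) w" for s u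
    using rot_has_vector_derivative[of "chart_dir v s" w 0] vector_derivative_unique_at by auto
  then have "orbit_tangent v w = {u. \<exists>s. u = rot_field (chart_dir v s) w}" by (simp add: orbit_tangent_def eq)
  also have "\<dots> = range (\<lambda>s. rot_field s w)"
  proof (intro equalityI subsetI)
    fix u assume "u \<in> range (\<lambda>s. rot_field s w)"
    then obtain s where "u = rot_field (chart_dir v (T v *v s)) w" using assms(1) by auto
    then show "u \<in> {u. \<exists>s. u = rot_field (chart_dir v s) w}" by blast
  qed auto
  finally show ?thesis .
qed

subsection \<open>Changes of charts and frames\<close>

definition overlap :: "real^'n \<Rightarrow> real^'n \<Rightarrow> (complex^'n) set" where
  "overlap v v' = {w \<in> Omega v. chart_inv v w \<in> V v'}"

lemma overlap_eq:
  assumes "v \<in> vertices" "v' \<in> vertices"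
  shows "overlap v v' = {w. \<forall>r\<in>{..<d} - (active v \<inter> active v'). ell r (moment_at v w) > 0}"
proof -
  have "w \<in> Omega v \<and> chart_inv v w \<in> V v' \<longleftrightarrow> (\<forall>r\<in>{..<d} - (active v \<inter> active v'). ell r (moment_at v w) > 0)" for w
  proof (cases "w \<in> Omega v")
    case True
    then have x: "moment_at v w \<in> P" "active (moment_at v w) \<subseteq> active v"
      using moment_at_P_at[OF assms(1), of w] by (auto simp: P_at_eq assms)
    have "chart_inv v w \<in> V v' \<longleftrightarrow> active (moment_at v w) \<subseteq> active v'"
      using True assms by (simp add: V_iff[OF assms(2)])
    also have "\<dots> \<longleftrightarrow> moment_at v w \<in> P \<and> active (moment_at v w) \<subseteq> active v \<inter> active v'"
      using x by simp
    also have "\<dots> \<longleftrightarrow> (\<forall>r<d. r \<notin> active v \<inter> active v' \<longrightarrow> 0 < ell r (moment_at v w))"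
      by (rule active_subset_iff) (rule P_ge[OF x(1)])
    finally show ?thesis using True by (simp add: Ball_def imp_conjL)
  qed (auto simp: Omega_def)
  then show ?thesis by (auto simp: overlap_def)
qed

lemma open_overlap: "v \<in> vertices \<Longrightarrow> v' \<in> vertices \<Longrightarrow> open (overlap v v')"
  unfolding overlap_eq by (rule open_ell_pos) (simp_all add: continuous_moment_at[OF continuous_on_id])

lemma overlap_Omega: "overlap v v' \<subseteq> Omega v"
  by (auto simp: overlap_def)

text \<open>
  On the overlap, only coordinates belonging to facets through both vertices can vanish.
\<close>

lemma overlap_nonzero:
  assumes "v \<in> vertices" "v' \<in> vertices" "w \<in> overlap v v'" "ord v j \<notin> active v'"
  shows "w $ j \<noteq> 0"
proof -
  have "ord v j \<in> {..<d} - (active v \<inter> active v')"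
    using assms ord_active[of v j] active_d by auto
  then have "0 < ell (ord v j) (moment_at v w)" using assms(3) unfolding overlap_eq[OF assms(1,2)] by blast
  then have "act j w > 0" using ell_moment_at[OF assms(1), of j w] by simp
  then show ?thesis by (auto simp: act_def)
qed

lemma smooth_cis_integer_combination:
  assumes "open S" "finite D" "\<And>j. j \<in> D \<Longrightarrow> n j \<in> \<int>" "\<And>j w. j \<in> D \<Longrightarrow> w \<in> S \<Longrightarrow> w $ j \<noteq> 0"
  shows "smooth_on S (\<lambda>w :: complex^'m. cis (\<Sum>j\<in>D. n j * Arg (w $ j)))"
proof -
  have "smooth_on S (\<lambda>w. \<Prod>j\<in>D. cis (n j * Arg (w $ j)))"
    by (intro smooth_intros assms) (use assms in auto)
  moreover have "(\<Prod>j\<in>D. cis (f j)) = cis (\<Sum>j\<in>D. f j)" for f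
    using assms(2) by (induction D) (auto simp: cis_mult[symmetric])
  ultimately show ?thesis by simp
qed

text \<open>
  The new coordinates are square roots of facet functions times products of integral powers of the
  phases \<open>w\<^sub>j / |w\<^sub>j|\<close>. Phases of coordinates \<open>j \<in> D\<close> are smooth on the overlap. A facet through both
  vertices gives a coordinate that may vanish, but its phase enters only the new coordinate of the
  same facet, with exponent \<open>1\<close>, where together with the square root it reproduces \<open>w\<^sub>j\<close>.
\<close>

lemma smooth_transition:
  assumes v: "v \<in> vertices" and v': "v' \<in> vertices"
  shows "smooth_on (overlap v v') (\<lambda>w. chart v' (chart_inv v w))"
proof -
  let ?O = "overlap v v'"
  note oO = open_overlap[OF v v']
  define D where "D = {j. ord v j \<notin> active v'}"
  define C where "C k j = chart_dir v' (nu (ord v j)) $ k" for k j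
  have CZ: "C k j \<in> \<int>" for k j
    using chart_dir_lattice[OF v', of "nu (ord v j)"] by (simp add: C_def int_lattice_def)
  have shared: "C k j = (if ord v' k = ord v j then 1 else 0)" if "j \<notin> D" for k j
  proof -
    have "ord v j \<in> active v'" using that by (simp add: D_def)
    then obtain i where i: "ord v' i = ord v j" using ord_ex[OF v'] by blast
    then have "C k j = axis i 1 $ k" using chart_dir_nu[OF v', of i] by (simp add: C_def)
    then show ?thesis using ord_inj[OF v'] i by (auto simp: axis_def)
  qed
  have comp: "chart v' (chart_inv v w) $ k = of_real (sqrt (2 * ell (ord v' k) (moment_at v w)))
      * cis (\<Sum>j\<in>UNIV. C k j * Arg (w $ j))" if w: "w \<in> ?O" for w k
  proof -
    have wO: "w \<in> Omega v" and "chart_inv v w \<in> V v'" using w by (auto simp: overlap_def)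
    then have "active (moment_at v w) \<subseteq> active v'" using v v' by (simp add: V_iff)
    moreover have "chart_inv v w = torus_class (moment_at v w) (T v *v (\<chi> j. Arg (w $ j)))"
      using chart_inv_eq[OF v wO] by (simp add: pt_def)
    moreover have "chart_dir v' (T v *v (\<chi> j. Arg (w $ j))) $ k = (\<Sum>j\<in>UNIV. C k j * Arg (w $ j))"
      by (simp add: T_mult C_def matrix_vector_right_distrib linear_sum[OF matrix_vector_mul_linear]
          matrix_vector_mult_scaleR mult.commute)
    ultimately show ?thesis using v' by (simp add: chart_torus_class)
  qed
  have "smooth_on ?O (\<lambda>w. chart v' (chart_inv v w) $ k)" for k
  proof (cases "\<exists>i. ord v i = ord v' k")
    case True
    then obtain i where i: "ord v i = ord v' k" by blast
    then have iD: "i \<notin> D" using ord_active[OF v', of k] by (simp add: D_def)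
    have "smooth_on ?O (\<lambda>w. w $ i * cis (\<Sum>j\<in>D. C k j * Arg (w $ j)))"
      by (intro smooth_intros smooth_cis_integer_combination oO CZ)
         (use overlap_nonzero[OF v v'] in \<open>auto simp: D_def\<close>)
    then show ?thesis
    proof (rule smooth_on_cong[OF oO])
      fix w assume w: "w \<in> ?O"
      have "(\<Sum>j\<in>UNIV. C k j * Arg (w $ j)) = (\<Sum>j\<in>D. C k j * Arg (w $ j)) + (\<Sum>j\<in>-D. C k j * Arg (w $ j))"
        using sum.subset_diff[of D UNIV "\<lambda>j. C k j * Arg (w $ j)"] by (simp add: Compl_eq_Diff_UNIV add.commute)
      also have "(\<Sum>j\<in>-D. C k j * Arg (w $ j)) = (\<Sum>j\<in>-D. if j = i then Arg (w $ i) else 0)"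
        using i ord_inj[OF v] by (intro sum.cong) (auto simp: shared)
      also have "\<dots> = Arg (w $ i)" using iD by simp
      finally have "chart v' (chart_inv v w) $ k = of_real (sqrt (2 * act i w)) * cis (Arg (w $ i))
          * cis (\<Sum>j\<in>D. C k j * Arg (w $ j))"
        using comp[OF w, of k] ell_moment_at[OF v, of i w] by (simp add: i cis_mult[symmetric])
      also have "of_real (sqrt (2 * act i w)) * cis (Arg (w $ i)) = w $ i"
        using rcis_cmod_Arg[of "w $ i"] by (simp add: act_def rcis_def)
      finally show "w $ i * cis (\<Sum>j\<in>D. C k j * Arg (w $ j)) = chart v' (chart_inv v w) $ k" by simp
    qed
  next
    case False
    then have "ord v' k \<notin> active v" using ord_ex[OF v] by blast
    then have "ell (ord v' k) (moment_at v w) > 0" if "w \<in> ?O" for w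
      using that overlap_Omega[of v v'] ord_active[OF v', of k] by (auto simp: Omega_def active_def)
    then have "smooth_on ?O (\<lambda>w. of_real (sqrt (2 * ell (ord v' k) (moment_at v w))) * cis (\<Sum>j\<in>D. C k j * Arg (w $ j)))"
      by (intro smooth_intros smooth_cis_integer_combination oO CZ)
         (use overlap_nonzero[OF v v'] in \<open>auto simp: D_def\<close>)
    then show ?thesis
    proof (rule smooth_on_cong[OF oO])
      fix w assume w: "w \<in> ?O"
      have "C k j = 0" if "j \<notin> D" for j using shared[OF that, of k] False by metis
      then have "(\<Sum>j\<in>UNIV. C k j * Arg (w $ j)) = (\<Sum>j\<in>D. C k j * Arg (w $ j))"
        by (intro sum.mono_neutral_right) auto
      then show "of_real (sqrt (2 * ell (ord v' k) (moment_at v w))) * cis (\<Sum>j\<in>D. C k j * Arg (w $ j))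
         = chart v' (chart_inv v w) $ k" using comp[OF w, of k] by simp
    qed
  qed
  then have "smooth_on ?O (\<lambda>w. \<chi> k. chart v' (chart_inv v w) $ k)" by (rule smooth_vec[OF oO])
  then show ?thesis by simp
qed

lemma vertex_lattice: "v \<in> vertices \<Longrightarrow> v \<in> int_lattice"
  using integral_vertices by blast

text \<open>
  The difference of two vertices of a face is orthogonal to the normals of the facets containing the
  face, and it is integral.
\<close>

lemma cis_frame_angle:
  assumes v: "v \<in> vertices" and v': "v' \<in> vertices" and x: "active x \<subseteq> active v" "active x \<subseteq> active v'"
    and t: "same_angle x t t'"
  shows "cis ((v - v') \<bullet> t') = cis ((v - v') \<bullet> t)"
proof -
  obtain k where k: "k \<in> int_lattice" "t' - t - (2 * pi) *\<^sub>R k \<in> span (nu ` active x)"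
    using t by (auto simp: same_angle_def)
  have "(v - v') \<bullet> s = 0" if "s \<in> span (nu ` active x)" for s
    using that
  proof (induction rule: span_induct_alt)
    case (step c y s)
    then obtain r where r: "r \<in> active x" "y = nu r" by blast
    then have "ell r v = 0" "ell r v' = 0" using x by (auto simp: active_def)
    then have "y \<bullet> (v - v') = 0" by (simp add: ell_def r inner_diff_right)
    then have "(v - v') \<bullet> y = 0" by (simp add: inner_commute)
    then show ?case using step by (simp add: inner_add_right)
  qed simp
  from this[OF k(2)] have "(v - v') \<bullet> t' = (v - v') \<bullet> t + 2 * pi * ((v - v') \<bullet> k)"
    by (simp add: inner_diff_right)
  moreover have "(v - v') \<bullet> k \<in> \<int>"
    using int_lattice_inner[OF int_lattice_diff[OF vertex_lattice[OF v] vertex_lattice[OF v']] k(1)] .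
  ultimately show ?thesis by (simp add: cis_mult[symmetric] cis_int)
qed

definition frame_change :: "real^'n \<Rightarrow> real^'n \<Rightarrow> 'n toric_point \<Rightarrow> complex" where
  "frame_change v v' p = cis ((v - v') \<bullet> angle p)"

lemma frame_change_torus_class:
  assumes "v \<in> vertices" "v' \<in> vertices" "active x \<subseteq> active v" "active x \<subseteq> active v'"
  shows "frame_change v v' (torus_class x t) = cis ((v - v') \<bullet> t)"
  unfolding frame_change_def by (rule cis_frame_angle[OF assms angle_torus_class])

lemma frame_change_trans: "frame_change v v' p * frame_change v' v'' p = frame_change v v'' p"
  by (simp add: frame_change_def cis_mult inner_diff_left)

lemma frame_change_self [simp]: "frame_change v v p = 1"
  by (simp add: frame_change_def)

lemma frame_change_torus_act:
  assumes "v \<in> vertices" "v' \<in> vertices" "p \<in> V v" "p \<in> V v'"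
  shows "frame_change v v' (torus_act s p) = cis ((v - v') \<bullet> s) * frame_change v v' p"
proof -
  obtain x t where p: "p = torus_class x t" "x \<in> P" "active x \<subseteq> active v" using V_cases assms by blast
  then have "active x \<subseteq> active v'" using assms by (simp add: V_iff)
  then show ?thesis
    using assms p by (simp add: torus_act_torus_class frame_change_torus_class inner_add_right cis_mult add.commute)
qed

text \<open>
  The exponent of the phase of \<open>w\<^sub>j\<close> is the difference of the values of the \<open>j\<close>-th facet function at
  the two vertices. It is an integer, and zero for facets through both.
\<close>

lemma smooth_frame_change:
  assumes v: "v \<in> vertices" and v': "v' \<in> vertices"
  shows "smooth_on (overlap v v') (\<lambda>w. frame_change v v' (chart_inv v w))"
proof -
  let ?O = "overlap v v'"
  note oO = open_overlap[OF v v']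
  define D where "D = {j. ord v j \<notin> active v'}"
  define n where "n j = (A v *v (v - v')) $ j" for j
  have nZ: "n j \<in> \<int>" for j
  proof -
    have "A v *v (v - v') \<in> int_lattice"
      by (intro int_lattice_mult int_lattice_diff vertex_lattice v v') (simp add: A_def)
    then show ?thesis by (simp add: n_def int_lattice_def)
  qed
  have n0: "n j = 0" if "j \<notin> D" for j
  proof -
    have "ell (ord v j) v' = 0" using that by (simp add: D_def active_def)
    then have "(A v *v v') $ j = lam_vec v $ j" using ell_ord[of v v' j] by simp
    then show ?thesis by (simp add: n_def matrix_vector_mult_diff_distrib A_vertex v)
  qed
  have "smooth_on ?O (\<lambda>w. cis (\<Sum>j\<in>D. n j * Arg (w $ j)))"
    by (intro smooth_cis_integer_combination oO nZ)
       (use overlap_nonzero[OF v v'] in \<open>auto simp: D_def\<close>)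
  then show ?thesis
  proof (rule smooth_on_cong[OF oO])
    fix w assume w: "w \<in> ?O"
    have wO: "w \<in> Omega v" and V': "chart_inv v w \<in> V v'" using w by (auto simp: overlap_def)
    have "active (moment_at v w) \<subseteq> active v'" using V' v v' wO by (simp add: V_iff)
    moreover have "active (moment_at v w) \<subseteq> active v" using chart_inv_V[OF v wO] v wO by (simp add: V_iff)
    moreover have "chart_inv v w = torus_class (moment_at v w) (T v *v (\<chi> j. Arg (w $ j)))"
      using chart_inv_eq[OF v wO] by (simp add: pt_def)
    ultimately have "frame_change v v' (chart_inv v w) = cis ((v - v') \<bullet> (T v *v (\<chi> j. Arg (w $ j))))"
      using v v' by (simp add: frame_change_torus_class)
    also have "(v - v') \<bullet> (T v *v (\<chi> j. Arg (w $ j))) = (\<Sum>j\<in>UNIV. n j * Arg (w $ j))"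
      unfolding A_T_inner[symmetric] by (simp add: inner_vec_def n_def)
    also have "\<dots> = (\<Sum>j\<in>D. n j * Arg (w $ j))"
      by (intro sum.mono_neutral_right) (auto simp: n0)
    finally show "cis (\<Sum>j\<in>D. n j * Arg (w $ j)) = frame_change v v' (chart_inv v w)" by simp
  qed
qed

subsection \<open>Topology\<close>

lemma open_in_X_iff:
  "open_in_X W \<longleftrightarrow> W \<subseteq> X \<and> (\<forall>v\<in>vertices. open {w \<in> Omega v. chart_inv v w \<in> W})"
  unfolding open_in_X_def by (auto simp: chart_image)

lemma topspace_X: "topspace X_top = X"
proof -
  have "{w \<in> Omega v. chart_inv v w \<in> X} = Omega v" if "v \<in> vertices" for v
    using that by auto
  then have "open_in_X X" by (simp add: open_in_X_iff)
  then have "openin X_top X" by (simp add: openin_X_top)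
  moreover have "openin X_top U \<Longrightarrow> U \<subseteq> X" for U by (simp add: openin_X_top open_in_X_iff)
  ultimately show ?thesis by (metis openin_subset openin_topspace subset_antisym)
qed

lemma openin_chart: "openin X_top W \<Longrightarrow> v \<in> vertices \<Longrightarrow> open {w \<in> Omega v. chart_inv v w \<in> W}"
  by (simp add: openin_X_top open_in_X_iff)

lemma openin_moment:
  assumes "open U" shows "openin X_top {p \<in> X. moment p \<in> U}"
  unfolding openin_X_top open_in_X_iff
proof (intro conjI ballI)
  fix v assume v: "v \<in> vertices"
  have "{w \<in> Omega v. chart_inv v w \<in> {p \<in> X. moment p \<in> U}} = Omega v \<inter> moment_at v -` U"
    using v by auto
  moreover have "open (moment_at v -` U)"
    by (rule open_vimage[OF assms]) (intro continuous_intros)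
  ultimately show "open {w \<in> Omega v. chart_inv v w \<in> {p \<in> X. moment p \<in> U}}" by (simp add: open_Int)
qed auto

lemma continuous_chart_inv:
  assumes "v \<in> vertices"
  shows "continuous_map (top_of_set (Omega v)) X_top (chart_inv v)"
  unfolding continuous_map_def
proof (intro conjI allI impI)
  show "chart_inv v \<in> topspace (top_of_set (Omega v)) \<rightarrow> topspace X_top"
    using assms by (auto simp: topspace_X)
  fix U assume "openin X_top U"
  then have "open {w \<in> Omega v. chart_inv v w \<in> U}" by (rule openin_chart[OF _ assms])
  then show "openin (top_of_set (Omega v)) {x \<in> topspace (top_of_set (Omega v)). chart_inv v x \<in> U}"
    using assms by (simp add: openin_open_eq)
qed

lemma P_at_open: "v \<in> vertices \<Longrightarrow> \<exists>U. open U \<and> P_at v = P \<inter> U"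
proof (intro exI conjI)
  assume v: "v \<in> vertices"
  let ?U = "{y. \<forall>r\<in>{..<d} - active v. 0 < ell r y}"
  show "open ?U" by (rule open_ell_pos) simp_all
  have "x \<in> P_at v \<longleftrightarrow> x \<in> P \<and> x \<in> ?U" for x
  proof (cases "x \<in> P")
    case True
    then show ?thesis
      using active_subset_iff[of "active v" x, OF P_ge] by (auto simp: P_at_eq[OF v])
  qed (simp add: P_at_eq[OF v])
  then show "P_at v = P \<inter> ?U" by blast
qed

text \<open>
  Action coordinates are affine functions of the moment map, so the chart is proper over compact sets.
\<close>

lemma compact_fiber:
  assumes v: "v \<in> vertices" and K: "compact K" "K \<subseteq> P_at v"
  shows "compact {w. moment_at v w \<in> K}"
proof -
  have "closed {w. moment_at v w \<in> K}"
  proof -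
    have "closed (moment_at v -` K)"
      by (rule closed_vimage[OF compact_imp_closed[OF K(1)]]) (intro continuous_intros)
    then show ?thesis by (simp add: vimage_def)
  qed
  moreover have "bounded {w. moment_at v w \<in> K}"
  proof -
    have "bounded ((\<lambda>x. A v *v x - lam_vec v) ` K)"
      by (intro compact_imp_bounded compact_continuous_image K continuous_intros
          linear_continuous_on matrix_vector_mul_bounded_linear)
    then obtain B where B: "\<And>x. x \<in> K \<Longrightarrow> norm (A v *v x - lam_vec v) \<le> B" by (auto simp: bounded_iff)
    have "act j w \<le> B" if "moment_at v w \<in> K" for w j
    proof -
      have "act j w = (A v *v moment_at v w - lam_vec v) $ j"
        using ell_moment_at[OF v, of j w] ell_ord[of v "moment_at v w" j] by simp
      also have "\<dots> \<le> norm (A v *v moment_at v w - lam_vec v)" using component_le_norm_cart[of _ j] by (metis abs_le_D1)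
      also have "\<dots> \<le> B" by (rule B[OF that])
      finally show ?thesis .
    qed
    then show ?thesis by (intro bounded_act[of _ "\<lambda>_. B"]) simp
  qed
  ultimately show ?thesis by (simp add: compact_eq_bounded_closed)
qed

lemma fiber_Omega: "v \<in> vertices \<Longrightarrow> K \<subseteq> P_at v \<Longrightarrow> moment_at v w \<in> K \<Longrightarrow> w \<in> Omega v"
  using moment_at_P_at by blast

lemma compact_space_X: "compact_space X_top"
proof -
  have "\<forall>x\<in>P. \<exists>v e. v \<in> vertices \<and> e > 0 \<and> P \<inter> cball x e \<subseteq> P_at v"
  proof
    fix x assume x: "x \<in> P"
    then obtain v where v: "v \<in> vertices" "x \<in> P_at v" using ex_vertex by blast
    then obtain U where U: "open U" "P_at v = P \<inter> U" using P_at_open by blast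
    then obtain e where "e > 0" "cball x e \<subseteq> U" using v(2) open_contains_cball by blast
    then show "\<exists>v e. v \<in> vertices \<and> e > 0 \<and> P \<inter> cball x e \<subseteq> P_at v" using v U by blast
  qed
  then obtain v e where ve: "\<And>x. x \<in> P \<Longrightarrow> v x \<in> vertices" "\<And>x. x \<in> P \<Longrightarrow> e x > 0"
    "\<And>x. x \<in> P \<Longrightarrow> P \<inter> cball x (e x) \<subseteq> P_at (v x)" by metis
  have "P \<subseteq> (\<Union>x\<in>P. ball x (e x))" using ve(2) by force
  then obtain F where F: "F \<subseteq> P" "finite F" "P \<subseteq> (\<Union>x\<in>F. ball x (e x))"
    using compactE_image[OF compact_P, of P "\<lambda>x. ball x (e x)"] by auto
  have c: "compactin X_top (chart_inv (v x) ` {w. moment_at (v x) w \<in> P \<inter> cball x (e x)})" if "x \<in> F" for x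
  proof -
    have x: "x \<in> P" using that F by blast
    have "compact {w. moment_at (v x) w \<in> P \<inter> cball x (e x)}"
      by (rule compact_fiber[OF ve(1)[OF x] _ ve(3)[OF x]]) (intro compact_Int_closed compact_P closed_cball)
    moreover have "{w. moment_at (v x) w \<in> P \<inter> cball x (e x)} \<subseteq> Omega (v x)"
      using fiber_Omega[OF ve(1)[OF x] ve(3)[OF x]] by blast
    ultimately have "compactin (top_of_set (Omega (v x))) {w. moment_at (v x) w \<in> P \<inter> cball x (e x)}"
      by (simp add: compactin_subtopology)
    then show ?thesis by (rule image_compactin[OF _ continuous_chart_inv[OF ve(1)[OF x]]])
  qed
  have "X \<subseteq> (\<Union>x\<in>F. chart_inv (v x) ` {w. moment_at (v x) w \<in> P \<inter> cball x (e x)})"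
  proof
    fix p assume p: "p \<in> X"
    then obtain x where x: "x \<in> F" "moment p \<in> ball x (e x)" using F(3) moment_P by blast
    then have xP: "x \<in> P" using F by blast
    have m: "moment p \<in> P \<inter> cball x (e x)" using x p moment_P by auto
    then have pV: "p \<in> V (v x)" using ve(3)[OF xP] p by (auto simp: V_def)
    have "p = chart_inv (v x) (chart (v x) p)" using ve(1)[OF xP] pV by simp
    then show "p \<in> (\<Union>x\<in>F. chart_inv (v x) ` {w. moment_at (v x) w \<in> P \<inter> cball x (e x)})"
      using x(1) m moment_at_chart[OF ve(1)[OF xP] pV] by (intro UN_I[OF x(1)] image_eqI) auto
  qed
  moreover have C: "compactin X_top (\<Union>x\<in>F. chart_inv (v x) ` {w. moment_at (v x) w \<in> P \<inter> cball x (e x)})"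
    using F(2) c by (intro compactin_Union) auto
  moreover have "(\<Union>x\<in>F. chart_inv (v x) ` {w. moment_at (v x) w \<in> P \<inter> cball x (e x)}) \<subseteq> X"
    using compactin_subset_topspace[OF C] unfolding topspace_X .
  ultimately have "X = (\<Union>x\<in>F. chart_inv (v x) ` {w. moment_at (v x) w \<in> P \<inter> cball x (e x)})"
    by (intro subset_antisym)
  with C have "compactin X_top X" by (simp only:)
  then show ?thesis by (simp add: compact_space_def topspace_X)
qed

end

section \<open>Smooth sections and covariant constancy along the torus orbits\<close>

lemma twist_cong:
  assumes "open S" "w \<in> S" "\<And>z. z \<in> S \<Longrightarrow> f z = g z" "g differentiable (at w)"
  shows "twist s f w = twist s g w"
proof -
  have "(f has_derivative frechet_derivative g (at w)) (at w)"
    by (rule has_derivative_transform_within_open[OF assms(4)[unfolded frechet_derivative_works] assms(1,2)])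
       (simp add: assms(3))
  then show ?thesis using frechet_derivative_at assms by (fastforce simp: twist_def)
qed

lemma twist_zero:
  assumes "open S" "w \<in> S" "\<And>z. z \<in> S \<Longrightarrow> f z = 0"
  shows "twist s f w = 0"
proof -
  have "twist s f w = twist s (\<lambda>_. 0) w"
    by (rule twist_cong[OF assms(1,2)]) (simp_all add: assms(3))
  then show ?thesis by (simp add: twist_def)
qed

text \<open>
  The symplectic form has constant coefficients in the coordinates \<open>a\<^sub>j, b\<^sub>j\<close>.
\<close>

lemma liouville_const:
  fixes w :: "complex^'m"
  shows "liouville_density w = liouville_density (0 :: complex^'m)"
  by (simp add: liouville_density_def omega_def)

lemma divergence_zero:
  fixes w :: "complex^'m"
  shows "divergence (\<lambda>_. 0) w = 0"
proof -
  have "partial_deriv b (\<lambda>z. liouville_density z * ((0::complex^'m) \<bullet> b)) w = 0" for b :: "complex^'m" and w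
    by (simp add: has_derivative_partial[OF has_derivative_const])
  then show ?thesis unfolding divergence_def by (simp only: sum.neutral_const div_0)
qed

lemma divergence_cong:
  fixes w :: "complex^'m"
  assumes "open S" "w \<in> S" "\<And>z. z \<in> S \<Longrightarrow> X' z = Y z"
    and "\<And>b. b \<in> Basis \<Longrightarrow> (\<lambda>z. Y z \<bullet> b) differentiable (at w)"
  shows "divergence X' w = divergence Y w"
proof -
  have "partial_deriv b (\<lambda>z. liouville_density z * (X' z \<bullet> b)) w
      = partial_deriv b (\<lambda>z. liouville_density z * (Y z \<bullet> b)) w" if b: "b \<in> Basis" for b
  proof -
    let ?c = "liouville_density (0::complex^'m)"
    have "((\<lambda>z. Y z \<bullet> b) has_derivative frechet_derivative (\<lambda>z. Y z \<bullet> b) (at w)) (at w)"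
      using assms(4)[OF b] by (simp add: frechet_derivative_works)
    from has_derivative_mult_right[OF this, of ?c]
    have d: "((\<lambda>z. liouville_density z * (Y z \<bullet> b)) has_derivative
        (\<lambda>u. ?c * frechet_derivative (\<lambda>z. Y z \<bullet> b) (at w) u)) (at w)"
      by (subst liouville_const) simp
    then have "((\<lambda>z. liouville_density z * (X' z \<bullet> b)) has_derivative
        (\<lambda>u. ?c * frechet_derivative (\<lambda>z. Y z \<bullet> b) (at w) u)) (at w)"
      by (rule has_derivative_transform_within_open[OF _ assms(1,2)]) (simp add: assms(3))
    from has_derivative_partial[OF this] has_derivative_partial[OF d] show ?thesis by simp
  qed
  then show ?thesis by (simp add: divergence_def)
qed

text \<open>
  The derivative in direction \<open>b\<close> of the \<open>b\<close>-th component is zero for each \<open>b\<close>, as infinitesimal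
  rotations are antisymmetric.
\<close>

lemma divergence_rot_field:
  fixes w :: "complex^'m"
  shows "divergence (rot_field s) w = 0"
proof -
  have "partial_deriv b (\<lambda>z. liouville_density z * (rot_field s z \<bullet> b)) w = 0" for b :: "complex^'m"
  proof -
    let ?c = "liouville_density (0::complex^'m)"
    have lin: "linear (rot_field s :: complex^'m \<Rightarrow> _)"
      by (rule linearI) (auto simp: rot_field_def vec_eq_iff algebra_simps)
    have "((\<lambda>z. ?c * (rot_field s z \<bullet> b)) has_derivative (\<lambda>u. ?c * (rot_field s u \<bullet> b))) (at w)"
      by (intro has_derivative_mult_right has_derivative_inner_left linear_imp_has_derivative lin)
    then have "((\<lambda>z. liouville_density z * (rot_field s z \<bullet> b)) has_derivative (\<lambda>u. ?c * (rot_field s u \<bullet> b))) (at w)"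
      by (subst liouville_const) simp
    from has_derivative_partial[OF this] have "partial_deriv b (\<lambda>z. liouville_density z * (rot_field s z \<bullet> b)) w = ?c * (rot_field s b \<bullet> b)" .
    moreover have "rot_field s b \<bullet> b = 0" by (simp add: inner_vec_def rot_field_def inner_complex_def)
    ultimately show ?thesis by simp
  qed
  then show ?thesis by (simp add: divergence_def)
qed

lemma action_form_rot_field: "action_form w (rot_field s w) = s \<bullet> actv w"
proof -
  have "Im (cnj z * (\<i> * of_real a * z)) / 2 = a * ((cmod z)\<^sup>2 / 2)" for z and a :: real
    unfolding cmod_power2 by (simp add: algebra_simps power2_eq_square)
  then show ?thesis
    by (simp only: action_form_def rot_field_def vec_lambda_beta inner_vec_def actv_nth act_def inner_real_def)
qed

context delzant_polytope
begin

abbreviation local_rep :: "(real^'n \<Rightarrow> 'n toric_point \<Rightarrow> complex) \<Rightarrow> real^'n \<Rightarrow> complex^'n \<Rightarrow> complex" where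
  "local_rep \<phi> v \<equiv> (\<lambda>w. \<phi> v (chart_inv v w))"

lemma sec_zero: "\<phi> \<in> smooth_sections \<Longrightarrow> \<not> (v \<in> vertices \<and> p \<in> V v) \<Longrightarrow> \<phi> v p = 0"
  by (simp add: smooth_sections_def)

lemma sec_glue:
  "\<phi> \<in> smooth_sections \<Longrightarrow> v \<in> vertices \<Longrightarrow> v' \<in> vertices \<Longrightarrow> p \<in> V v \<Longrightarrow> p \<in> V v' \<Longrightarrow>
   \<phi> v p = frame_change v v' p * \<phi> v' p"
  unfolding smooth_sections_def frame_change_def by blast

lemma sec_smooth: "\<phi> \<in> smooth_sections \<Longrightarrow> v \<in> vertices \<Longrightarrow> smooth_on (Omega v) (local_rep \<phi> v)"
  unfolding smooth_sections_def by (simp add: chart_image)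

lemma secI:
  assumes "\<And>v p. \<not> (v \<in> vertices \<and> p \<in> V v) \<Longrightarrow> \<phi> v p = 0"
    and "\<And>v v' p. v \<in> vertices \<Longrightarrow> v' \<in> vertices \<Longrightarrow> p \<in> V v \<Longrightarrow> p \<in> V v' \<Longrightarrow> \<phi> v p = frame_change v v' p * \<phi> v' p"
    and "\<And>v. v \<in> vertices \<Longrightarrow> smooth_on (Omega v) (local_rep \<phi> v)"
  shows "\<phi> \<in> smooth_sections"
  unfolding smooth_sections_def mem_Collect_eq
proof (intro conjI allI ballI impI)
  show "\<phi> v p = 0" if "\<not> (v \<in> vertices \<and> p \<in> V v)" for v p by (rule assms(1)[OF that])
  show "\<phi> v p = cis ((v - v') \<bullet> angle p) * \<phi> v' p"
    if "v \<in> vertices" "v' \<in> vertices" "p \<in> V v \<inter> V v'" for v v' p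
    by (rule assms(2)[unfolded frame_change_def]) (use that in auto)
  show "smooth_on (chart v ` V v) (local_rep \<phi> v)" if "v \<in> vertices" for v
    unfolding chart_image[OF that] by (rule assms(3)[OF that])
qed

lemma sec_lincomb:
  assumes "\<phi> \<in> smooth_sections" "\<psi> \<in> smooth_sections"
  shows "(\<lambda>v p. a * \<phi> v p + b * \<psi> v p) \<in> smooth_sections"
proof (rule secI)
  show "smooth_on (Omega v) (\<lambda>w. a * \<phi> v (chart_inv v w) + b * \<psi> v (chart_inv v w))" if "v \<in> vertices" for v
    by (intro smooth_intros sec_smooth assms that) simp_all
  show "a * \<phi> v p + b * \<psi> v p = frame_change v v' p * (a * \<phi> v' p + b * \<psi> v' p)"
    if "v \<in> vertices" "v' \<in> vertices" "p \<in> V v" "p \<in> V v'" for v v' p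
    using sec_glue[OF assms(1) that] sec_glue[OF assms(2) that] by (simp add: algebra_simps)
qed (auto simp: sec_zero[OF assms(1)] sec_zero[OF assms(2)])

lemma sec_mult:
  assumes "\<phi> \<in> smooth_sections" "smooth_on U f" "open U" "P \<subseteq> U"
  shows "(\<lambda>v p. f (moment p) * \<phi> v p) \<in> smooth_sections"
proof (rule secI)
  fix v assume v: "v \<in> vertices"
  have "smooth_on (Omega v) (\<lambda>w. f (moment_at v w) * \<phi> v (chart_inv v w))"
  proof (intro smooth_intros smooth_compose[OF assms(2,3)] sec_smooth assms(1) v)
    show "moment_at v w \<in> U" if "w \<in> Omega v" for w
      using moment_at_P_at[OF v, of w] that subsetD[OF assms(4), of "moment_at v w"] by (simp add: P_at_eq[OF v])
  qed simp_all
  then show "smooth_on (Omega v) (\<lambda>w. f (moment (chart_inv v w)) * \<phi> v (chart_inv v w))"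
    by (rule smooth_on_cong[OF open_Omega]) (simp add: v)
next
  show "f (moment p) * \<phi> v p = frame_change v v' p * (f (moment p) * \<phi> v' p)"
    if "v \<in> vertices" "v' \<in> vertices" "p \<in> V v" "p \<in> V v'" for v v' p
    using sec_glue[OF assms(1) that] by simp
qed (auto simp: sec_zero[OF assms(1)])

lemma test_sections_X: "test_sections X = smooth_sections"
proof -
  have "compactin X_top (section_support \<phi>)" for \<phi>
    unfolding section_support_def by (rule closedin_compact_space[OF compact_space_X closedin_closure_of])
  moreover have "section_support \<phi> \<subseteq> X" for \<phi>
    unfolding section_support_def topspace_X[symmetric] by (rule closure_of_subset_topspace)
  ultimately show ?thesis by (auto simp: test_sections_def)
qed

subsection \<open>The twisted torus action on sections\<close>

lemma actv_chart:
  assumes "v \<in> vertices" "p \<in> V v"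
  shows "actv (chart v p) = A v *v (moment p - v)"
proof -
  have "A v *v moment_at v (chart v p) = actv (chart v p) + lam_vec v"
    using assms by (simp add: moment_at_def)
  then show ?thesis
    using assms by (simp add: moment_at_chart matrix_vector_mult_diff_distrib A_vertex)
qed

lemma chart_dir_actv:
  assumes "v \<in> vertices" "p \<in> V v"
  shows "chart_dir v s \<bullet> actv (chart v p) = (moment p - v) \<bullet> s"
  using A_chart_dir_inner[OF assms(1), of "moment p - v" s] by (simp add: actv_chart[OF assms] inner_commute)

text \<open>
  The twisted torus action on sections, evaluated in the frame at \<open>v\<close>.
\<close>

definition flow :: "real^'n \<Rightarrow> (real^'n \<Rightarrow> 'n toric_point \<Rightarrow> complex) \<Rightarrow> real^'n \<Rightarrow> 'n toric_point \<Rightarrow> real \<Rightarrow> complex" where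
  "flow s \<phi> v p t = cis (t * ((moment p - v) \<bullet> s)) * \<phi> v (torus_act (t *\<^sub>R s) p)"

lemma flow_eq:
  assumes "v \<in> vertices" "p \<in> V v"
  shows "flow s \<phi> v p t = cis (t * (chart_dir v s \<bullet> actv (chart v p))) * local_rep \<phi> v (rot (t *\<^sub>R chart_dir v s) (chart v p))"
proof -
  have "chart_inv v (rot (chart_dir v (t *\<^sub>R s)) (chart v p)) = torus_act (t *\<^sub>R s) p"
    using chart_inv_rot[OF assms(1) chart_Omega[OF assms], of "t *\<^sub>R s"] assms by simp
  then show ?thesis using assms by (simp add: flow_def chart_dir_actv matrix_vector_mult_scaleR)
qed

text \<open>
  The twist depends on the vertex in the way that compensates the rotation of the frame change, so
  that the torus action on sections does not depend on the frame.
\<close>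

lemma flow_glue:
  assumes "\<phi> \<in> smooth_sections" "v \<in> vertices" "v' \<in> vertices" "p \<in> V v" "p \<in> V v'"
  shows "flow s \<phi> v p t = frame_change v v' p * flow s \<phi> v' p t"
proof -
  have "\<phi> v (torus_act (t *\<^sub>R s) p) = cis ((v - v') \<bullet> (t *\<^sub>R s)) * frame_change v v' p * \<phi> v' (torus_act (t *\<^sub>R s) p)"
    using sec_glue[OF assms(1-3), of "torus_act (t *\<^sub>R s) p"] assms by (simp add: frame_change_torus_act)
  note e1 = this
  have e2: "cis (t * ((moment p - v) \<bullet> s)) * cis ((v - v') \<bullet> (t *\<^sub>R s)) = cis (t * ((moment p - v') \<bullet> s))"
    by (simp add: cis_mult inner_diff_left algebra_simps)
  show ?thesis unfolding flow_def e1 e2[symmetric] by (simp only: mult_ac)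
qed

definition inf_act :: "real^'n \<Rightarrow> (real^'n \<Rightarrow> 'n toric_point \<Rightarrow> complex) \<Rightarrow> real^'n \<Rightarrow> 'n toric_point \<Rightarrow> complex" where
  "inf_act s \<phi> v p = (if v \<in> vertices \<and> p \<in> V v then twist (chart_dir v s) (local_rep \<phi> v) (chart v p) else 0)"

definition int_act :: "real^'n \<Rightarrow> (real^'n \<Rightarrow> 'n toric_point \<Rightarrow> complex) \<Rightarrow> real^'n \<Rightarrow> 'n toric_point \<Rightarrow> complex" where
  "int_act s \<phi> v p = (if v \<in> vertices \<and> p \<in> V v then twist_int (chart_dir v s) (local_rep \<phi> v) (chart v p) else 0)"

text \<open>
  \<open>inf_act\<close> and \<open>int_act\<close> are the derivative and the period integral of the twisted torus action,
  hence they are compatible with the frame changes.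
\<close>

lemma inf_act_smooth:
  assumes "\<phi> \<in> smooth_sections" shows "inf_act s \<phi> \<in> smooth_sections"
proof (rule secI)
  fix v v' p assume v: "v \<in> vertices" "v' \<in> vertices" and p: "p \<in> V v" "p \<in> V v'"
  have d: "((\<lambda>t. flow s \<phi> v p t) has_vector_derivative inf_act s \<phi> v p) (at 0)" if "v \<in> vertices" "p \<in> V v" for v
    using flow_derivative_0[OF smooth_on_differentiable[OF sec_smooth[OF assms that(1)] chart_Omega[OF that]], of "chart_dir v s"] that
    by (simp add: flow_eq inf_act_def)
  have "((\<lambda>t. flow s \<phi> v p t) has_vector_derivative frame_change v v' p * inf_act s \<phi> v' p) (at 0)"
    using has_vector_derivative_mult_right[OF d[OF v(2) p(2)], of "frame_change v v' p"]
    by (simp add: flow_glue[OF assms v p])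
  then show "inf_act s \<phi> v p = frame_change v v' p * inf_act s \<phi> v' p"
    using d[OF v(1) p(1)] vector_derivative_unique_at by blast
next
  fix v assume v: "v \<in> vertices"
  show "smooth_on (Omega v) (local_rep (inf_act s \<phi>) v)"
    by (rule smooth_on_cong[OF open_Omega smooth_twist[OF open_Omega sec_smooth[OF assms v], of "chart_dir v s"]])
       (simp add: inf_act_def v)
qed (auto simp: inf_act_def)

lemma int_act_smooth:
  assumes "\<phi> \<in> smooth_sections" shows "int_act s \<phi> \<in> smooth_sections"
proof (rule secI)
  fix v v' p assume v: "v \<in> vertices" "v' \<in> vertices" and p: "p \<in> V v" "p \<in> V v'"
  have "int_act s \<phi> v p = integral {0..2*pi} (flow s \<phi> v p)" if "v \<in> vertices" "p \<in> V v" for v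
  proof -
    have "flow s \<phi> v p = (\<lambda>t. cis (t * (chart_dir v s \<bullet> actv (chart v p))) * local_rep \<phi> v (rot (t *\<^sub>R chart_dir v s) (chart v p)))"
      by (intro ext flow_eq that)
    then show ?thesis using that by (simp add: int_act_def twist_int_def)
  qed
  moreover have "flow s \<phi> v p = (\<lambda>t. frame_change v v' p * flow s \<phi> v' p t)"
    by (intro ext flow_glue assms v p)
  then have "integral {0..2*pi} (flow s \<phi> v p) = frame_change v v' p * integral {0..2*pi} (flow s \<phi> v' p)"
    by (simp add: integral_mult_right)
  ultimately show "int_act s \<phi> v p = frame_change v v' p * int_act s \<phi> v' p" using v p by simp
next
  fix v assume v: "v \<in> vertices"
  have "smooth_on (Omega v) (twist_int (chart_dir v s) (local_rep \<phi> v))"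
    by (rule smooth_twist_int[OF open_Omega sec_smooth[OF assms v]]) simp
  then show "smooth_on (Omega v) (local_rep (int_act s \<phi>) v)"
    by (rule smooth_on_cong[OF open_Omega]) (simp add: int_act_def v)
qed (auto simp: int_act_def)

text \<open>
  For an integral direction the time \<open>2 \<pi>\<close> rotation is the identity, and the holonomy is
  \<open>exp(2 \<pi> i (x - v) \<bullet> s) = exp(2 \<pi> i x \<bullet> s)\<close> as vertices are integral.
\<close>

lemma inf_act_int_act:
  assumes \<phi>: "\<phi> \<in> smooth_sections" and s: "s \<in> int_lattice"
  shows "inf_act s (int_act s \<phi>) = (\<lambda>v p. (cis (2 * pi * (moment p \<bullet> s)) - 1) * \<phi> v p)"
proof (intro ext)
  fix v p
  show "inf_act s (int_act s \<phi>) v p = (cis (2 * pi * (moment p \<bullet> s)) - 1) * \<phi> v p"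
  proof (cases "v \<in> vertices \<and> p \<in> V v")
    case False
    then show ?thesis using sec_zero[OF \<phi> False] by (auto simp: inf_act_def)
  next
    case True
    then have v: "v \<in> vertices" and p: "p \<in> V v" by auto
    let ?w = "chart v p"
    have rotO: "\<And>w r. w \<in> Omega v \<Longrightarrow> rot r w \<in> Omega v" by simp
    note sB = smooth_twist_int[OF open_Omega sec_smooth[OF \<phi> v] rotO, of "chart_dir v s"]
    have "inf_act s (int_act s \<phi>) v p = twist (chart_dir v s) (twist_int (chart_dir v s) (local_rep \<phi> v)) ?w"
    proof -
      have "twist (chart_dir v s) (local_rep (int_act s \<phi>) v) ?w = twist (chart_dir v s) (twist_int (chart_dir v s) (local_rep \<phi> v)) ?w"
        by (rule twist_cong[OF open_Omega chart_Omega[OF v p]])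
           (simp_all add: int_act_def v smooth_on_differentiable[OF sB] chart_Omega p)
      then show ?thesis by (simp add: inf_act_def v p)
    qed
    also have "\<dots> = cis (2 * pi * (chart_dir v s \<bullet> actv ?w)) * local_rep \<phi> v (rot ((2 * pi) *\<^sub>R chart_dir v s) ?w) - local_rep \<phi> v ?w"
      by (rule twist_twist_int[OF open_Omega sec_smooth[OF \<phi> v] rotO chart_Omega[OF v p]])
    also have "rot ((2 * pi) *\<^sub>R chart_dir v s) ?w = ?w"
      using chart_dir_lattice[OF v s] by (simp add: vec_eq_iff int_lattice_def cis_int)
    also have "cis (2 * pi * (chart_dir v s \<bullet> actv ?w)) = cis (2 * pi * (moment p \<bullet> s))"
    proof -
      have "v \<bullet> s \<in> \<int>" using int_lattice_inner[OF vertex_lattice[OF v] s] .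
      then have "cis (2 * pi * (v \<bullet> s)) = 1" by (rule cis_int)
      moreover have "cis (2 * pi * (moment p \<bullet> s)) = cis (2 * pi * ((moment p - v) \<bullet> s)) * cis (2 * pi * (v \<bullet> s))"
        by (simp add: cis_mult inner_diff_left algebra_simps)
      ultimately show ?thesis by (simp add: chart_dir_actv v p)
    qed
    finally show ?thesis using v p by (simp add: algebra_simps)
  qed
qed

subsection \<open>The generating vector fields\<close>

definition generator_field :: "real^'n \<Rightarrow> real^'n \<Rightarrow> 'n toric_point \<Rightarrow> (complex^'n) \<times> (complex^'n)" where
  "generator_field s v p = (rot_field (chart_dir v s) (chart v p), 0)"

lemma generator_field_polarized: "generator_field s \<in> polarized_fields X"
  unfolding polarized_fields_def mem_Collect_eq
proof (intro conjI ballI)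
  fix v assume v: "v \<in> vertices"
  have im: "chart v ` (X \<inter> V v) = Omega v" using chart_image_Int[OF v, of X] v by auto
  have "smooth_on (Omega v) (\<lambda>w. (rot_field (chart_dir v s) w, 0 :: complex^'n))" by (intro smooth_intros) simp_all
  then show "smooth_on (chart v ` (X \<inter> V v)) (\<lambda>w. generator_field s v (chart_inv v w))"
    unfolding im by (rule smooth_on_cong[OF open_Omega]) (simp add: generator_field_def v)
next
  fix v v' p assume v: "v \<in> vertices" "v' \<in> vertices" and "p \<in> X \<inter> V v \<inter> V v'"
  then have p: "p \<in> V v" "p \<in> V v'" by auto
  let ?\<psi> = "chart v' \<circ> chart_inv v" and ?w = "chart v p"
  have w: "?w \<in> overlap v v'" using v p by (simp add: overlap_def chart_Omega)
  have d: "?\<psi> differentiable (at ?w)"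
    using smooth_on_differentiable[OF smooth_transition[OF v] w] by (simp add: o_def)
  then have "((\<lambda>t. ?\<psi> (rot (t *\<^sub>R chart_dir v s) ?w)) has_vector_derivative frechet_derivative ?\<psi> (at ?w) (rot_field (chart_dir v s) ?w)) (at 0)"
    using chain_vector_derivative[OF rot_has_vector_derivative[of "chart_dir v s" ?w 0], of ?\<psi>] by simp
  moreover have "?\<psi> (rot (t *\<^sub>R chart_dir v s) ?w) = rot (t *\<^sub>R chart_dir v' s) (chart v' p)" for t
    using chart_inv_rot[OF v(1) chart_Omega[OF v(1) p(1)], of "t *\<^sub>R s"] v p chart_torus_act[OF v(2) p(2), of "t *\<^sub>R s"]
    by (simp add: matrix_vector_mult_scaleR)
  ultimately have "((\<lambda>t. rot (t *\<^sub>R chart_dir v' s) (chart v' p)) has_vector_derivative frechet_derivative ?\<psi> (at ?w) (rot_field (chart_dir v s) ?w)) (at 0)"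
    by simp
  moreover have "((\<lambda>t. rot (t *\<^sub>R chart_dir v' s) (chart v' p)) has_vector_derivative rot_field (chart_dir v' s) (chart v' p)) (at 0)"
    using rot_has_vector_derivative[of "chart_dir v' s" "chart v' p" 0] by simp
  ultimately have "rot_field (chart_dir v' s) (chart v' p) = frechet_derivative ?\<psi> (at ?w) (rot_field (chart_dir v s) ?w)"
    using vector_derivative_unique_at by blast
  moreover have "frechet_derivative ?\<psi> (at ?w) 0 = 0"
    using linear_frechet_derivative[OF d] linear_0 by blast
  ultimately show "generator_field s v' p = map_prod (frechet_derivative ?\<psi> (at ?w)) (frechet_derivative ?\<psi> (at ?w)) (generator_field s v p)"
    by (simp add: generator_field_def)
next
  fix v p assume v: "v \<in> vertices" and p: "p \<in> X \<inter> V v"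
  show "fst (generator_field s v p) \<in> orbit_tangent v (chart v p)"
    using p by (simp add: generator_field_def orbit_tangent_eq[OF v chart_Omega[OF v]])
  have "0 = rot_field 0 (chart v p)" by (simp add: rot_field_def vec_eq_iff)
  then show "snd (generator_field s v p) \<in> orbit_tangent v (chart v p)"
    using p by (auto simp: generator_field_def orbit_tangent_eq[OF v chart_Omega[OF v]])
qed

lemma transpose_nabla_generator_field:
  assumes "\<phi> \<in> smooth_sections"
  shows "transpose_nabla X (generator_field s) \<phi> = (\<lambda>v p. - inf_act s \<phi> v p)"
proof (intro ext)
  fix v p
  show "transpose_nabla X (generator_field s) \<phi> v p = - inf_act s \<phi> v p"
  proof (cases "v \<in> vertices \<and> p \<in> X \<inter> V v")
    case True
    then have v: "v \<in> vertices" and p: "p \<in> V v" by auto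
    let ?w = "chart v p"
    have w: "?w \<in> Omega v" by (rule chart_Omega[OF v p])
    have "divergence (\<lambda>w. fst (generator_field s v (chart_inv v w))) ?w = divergence (rot_field (chart_dir v s)) ?w"
    proof (rule divergence_cong[OF open_Omega w])
      fix b :: "complex^'n"
      have "smooth_on UNIV (\<lambda>z. rot_field (chart_dir v s) z \<bullet> b)" by (intro smooth_intros) simp_all
      then show "(\<lambda>z. rot_field (chart_dir v s) z \<bullet> b) differentiable (at ?w)" by (rule smooth_on_differentiable) simp
    qed (simp add: generator_field_def v)
    then have "cdivergence (\<lambda>w. generator_field s v (chart_inv v w)) ?w = 0"
      by (simp add: cdivergence_def divergence_rot_field generator_field_def[of s v "chart_inv v _"] divergence_zero)
    moreover have "dual_connection (generator_field s) \<phi> v p = inf_act s \<phi> v p"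
    proof -
      have "frechet_derivative (local_rep \<phi> v) (at ?w) 0 = 0"
        using linear_frechet_derivative[OF smooth_on_differentiable[OF sec_smooth[OF assms v] w]] linear_0 by blast
      then show ?thesis
        using v p by (simp add: dual_connection_def cderiv_def connection_form_def generator_field_def action_form_rot_field
            inf_act_def twist_def action_form_def[of _ 0])
    qed
    ultimately show ?thesis using True by (simp add: transpose_nabla_def)
  next
    case False
    then have "\<not> (v \<in> vertices \<and> p \<in> V v)" using V_X by auto
    then show ?thesis using False by (auto simp: transpose_nabla_def inf_act_def)
  qed
qed

lemma Q_real_lincomb:
  assumes "\<sigma> \<in> distributional_sections X" "\<phi> \<in> smooth_sections" "\<psi> \<in> smooth_sections"
  shows "\<sigma> (\<lambda>v p. a * \<phi> v p + b * \<psi> v p) = a * \<sigma> \<phi> + b * \<sigma> \<psi>"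
  using assms unfolding distributional_sections_def test_sections_X by blast

lemma Q_real_dist: "\<sigma> \<in> Q_real \<Longrightarrow> \<sigma> \<in> distributional_sections X"
  by (simp add: Q_real_def)

lemma openin_X: "openin X_top X"
  using openin_topspace[of X_top] by (simp add: topspace_X)

text \<open>
  Covariant constancy, tested with the global generators of the torus action.
\<close>

lemma Q_real_inf_act:
  assumes "\<sigma> \<in> Q_real" "\<phi> \<in> smooth_sections"
  shows "\<sigma> (inf_act s \<phi>) = 0"
proof -
  have "nabla_dist X (generator_field s) (restrict_dist X \<sigma>) = (\<lambda>_. 0)"
    using assms(1) openin_X generator_field_polarized unfolding Q_real_def by blast
  then have "nabla_dist X (generator_field s) (restrict_dist X \<sigma>) \<phi> = 0" by simp
  moreover have m: "(\<lambda>v p. - inf_act s \<phi> v p) \<in> smooth_sections"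
    using sec_lincomb[OF inf_act_smooth[OF assms(2)] assms(2), of "-1" s 0] by simp
  ultimately have "\<sigma> (\<lambda>v p. - inf_act s \<phi> v p) = 0"
    using assms(2) by (simp add: nabla_dist_def restrict_dist_def test_sections_X transpose_nabla_generator_field)
  moreover have "\<sigma> (\<lambda>v p. (-1) * inf_act s \<phi> v p + 0 * \<phi> v p) = (-1) * \<sigma> (inf_act s \<phi>) + 0 * \<sigma> \<phi>"
    by (rule Q_real_lincomb[OF Q_real_dist[OF assms(1)] inf_act_smooth[OF assms(2)] assms(2)])
  ultimately show ?thesis by simp
qed

subsection \<open>Sections supported in a chart\<close>

text \<open>
  Extension by zero of a function on a chart, read as a section over that chart.
\<close>

definition extend :: "real^'n \<Rightarrow> (complex^'n \<Rightarrow> complex) \<Rightarrow> real^'n \<Rightarrow> 'n toric_point \<Rightarrow> complex" where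
  "extend v g v' p = (if v' \<in> vertices \<and> p \<in> V v' \<and> p \<in> V v then frame_change v' v p * g (chart v p) else 0)"

lemma open_moment_at_Compl:
  assumes "compact K" shows "open {w \<in> Omega v. moment_at v w \<notin> K}"
proof -
  have "open (moment_at v -` (- K))"
    by (rule open_vimage) (use assms in \<open>auto intro!: continuous_intros simp: compact_imp_closed open_Compl\<close>)
  moreover have "{w \<in> Omega v. moment_at v w \<notin> K} = Omega v \<inter> moment_at v -` (- K)" by auto
  ultimately show ?thesis by (simp add: open_Int)
qed

lemma extend_zero:
  assumes v: "v \<in> vertices" and v': "v' \<in> vertices" and K: "\<And>w. g w \<noteq> 0 \<Longrightarrow> moment_at v w \<in> K"
    and w: "w \<in> Omega v'" "moment_at v' w \<notin> K"
  shows "local_rep (extend v g) v' w = 0"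
proof (cases "chart_inv v' w \<in> V v")
  case True
  then have "moment_at v (chart v (chart_inv v' w)) = moment_at v' w" using v v' w by (simp add: moment_at_chart)
  then have "g (chart v (chart_inv v' w)) = 0" using K w by metis
  then show ?thesis by (simp add: extend_def)
qed (simp add: extend_def)

text \<open>
  The support condition is imposed on the moment map. This makes the extension smooth near points
  outside the chart: they have a neighbourhood that is mapped into the complement of \<open>K\<close>.
\<close>

lemma extend_smooth:
  assumes v: "v \<in> vertices" and g: "smooth_on (Omega v) g"
    and K: "compact K" "K \<subseteq> P_at v" "\<And>w. g w \<noteq> 0 \<Longrightarrow> moment_at v w \<in> K"
  shows "extend v g \<in> smooth_sections"
proof (rule secI)
  fix v' v'' p assume "v' \<in> vertices" "v'' \<in> vertices" "p \<in> V v'" "p \<in> V v''"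
  then show "extend v g v' p = frame_change v' v'' p * extend v g v'' p"
    by (simp add: extend_def mult.assoc[symmetric] frame_change_trans)
next
  fix v' assume v': "v' \<in> vertices"
  show "smooth_on (Omega v') (local_rep (extend v g) v')"
  proof (rule smooth_on_zero_off[OF open_overlap[OF v' v] open_moment_at_Compl[OF K(1)]])
    show "overlap v' v \<union> {w \<in> Omega v'. moment_at v' w \<notin> K} = Omega v'"
    proof (intro equalityI subsetI)
      fix w assume w: "w \<in> Omega v'"
      show "w \<in> overlap v' v \<union> {w \<in> Omega v'. moment_at v' w \<notin> K}"
      proof (cases "moment_at v' w \<in> K")
        case True
        then have "chart_inv v' w \<in> V v" using K(2) v' w by (auto simp: V_def)
        then show ?thesis using w by (simp add: overlap_def)
      qed (use w in auto)
    qed (auto simp: overlap_def)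
    have "smooth_on (overlap v' v) (\<lambda>w. frame_change v' v (chart_inv v' w) * g (chart v (chart_inv v' w)))"
      by (intro smooth_intros smooth_frame_change smooth_compose[OF g] smooth_transition open_overlap v v')
         (auto simp: overlap_def chart_Omega v)
    then show "smooth_on (overlap v' v) (local_rep (extend v g) v')"
      by (rule smooth_on_cong[OF open_overlap[OF v' v]]) (simp add: extend_def v' overlap_def)
    show "local_rep (extend v g) v' w = 0" if "w \<in> {w \<in> Omega v'. moment_at v' w \<notin> K}" for w
      using extend_zero[OF v v' K(3)] that by simp
  qed
qed (auto simp: extend_def)

lemma extend_lincomb: "extend v (\<lambda>w. a * f w + b * g w) = (\<lambda>v' p. a * extend v f v' p + b * extend v g v' p)"
  by (intro ext) (simp add: extend_def algebra_simps)

lemma inf_act_extend: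
  assumes v: "v \<in> vertices" and g: "smooth_on (Omega v) g"
    and K: "compact K" "K \<subseteq> P_at v" "\<And>w. g w \<noteq> 0 \<Longrightarrow> moment_at v w \<in> K"
  shows "inf_act s (extend v g) = extend v (twist (chart_dir v s) g)"
proof (intro ext)
  fix v' p
  note sec = extend_smooth[OF v g K]
  show "inf_act s (extend v g) v' p = extend v (twist (chart_dir v s) g) v' p"
  proof (cases "v' \<in> vertices \<and> p \<in> V v'")
    case True
    then have v': "v' \<in> vertices" and p: "p \<in> V v'" by auto
    show ?thesis
    proof (cases "p \<in> V v")
      case pv: True
      have "inf_act s (extend v g) v' p = frame_change v' v p * inf_act s (extend v g) v p"
        by (rule sec_glue[OF inf_act_smooth[OF sec] v' v p pv])
      also have "inf_act s (extend v g) v p = twist (chart_dir v s) g (chart v p)"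
      proof -
        have "twist (chart_dir v s) (local_rep (extend v g) v) (chart v p) = twist (chart_dir v s) g (chart v p)"
          by (rule twist_cong[OF open_Omega chart_Omega[OF v pv]])
             (simp_all add: extend_def v smooth_on_differentiable[OF g chart_Omega[OF v pv]])
        then show ?thesis by (simp add: inf_act_def v pv)
      qed
      finally have "inf_act s (extend v g) v' p = frame_change v' v p * twist (chart_dir v s) g (chart v p)" .
      then show ?thesis by (simp add: extend_def[of v "twist (chart_dir v s) g" v' p] v' p pv)
    next
      case False
      have "chart v' p \<in> {w \<in> Omega v'. moment_at v' w \<notin> K}"
        using False v' p K(2) V_X[OF p] by (auto simp: chart_Omega moment_at_chart V_def)
      then have "twist (chart_dir v' s) (local_rep (extend v g) v') (chart v' p) = 0"
        by (rule twist_zero[OF open_moment_at_Compl[OF K(1)]]) (use extend_zero[OF v v' K(3)] in auto)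
      then show ?thesis using False by (simp add: inf_act_def extend_def[of v "twist (chart_dir v s) g" v' p])
    qed
  qed (auto simp: inf_act_def extend_def)
qed

end

section \<open>Every covariantly constant section is a combination of Bohr-Sommerfeld sections\<close>

definition bs_torus :: "('n \<Rightarrow> nat) \<Rightarrow> (complex^'n) set" where
  "bs_torus k = {w. \<forall>j. act j w = real (k j)}"

definition bs_point :: "('n \<Rightarrow> nat) \<Rightarrow> complex^'n" where
  "bs_point k = (\<chi> j. of_real (sqrt (2 * real (k j))))"

lemma bs_point_bs_torus: "bs_point k \<in> bs_torus k"
  by (simp add: bs_torus_def bs_point_def act_def)

lemma upd_bs_torus: "w \<in> bs_torus k \<Longrightarrow> upd j (of_real (sqrt (2 * real (k j))) * cis t) w \<in> bs_torus k"
  by (simp add: bs_torus_def act_upd norm_mult)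

text \<open>
  Iterated circle averages only involve values on the torus where the action coordinates are \<open>k\<close>.
\<close>

lemma torus_avg_cong:
  assumes "\<And>w. w \<in> bs_torus k \<Longrightarrow> f w = g w" "w \<in> bs_torus k"
  shows "torus_avg k js f w = torus_avg k js g w"
  using assms(2)
proof (induction js arbitrary: w)
  case (Cons j js)
  then show ?case by (simp add: circ_avg_def upd_bs_torus)
qed (simp add: assms(1))

definition coord_list :: "'n::finite list" where
  "coord_list = (SOME js. distinct js \<and> set js = UNIV)"

lemma coord_list:
  shows "distinct (coord_list :: 'n::finite list)" "set (coord_list :: 'n list) = UNIV"
proof -
  have "\<exists>js :: 'n list. distinct js \<and> set js = UNIV" using finite_distinct_list[OF finite] by blast
  then have "distinct (coord_list :: 'n list) \<and> set (coord_list :: 'n list) = UNIV" unfolding coord_list_def by (rule someI_ex)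
  then show "distinct (coord_list :: 'n list)" "set (coord_list :: 'n list) = UNIV" by auto
qed

context delzant_polytope
begin

definition chosen_vertex :: "real^'n \<Rightarrow> real^'n" where
  "chosen_vertex m = (SOME v. v \<in> vertices \<and> m \<in> P_at v)"

lemma chosen_vertex:
  assumes "m \<in> P" shows "chosen_vertex m \<in> vertices" "m \<in> P_at (chosen_vertex m)"
proof -
  have "\<exists>v. v \<in> vertices \<and> m \<in> P_at v" using ex_vertex[OF assms] by blast
  then have "chosen_vertex m \<in> vertices \<and> m \<in> P_at (chosen_vertex m)" unfolding chosen_vertex_def by (rule someI_ex)
  then show "chosen_vertex m \<in> vertices" "m \<in> P_at (chosen_vertex m)" by auto
qed

definition bs_idx :: "real^'n \<Rightarrow> 'n \<Rightarrow> nat" where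
  "bs_idx m j = nat \<lfloor>ell (ord (chosen_vertex m) j) m\<rfloor>"

lemma ell_int: "m \<in> int_lattice \<Longrightarrow> ell r m \<in> \<int>"
  unfolding ell_def by (intro Ints_diff int_lattice_inner) auto

lemma ord_d: "v \<in> vertices \<Longrightarrow> ord v j < d"
  using ord_active active_d by blast

lemma bs_idx:
  assumes "m \<in> P \<inter> int_lattice" shows "real (bs_idx m j) = ell (ord (chosen_vertex m) j) m"
proof -
  have "ell (ord (chosen_vertex m) j) m \<ge> 0" using assms chosen_vertex(1) ord_d P_ge by blast
  moreover have "ell (ord (chosen_vertex m) j) m \<in> \<int>" using assms ell_int by blast
  ultimately show ?thesis by (auto simp: bs_idx_def elim!: Ints_cases)
qed

lemma x_from_ell: "v \<in> vertices \<Longrightarrow> x = matrix_inv (A v) *v ((\<chi> j. ell (ord v j) x) + lam_vec v)"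
proof -
  assume v: "v \<in> vertices"
  have "(\<chi> j. ell (ord v j) x) + lam_vec v = A v *v x"
    by (simp add: vec_eq_iff ell_ord[symmetric])
  then show ?thesis using v by simp
qed

lemma moment_at_bs_torus:
  assumes "m \<in> P \<inter> int_lattice" "w \<in> bs_torus (bs_idx m)" shows "moment_at (chosen_vertex m) w = m"
proof -
  have "actv w = (\<chi> j. ell (ord (chosen_vertex m) j) m)"
    using assms by (simp add: bs_torus_def vec_eq_iff bs_idx)
  then show ?thesis using x_from_ell[of "chosen_vertex m" m] assms chosen_vertex(1) by (simp add: moment_at_def)
qed

lemma bs_torus_Omega:
  assumes "m \<in> P \<inter> int_lattice" shows "bs_torus (bs_idx m) \<subseteq> Omega (chosen_vertex m)"
  using assms moment_at_bs_torus[OF assms] chosen_vertex moment_at_P_at[of "chosen_vertex m"] by (metis IntD1 subsetI)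

text \<open>
  If the facet functions at \<open>chosen_vertex m\<close> are close to their values at \<open>m\<close>, the remaining facet
  functions stay positive, as they are at \<open>m\<close>.
\<close>

lemma ex_box:
  assumes m: "m \<in> P \<inter> int_lattice"
  shows "\<exists>e. 0 < e \<and> e < 1 \<and> (\<forall>x. (\<forall>j. \<bar>ell (ord (chosen_vertex m) j) x - real (bs_idx m j)\<bar> \<le> e) \<longrightarrow>
     (\<forall>r<d. r \<notin> active (chosen_vertex m) \<longrightarrow> ell r x > 0))"
proof -
  let ?v = "chosen_vertex m"
  have v: "?v \<in> vertices" using m chosen_vertex by blast
  define S where "S = {y. \<forall>r\<in>{..<d} - active ?v. ell r (matrix_inv (A ?v) *v (y + lam_vec ?v)) > 0}"
  define y0 where "y0 = (\<chi> j. real (bs_idx m j))"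
  have "open S"
    unfolding S_def
    by (rule open_ell_pos) (auto intro!: continuous_intros
        continuous_on_compose2[OF matrix_vector_mult_linear_continuous_on, of UNIV])
  moreover have "y0 \<in> S"
  proof -
    have "y0 = (\<chi> j. ell (ord ?v j) m)" by (simp add: y0_def bs_idx[OF m])
    then have "matrix_inv (A ?v) *v (y0 + lam_vec ?v) = m" using x_from_ell[OF v, of m] by simp
    moreover have "\<forall>r<d. r \<notin> active ?v \<longrightarrow> 0 < ell r m"
      using active_subset_iff[of "active ?v" m] chosen_vertex(2)[of m] m P_ge by (auto simp: P_at_eq[OF v])
    ultimately show ?thesis by (simp add: S_def)
  qed
  ultimately obtain e0 where e0: "e0 > 0" "cball y0 e0 \<subseteq> S" using open_contains_cball by blast
  \<comment> \<open>Below 1, so that no other lattice point is near; the second bound turns coordinatewise into norm estimates.\<close>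
  define e where "e = min (1/2) (e0 / real CARD('n))"
  have e: "0 < e" "e < 1" "real CARD('n) * e \<le> e0"
  proof -
    show "0 < e" "e < 1" using e0 by (auto simp: e_def)
    have "real CARD('n) * e \<le> real CARD('n) * (e0 / real CARD('n))"
      by (intro mult_left_mono) (auto simp: e_def)
    then show "real CARD('n) * e \<le> e0" by simp
  qed
  have "ell r x > 0" if x: "\<And>j. \<bar>ell (ord ?v j) x - real (bs_idx m j)\<bar> \<le> e" and r: "r < d" "r \<notin> active ?v" for x r
  proof -
    let ?y = "\<chi> j. ell (ord ?v j) x"
    have "norm (?y - y0) \<le> (\<Sum>j\<in>UNIV. norm ((?y - y0) $ j))" by (simp add: norm_vec_def L2_set_le_sum)
    also have "\<dots> \<le> (\<Sum>j\<in>(UNIV::'n set). e)" by (intro sum_mono) (simp add: y0_def x)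
    finally have "norm (?y - y0) \<le> e0" using e(3) by simp
    then have "?y \<in> S" using e0(2) by (auto simp: dist_norm norm_minus_commute)
    then show ?thesis using r x_from_ell[OF v, of x] by (simp add: S_def)
  qed
  then show ?thesis using e by blast
qed

definition bs_rad :: "real^'n \<Rightarrow> real" where
  "bs_rad m = (SOME e. 0 < e \<and> e < 1 \<and> (\<forall>x. (\<forall>j. \<bar>ell (ord (chosen_vertex m) j) x - real (bs_idx m j)\<bar> \<le> e) \<longrightarrow>
     (\<forall>r<d. r \<notin> active (chosen_vertex m) \<longrightarrow> ell r x > 0)))"

lemma bs_rad:
  assumes m: "m \<in> P \<inter> int_lattice"
  shows "0 < bs_rad m" "bs_rad m < 1"
    and "\<And>x r. (\<And>j. \<bar>ell (ord (chosen_vertex m) j) x - real (bs_idx m j)\<bar> \<le> bs_rad m) \<Longrightarrow> r < d \<Longrightarrow> r \<notin> active (chosen_vertex m) \<Longrightarrow> ell r x > 0"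
proof -
  have "0 < bs_rad m \<and> bs_rad m < 1 \<and> (\<forall>x. (\<forall>j. \<bar>ell (ord (chosen_vertex m) j) x - real (bs_idx m j)\<bar> \<le> bs_rad m) \<longrightarrow>
     (\<forall>r<d. r \<notin> active (chosen_vertex m) \<longrightarrow> ell r x > 0))"
    unfolding bs_rad_def by (rule someI_ex[OF ex_box[OF m]])
  then show "0 < bs_rad m" "bs_rad m < 1"
    "\<And>x r. (\<And>j. \<bar>ell (ord (chosen_vertex m) j) x - real (bs_idx m j)\<bar> \<le> bs_rad m) \<Longrightarrow> r < d \<Longrightarrow> r \<notin> active (chosen_vertex m) \<Longrightarrow> ell r x > 0"
    by blast+
qed

definition box_at :: "real^'n \<Rightarrow> (complex^'n) set" where
  "box_at m = {w. \<forall>j. \<bar>act j w - real (bs_idx m j)\<bar> \<le> bs_rad m}"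

lemma closed_box: "closed (box_at m)"
proof -
  have "box_at m = (\<Inter>j. {w. \<bar>act j w - real (bs_idx m j)\<bar> \<le> bs_rad m})" by (auto simp: box_at_def)
  moreover have "closed (\<Inter>j. {w. \<bar>act j w - real (bs_idx m j)\<bar> \<le> bs_rad m})"
    by (intro closed_INT ballI closed_Collect_le continuous_intros)
  ultimately show ?thesis by simp
qed

lemma compact_box: "compact (box_at m)"
proof -
  have "bounded (box_at m)"
    by (rule bounded_act[of _ "\<lambda>j. real (bs_idx m j) + bs_rad m"]) (auto simp: box_at_def abs_le_iff algebra_simps)
  then show ?thesis using closed_box compact_eq_bounded_closed by blast
qed

lemma box_Omega: "m \<in> P \<inter> int_lattice \<Longrightarrow> box_at m \<subseteq> Omega (chosen_vertex m)"
  using bs_rad(3)[of m] chosen_vertex(1)[of m] by (auto simp: box_at_def Omega_def ell_moment_at)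

lemma near_support:
  assumes m: "m \<in> P \<inter> int_lattice" and g: "g \<in> near (bs_idx m) (bs_rad m)"
  shows "smooth_on (Omega (chosen_vertex m)) g" "compact (moment_at (chosen_vertex m) ` box_at m)" "moment_at (chosen_vertex m) ` box_at m \<subseteq> P_at (chosen_vertex m)"
    "\<And>w. g w \<noteq> 0 \<Longrightarrow> moment_at (chosen_vertex m) w \<in> moment_at (chosen_vertex m) ` box_at m"
proof -
  show "smooth_on (Omega (chosen_vertex m)) g" by (rule smooth_on_subset[OF nearD[OF g]]) simp
  show "compact (moment_at (chosen_vertex m) ` box_at m)"
    by (rule compact_continuous_image[OF _ compact_box]) (intro continuous_intros)
  show "moment_at (chosen_vertex m) ` box_at m \<subseteq> P_at (chosen_vertex m)"
    using box_Omega[OF m] moment_at_P_at chosen_vertex(1) m by blast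
  show "moment_at (chosen_vertex m) w \<in> moment_at (chosen_vertex m) ` box_at m" if "g w \<noteq> 0" for w
    using g that by (auto simp: near_def box_at_def)
qed

definition bump :: "real^'n \<Rightarrow> real^'n \<Rightarrow> real" where
  "bump m x = (\<Prod>j\<in>UNIV. cutoff ((ell (ord (chosen_vertex m) j) x - real (bs_idx m j))\<^sup>2 / (bs_rad m)\<^sup>2))"

lemma smooth_bump: "m \<in> P \<inter> int_lattice \<Longrightarrow> smooth_on UNIV (bump m)"
  unfolding bump_def[abs_def] divide_inverse by (intro smooth_intros) simp_all

lemma smooth_bump_comp: "m \<in> P \<inter> int_lattice \<Longrightarrow> open S \<Longrightarrow> smooth_on S f \<Longrightarrow> smooth_on S (\<lambda>x. bump m (f x))"
  by (rule smooth_compose[OF smooth_bump]) auto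

lemma bump_zero:
  assumes "m \<in> P \<inter> int_lattice" "\<bar>ell (ord (chosen_vertex m) j) x - real (bs_idx m j)\<bar> > bs_rad m"
  shows "bump m x = 0"
proof -
  have "(bs_rad m)\<^sup>2 \<le> (ell (ord (chosen_vertex m) j) x - real (bs_idx m j))\<^sup>2"
    using assms bs_rad(1)[OF assms(1)] power_mono[of "bs_rad m" "\<bar>ell (ord (chosen_vertex m) j) x - real (bs_idx m j)\<bar>" 2] by simp
  then have "cutoff ((ell (ord (chosen_vertex m) j) x - real (bs_idx m j))\<^sup>2 / (bs_rad m)\<^sup>2) = 0"
    using bs_rad(1)[OF assms(1)] by (intro cutoff_zero) simp
  then show ?thesis unfolding bump_def by (intro prod_zero) auto
qed

lemma bump_P_at:
  assumes m: "m \<in> P \<inter> int_lattice" and x: "x \<in> P" "bump m x \<noteq> 0"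
  shows "x \<in> P_at (chosen_vertex m)"
proof -
  have "\<bar>ell (ord (chosen_vertex m) j) x - real (bs_idx m j)\<bar> \<le> bs_rad m" for j
    using bump_zero[OF m, of j x] x(2) by linarith
  then have "\<forall>r<d. r \<notin> active (chosen_vertex m) \<longrightarrow> ell r x > 0" using bs_rad(3)[OF m] by blast
  then show ?thesis
    using active_subset_iff[of "active (chosen_vertex m)" x] P_ge[OF x(1)] chosen_vertex(1)[of m] m by (simp add: P_at_eq)
qed

definition bump_one :: "real^'n \<Rightarrow> (real^'n) set" where
  "bump_one m = {x. \<forall>j. (ell (ord (chosen_vertex m) j) x - real (bs_idx m j))\<^sup>2 / (bs_rad m)\<^sup>2 < 1/2}"

lemma open_bump_one: "open (bump_one m)"
proof -
  have "bump_one m = (\<Inter>j. {x. (ell (ord (chosen_vertex m) j) x - real (bs_idx m j))\<^sup>2 / (bs_rad m)\<^sup>2 < 1/2})"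
    by (auto simp: bump_one_def)
  moreover have "open (\<Inter>j. {x. (ell (ord (chosen_vertex m) j) x - real (bs_idx m j))\<^sup>2 / (bs_rad m)\<^sup>2 < 1/2})"
    unfolding divide_inverse
    by (rule open_INT) (auto intro!: open_Collect_less continuous_intros)
  ultimately show ?thesis by simp
qed

lemma bump_one: "x \<in> bump_one m \<Longrightarrow> bump m x = 1"
  by (simp add: bump_one_def bump_def cutoff_one less_imp_le)

lemma bump_one_self: "m \<in> P \<inter> int_lattice \<Longrightarrow> m \<in> bump_one m"
  by (simp add: bump_one_def bs_idx)

definition bump_off :: "real^'n \<Rightarrow> (real^'n) set" where
  "bump_off m = {x. \<exists>j. \<bar>ell (ord (chosen_vertex m) j) x - real (bs_idx m j)\<bar> > bs_rad m}"

lemma open_bump_off: "open (bump_off m)"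
proof -
  have "bump_off m = (\<Union>j. {x. \<bar>ell (ord (chosen_vertex m) j) x - real (bs_idx m j)\<bar> > bs_rad m})"
    by (auto simp: bump_off_def)
  moreover have "open (\<Union>j. {x. \<bar>ell (ord (chosen_vertex m) j) x - real (bs_idx m j)\<bar> > bs_rad m})"
    by (intro open_UN ballI open_Collect_less continuous_intros)
  ultimately show ?thesis by simp
qed

lemma bump_off_other:
  assumes m: "m \<in> P \<inter> int_lattice" and m': "m' \<in> P \<inter> int_lattice" and ne: "m \<noteq> m'"
  shows "m \<in> bump_off m'"
proof -
  let ?v = "chosen_vertex m'"
  have v: "?v \<in> vertices" using m' chosen_vertex by blast
  have "\<exists>j. ell (ord ?v j) m \<noteq> ell (ord ?v j) m'"
  proof (rule ccontr)
    assume "\<not> ?thesis"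
    then have "(\<chi> j. ell (ord ?v j) m) = (\<chi> j. ell (ord ?v j) m')" by simp
    then show False using x_from_ell[OF v, of m] x_from_ell[OF v, of m'] ne by simp
  qed
  then obtain j where "ell (ord ?v j) m \<noteq> real (bs_idx m' j)" using bs_idx[OF m'] by auto
  moreover have "ell (ord ?v j) m - real (bs_idx m' j) \<in> \<int>" using m ell_int by auto
  ultimately have "\<bar>ell (ord ?v j) m - real (bs_idx m' j)\<bar> \<ge> 1"
    using Ints_nonzero_abs_ge1[of "ell (ord ?v j) m - real (bs_idx m' j)"] by simp
  then have "\<bar>ell (ord ?v j) m - real (bs_idx m' j)\<bar> > bs_rad m'" using bs_rad(2)[OF m'] by linarith
  then show ?thesis unfolding bump_off_def by blast
qed

text \<open>
  Near a lattice point a section lives in a single chart.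
\<close>

lemma bump_localize:
  assumes m: "m \<in> P \<inter> int_lattice" and \<phi>: "\<phi> \<in> smooth_sections"
  obtains g where "g \<in> near (bs_idx m) (bs_rad m)" "(\<lambda>v p. of_real (bump m (moment p)) * \<phi> v p) = extend (chosen_vertex m) g"
    "\<And>w. w \<in> bs_torus (bs_idx m) \<Longrightarrow> g w = local_rep \<phi> (chosen_vertex m) w"
proof
  let ?v = "chosen_vertex m"
  have v: "?v \<in> vertices" using m chosen_vertex by blast
  define g where "g w = (if w \<in> Omega ?v then of_real (bump m (moment_at ?v w)) * local_rep \<phi> ?v w else 0)" for w
  have far: "g w = 0" if "\<bar>act j w - real (bs_idx m j)\<bar> > bs_rad m" for w j
    using bump_zero[OF m, of j "moment_at ?v w"] that v by (simp add: g_def ell_moment_at)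
  show "g \<in> near (bs_idx m) (bs_rad m)"
  proof (rule nearI[OF _ far])
    show "smooth_on UNIV g"
    proof (rule smooth_on_zero_off[OF open_Omega])
      show "open (- box_at m)" using closed_box by (simp add: open_Compl)
      show "Omega ?v \<union> - box_at m = UNIV" using box_Omega[OF m] by blast
      have "smooth_on (Omega ?v) (\<lambda>w. of_real (bump m (moment_at ?v w)) * local_rep \<phi> ?v w)"
        by (intro smooth_intros smooth_bump_comp m sec_smooth \<phi> v) simp_all
      then show "smooth_on (Omega ?v) g" by (rule smooth_on_cong[OF open_Omega]) (simp add: g_def)
      show "g w = 0" if "w \<in> - box_at m" for w
        using that far[of _ w] by (auto simp: box_at_def not_le)
    qed
  qed
  show "(\<lambda>v p. of_real (bump m (moment p)) * \<phi> v p) = extend ?v g"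
  proof (intro ext)
    fix v' p
    consider "\<not> (v' \<in> vertices \<and> p \<in> V v')" | "v' \<in> vertices" "p \<in> V v'" "p \<in> V ?v" | "p \<in> V v'" "p \<notin> V ?v"
      by blast
    then show "of_real (bump m (moment p)) * \<phi> v' p = extend ?v g v' p"
    proof cases
      case 1
      then show ?thesis using sec_zero[OF \<phi> 1] by (auto simp: extend_def)
    next
      case 2
      then show ?thesis
        using sec_glue[OF \<phi> 2(1) v 2(2,3)] v by (simp add: extend_def g_def chart_Omega moment_at_chart)
    next
      case 3
      then have "bump m (moment p) = 0"
        using bump_P_at[OF m moment_P[OF V_X[OF 3(1)]]] V_X[OF 3(1)] by (auto simp: V_def)
      then show ?thesis using 3 by (simp add: extend_def)
    qed
  qed
  fix w assume w: "w \<in> bs_torus (bs_idx m)"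
  then show "g w = local_rep \<phi> ?v w"
    using bs_torus_Omega[OF m] moment_at_bs_torus[OF m w] bump_one[OF bump_one_self[OF m]] by (auto simp: g_def)
qed

text \<open>
  The average of the section over the fiber of \<open>m\<close> against the parallel section of the bundle. In
  the frame at a vertex the parallel section is \<open>exp(i k \<bullet> \<theta>)\<close>, where \<open>k = bs_idx m\<close> are the values of
  the facet functions at \<open>m\<close>; this is the weight built into \<open>circ_avg\<close>.
\<close>

definition bs_section :: "real^'n \<Rightarrow> (real^'n \<Rightarrow> 'n toric_point \<Rightarrow> complex) \<Rightarrow> complex" where
  "bs_section m \<phi> = (if \<phi> \<in> smooth_sections then torus_avg (bs_idx m) coord_list (local_rep \<phi> (chosen_vertex m)) (bs_point (bs_idx m)) else 0)"

definition coefficient :: "((real^'n \<Rightarrow> 'n toric_point \<Rightarrow> complex) \<Rightarrow> complex) \<Rightarrow> real^'n \<Rightarrow> complex" where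
  "coefficient \<sigma> m = \<sigma> (extend (chosen_vertex m) (\<lambda>w. \<Prod>j\<in>UNIV. profile (bs_rad m) (bs_idx m j) (w $ j)))"

lemma sigma_near_lattice_point:
  assumes \<sigma>: "\<sigma> \<in> Q_real" and m: "m \<in> P \<inter> int_lattice" and \<phi>: "\<phi> \<in> smooth_sections"
  shows "\<sigma> (\<lambda>v p. of_real (bump m (moment p)) * \<phi> v p) = bs_section m \<phi> * coefficient \<sigma> m"
proof -
  let ?v = "chosen_vertex m"
  have v: "?v \<in> vertices" using m chosen_vertex by blast
  obtain g where g: "g \<in> near (bs_idx m) (bs_rad m)"
    and eq: "(\<lambda>v p. of_real (bump m (moment p)) * \<phi> v p) = extend ?v g"
    and gt: "\<And>w. w \<in> bs_torus (bs_idx m) \<Longrightarrow> g w = local_rep \<phi> ?v w"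
    using bump_localize[OF m \<phi>] by blast
  have sec: "extend ?v f \<in> smooth_sections" if "f \<in> near (bs_idx m) (bs_rad m)" for f
    by (rule extend_smooth[OF v near_support[OF m that]])
  have "\<sigma> (extend ?v g) = torus_avg (bs_idx m) coord_list g (bs_point (bs_idx m)) * coefficient \<sigma> m"
    unfolding coefficient_def
  proof (rule local_reduction[where \<tau> = "\<lambda>g. \<sigma> (extend ?v g)" and k = "bs_idx m" and e = "bs_rad m"])
    show "\<sigma> (extend ?v (\<lambda>w. a * f w + b * h w)) = a * \<sigma> (extend ?v f) + b * \<sigma> (extend ?v h)"
      if "f \<in> near (bs_idx m) (bs_rad m)" "h \<in> near (bs_idx m) (bs_rad m)" for f h a b
      unfolding extend_lincomb by (rule Q_real_lincomb[OF Q_real_dist[OF \<sigma>] sec[OF that(1)] sec[OF that(2)]])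
    show "\<sigma> (extend ?v (twist (axis j 1) \<psi>)) = 0" if \<psi>: "\<psi> \<in> near (bs_idx m) (bs_rad m)" for \<psi> j
    proof -
      have "extend ?v (twist (axis j 1) \<psi>) = inf_act (T ?v *v axis j 1) (extend ?v \<psi>)"
        by (subst inf_act_extend[OF v near_support[OF m \<psi>]]) (simp_all add: v)
      then show ?thesis using Q_real_inf_act[OF \<sigma> sec[OF \<psi>]] by simp
    qed
  qed (use g bs_rad[OF m] coord_list in auto)
  moreover have "torus_avg (bs_idx m) coord_list g (bs_point (bs_idx m)) = torus_avg (bs_idx m) coord_list (local_rep \<phi> ?v) (bs_point (bs_idx m))"
    by (rule torus_avg_cong[OF gt bs_point_bs_torus])
  ultimately show ?thesis by (simp add: eq bs_section_def \<phi>)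
qed

lemma zero_section: "(\<lambda>v p. 0) \<in> smooth_sections"
  by (rule secI) (auto intro: smooth_const)

lemma sum_sections:
  assumes "\<sigma> \<in> distributional_sections X" "finite I" "\<And>i. i \<in> I \<Longrightarrow> \<Phi> i \<in> smooth_sections"
  shows "(\<lambda>v p. \<Sum>i\<in>I. \<Phi> i v p) \<in> smooth_sections \<and> \<sigma> (\<lambda>v p. \<Sum>i\<in>I. \<Phi> i v p) = (\<Sum>i\<in>I. \<sigma> (\<Phi> i))"
  using assms(2,3)
proof (induction I)
  case empty
  then show ?case
    using zero_section Q_real_lincomb[OF assms(1) zero_section zero_section, of 0 0] by simp
next
  case (insert i I)
  then show ?case
    using sec_lincomb[of "\<Phi> i" "\<lambda>v p. \<Sum>i\<in>I. \<Phi> i v p" 1 1]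
      Q_real_lincomb[OF assms(1), of "\<Phi> i" "\<lambda>v p. \<Sum>i\<in>I. \<Phi> i v p" 1 1] by simp
qed

lemma finite_lattice_points: "finite (P \<inter> int_lattice)"
proof -
  obtain B where B: "\<And>x. x \<in> P \<Longrightarrow> norm x \<le> B"
    using compact_imp_bounded[OF compact_P] by (auto simp: bounded_iff)
  have "P \<inter> int_lattice \<subseteq> (\<lambda>f. \<chi> i. real_of_int (f i)) ` (UNIV \<rightarrow>\<^sub>E {- \<lceil>B\<rceil>..\<lceil>B\<rceil>})"
  proof
    fix x assume x: "x \<in> P \<inter> int_lattice"
    then obtain z where z: "x = real_vec z" by (auto simp: int_lattice_iff)
    have "\<bar>x $ i\<bar> \<le> B" for i using B[of x] x component_le_norm_cart[of x i] by auto
    then have "z $ i \<in> {- \<lceil>B\<rceil>..\<lceil>B\<rceil>}" for i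
      using z le_of_int_ceiling[of B] by (simp add: abs_le_iff) (smt (verit, best) le_ceiling_iff of_int_less_iff ceiling_less_iff minus_le_iff of_int_minus)
    then show "x \<in> (\<lambda>f. \<chi> i. real_of_int (f i)) ` (UNIV \<rightarrow>\<^sub>E {- \<lceil>B\<rceil>..\<lceil>B\<rceil>})"
      using z by (intro image_eqI[of _ _ "\<lambda>i. z $ i"]) (auto simp: vec_eq_iff)
  qed
  then show ?thesis by (rule finite_subset) (intro finite_imageI finite_PiE, auto)
qed

definition away :: "real^'n \<Rightarrow> real" where
  "away x = 1 - (\<Sum>m\<in>P \<inter> int_lattice. bump m x)"

text \<open>
  The functions that multiply sections in \<open>inf_act_int_act\<close>; their common zeros are the lattice
  points.
\<close>

definition period :: "'n \<Rightarrow> real^'n \<Rightarrow> complex" where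
  "period i x = cis (2 * pi * (x $ i)) - 1"

definition period_sum :: "real^'n \<Rightarrow> real" where
  "period_sum x = (\<Sum>i\<in>UNIV. (cmod (period i x))\<^sup>2)"

lemma smooth_period [smooth_intros]: "open S \<Longrightarrow> smooth_on S (period i)"
  unfolding period_def[abs_def] by (intro smooth_intros)

lemma smooth_period_sum [smooth_intros]: "open S \<Longrightarrow> smooth_on S period_sum"
  unfolding period_sum_def[abs_def] by (intro smooth_intros)

lemma period_sum_zero: "period_sum x = 0 \<Longrightarrow> x \<in> int_lattice"
proof -
  assume "period_sum x = 0"
  then have "period i x = 0" for i
    by (simp add: period_sum_def sum_nonneg_eq_0_iff)
  then have "cos (2 * pi * (x $ i)) = 1" for i
    by (metis period_def right_minus_eq cis.sel(1) one_complex.sel(1))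
  then have "\<exists>n::int. 2 * pi * (x $ i) = of_int n * 2 * pi" for i
    by (simp add: cos_one_2pi_int)
  then have "x $ i \<in> \<int>" for i
    by (metis Ints_of_int mult.commute mult_cancel_left pi_neq_zero mult.assoc zero_neq_numeral)
  then show ?thesis by (simp add: int_lattice_def)
qed

text \<open>
  A section that vanishes near the lattice points is a combination of the functions \<open>period i\<close>
  with smooth coefficients, obtained by dividing by the sum of their squares; each summand is an
  infinitesimal torus action applied to a section.
\<close>

lemma sigma_away_from_lattice:
  assumes \<sigma>: "\<sigma> \<in> Q_real" and \<phi>: "\<phi> \<in> smooth_sections"
  shows "(\<lambda>v p. of_real (away (moment p)) * \<phi> v p) \<in> smooth_sections"
    and "\<sigma> (\<lambda>v p. of_real (away (moment p)) * \<phi> v p) = 0"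
proof -
  let ?M = "P \<inter> int_lattice"
  define N where "N m = bump_one m \<inter> (\<Inter>m'\<in>?M - {m}. bump_off m')" for m
  have oN: "open (N m)" for m
    unfolding N_def using finite_lattice_points by (intro open_Int open_INT open_bump_one ballI open_bump_off) auto
  have mN: "m \<in> N m" if "m \<in> ?M" for m
    using bump_one_self[OF that] bump_off_other[OF that] by (auto simp: N_def)
  have rN: "away x = 0" if m: "m \<in> ?M" and x: "x \<in> N m" for m x
  proof -
    have "(\<Sum>m'\<in>?M. bump m' x) = (\<Sum>m'\<in>?M. if m' = m then 1 else 0)"
    proof (rule sum.cong[OF refl])
      fix m' assume m': "m' \<in> ?M"
      show "bump m' x = (if m' = m then 1 else 0)"
      proof (cases "m' = m")
        case True
        then show ?thesis using x by (simp add: N_def bump_one)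
      next
        case False
        then have "x \<in> bump_off m'" using x m' by (simp add: N_def)
        then obtain j where "\<bar>ell (ord (chosen_vertex m') j) x - real (bs_idx m' j)\<bar> > bs_rad m'" by (auto simp: bump_off_def)
        then show ?thesis using bump_zero[OF m'] False by simp
      qed
    qed
    then show ?thesis using m finite_lattice_points by (simp add: away_def)
  qed
  define U where "U = {x. period_sum x \<noteq> 0} \<union> (\<Union>m\<in>?M. N m)"
  have oS: "open {x. period_sum x \<noteq> 0}"
    by (intro open_Collect_neq continuous_intros smooth_on_continuous_on smooth_intros open_UNIV)
  have oU: "open U" unfolding U_def by (intro open_Un oS open_UN ballI oN)
  have PU: "P \<subseteq> U" using period_sum_zero mN by (auto simp: U_def)
  define u where "u i x = of_real (away x / period_sum x) * cnj (period i x)" for i x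
  have srest: "smooth_on S away" if "open S" for S
    unfolding away_def[abs_def] by (intro smooth_intros that smooth_on_subset[OF smooth_bump]) auto
  have su: "smooth_on U (u i)" for i
  proof (rule smooth_on_zero_off[OF oS])
    show "open (\<Union>m\<in>?M. N m)" by (intro open_UN ballI oN)
    show "smooth_on {x. period_sum x \<noteq> 0} (u i)"
      unfolding u_def[abs_def] by (intro smooth_intros srest oS) simp
    show "u i x = 0" if "x \<in> (\<Union>m\<in>?M. N m)" for x
      using that rN by (auto simp: u_def)
  qed (simp add: U_def)
  define \<Phi> where "\<Phi> i = (\<lambda>v p. u i (moment p) * \<phi> v p)" for i
  have \<Phi>: "\<Phi> i \<in> smooth_sections" for i unfolding \<Phi>_def by (rule sec_mult[OF \<phi> su oU PU])
  have DB: "inf_act (axis i 1) (int_act (axis i 1) (\<Phi> i)) = (\<lambda>v p. period i (moment p) * \<Phi> i v p)" for i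
  proof -
    have "axis i 1 \<in> int_lattice" by (auto simp: int_lattice_def axis_def)
    from inf_act_int_act[OF \<Phi> this] show ?thesis by (simp add: period_def inner_axis)
  qed
  have DS: "inf_act (axis i 1) (int_act (axis i 1) (\<Phi> i)) \<in> smooth_sections" for i
    by (intro inf_act_smooth int_act_smooth \<Phi>)
  have eq: "(\<lambda>v p. of_real (away (moment p)) * \<phi> v p)
      = (\<lambda>v p. \<Sum>i\<in>UNIV. inf_act (axis i 1) (int_act (axis i 1) (\<Phi> i)) v p)"
  proof (intro ext)
    fix v p
    show "of_real (away (moment p)) * \<phi> v p = (\<Sum>i\<in>UNIV. inf_act (axis i 1) (int_act (axis i 1) (\<Phi> i)) v p)"
    proof (cases "p \<in> X")
      case False
      then have "\<phi> v p = 0" using sec_zero[OF \<phi>, of v p] V_X by blast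
      then show ?thesis unfolding DB by (simp add: \<Phi>_def)
    next
      case True
      let ?x = "moment p"
      have "(\<Sum>i\<in>UNIV. inf_act (axis i 1) (int_act (axis i 1) (\<Phi> i)) v p)
          = of_real (away ?x / period_sum ?x) * (\<Sum>i\<in>UNIV. period i ?x * cnj (period i ?x)) * \<phi> v p"
        unfolding DB by (simp add: \<Phi>_def u_def sum_distrib_left sum_distrib_right sum_divide_distrib mult_ac)
      also have "(\<Sum>i\<in>UNIV. period i ?x * cnj (period i ?x)) = of_real (period_sum ?x)"
        by (simp add: period_sum_def complex_norm_square[symmetric] del: of_real_power)
      also have "of_real (away ?x / period_sum ?x) * of_real (period_sum ?x) = (of_real (away ?x) :: complex)"
      proof (cases "period_sum ?x = 0")
        case True
        then have "?x \<in> ?M" using period_sum_zero moment_P[OF \<open>p \<in> X\<close>] by blast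
        then have "away ?x = 0" using rN mN by blast
        then show ?thesis by simp
      qed simp
      finally show ?thesis by simp
    qed
  qed
  have "(\<lambda>v p. \<Sum>i\<in>UNIV. inf_act (axis i 1) (int_act (axis i 1) (\<Phi> i)) v p) \<in> smooth_sections \<and>
      \<sigma> (\<lambda>v p. \<Sum>i\<in>UNIV. inf_act (axis i 1) (int_act (axis i 1) (\<Phi> i)) v p)
      = (\<Sum>i\<in>UNIV. \<sigma> (inf_act (axis i 1) (int_act (axis i 1) (\<Phi> i))))"
    by (rule sum_sections[OF Q_real_dist[OF \<sigma>] finite DS])
  moreover have "\<sigma> (inf_act (axis i 1) (int_act (axis i 1) (\<Phi> i))) = 0" for i
    by (rule Q_real_inf_act[OF \<sigma> int_act_smooth[OF \<Phi>]])
  ultimately show "(\<lambda>v p. of_real (away (moment p)) * \<phi> v p) \<in> smooth_sections"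
    "\<sigma> (\<lambda>v p. of_real (away (moment p)) * \<phi> v p) = 0"
    unfolding eq by simp_all
qed

text \<open>
  Cut a section into pieces near the lattice points and a remainder away from them.
\<close>

theorem Q_real_expansion:
  assumes \<sigma>: "\<sigma> \<in> Q_real"
  shows "\<sigma> = (\<lambda>\<phi>. \<Sum>m\<in>P \<inter> int_lattice. coefficient \<sigma> m * bs_section m \<phi>)"
proof
  fix \<phi>
  let ?M = "P \<inter> int_lattice"
  show "\<sigma> \<phi> = (\<Sum>m\<in>?M. coefficient \<sigma> m * bs_section m \<phi>)"
  proof (cases "\<phi> \<in> smooth_sections")
    case False
    then show ?thesis
      using Q_real_dist[OF \<sigma>] by (simp add: distributional_sections_def test_sections_X bs_section_def)
  next
    case \<phi>: True
    define \<Phi> where "\<Phi> m = (\<lambda>v p. of_real (bump m (moment p)) * \<phi> v p)" for m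
    have \<Phi>: "\<Phi> m \<in> smooth_sections" if "m \<in> ?M" for m
      unfolding \<Phi>_def by (rule sec_mult[OF \<phi>, of UNIV]) (auto intro!: smooth_intros smooth_bump_comp that)
    have S: "(\<lambda>v p. \<Sum>m\<in>?M. \<Phi> m v p) \<in> smooth_sections \<and> \<sigma> (\<lambda>v p. \<Sum>m\<in>?M. \<Phi> m v p) = (\<Sum>m\<in>?M. \<sigma> (\<Phi> m))"
      by (rule sum_sections[OF Q_real_dist[OF \<sigma>] finite_lattice_points \<Phi>])
    let ?R = "\<lambda>v p. of_real (away (moment p)) * \<phi> v p"
    have "\<phi> = (\<lambda>v p. 1 * ?R v p + 1 * (\<Sum>m\<in>?M. \<Phi> m v p))"
      by (intro ext) (simp add: away_def \<Phi>_def sum_distrib_right left_diff_distrib)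
    then have "\<sigma> \<phi> = \<sigma> (\<lambda>v p. 1 * ?R v p + 1 * (\<Sum>m\<in>?M. \<Phi> m v p))" by (rule arg_cong)
    also have "\<dots> = 1 * \<sigma> ?R + 1 * \<sigma> (\<lambda>v p. \<Sum>m\<in>?M. \<Phi> m v p)"
      by (rule Q_real_lincomb[OF Q_real_dist[OF \<sigma>] sigma_away_from_lattice(1)[OF \<sigma> \<phi>]]) (simp add: S)
    also have "\<dots> = (\<Sum>m\<in>?M. \<sigma> (\<Phi> m))" using S sigma_away_from_lattice(2)[OF \<sigma> \<phi>] by simp
    also have "\<dots> = (\<Sum>m\<in>?M. coefficient \<sigma> m * bs_section m \<phi>)"
      unfolding \<Phi>_def
      by (intro sum.cong refl, subst sigma_near_lattice_point[OF \<sigma> _ \<phi>]) simp_all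
    finally show ?thesis .
  qed
qed

end

section \<open>Integration over Bohr-Sommerfeld tori\<close>

lemma upd_continuous:
  "continuous_on S f \<Longrightarrow> continuous_on S g \<Longrightarrow> continuous_on S (\<lambda>x. upd j (f x) (g x))"
  unfolding upd_eq
  by (intro continuous_intros bounded_linear.continuous_on[OF bounded_linear_axis]) auto

lemma ring_continuous:
  assumes "continuous_on (bs_torus k) f" "continuous_on S c" "continuous_on S w" "\<And>x. x \<in> S \<Longrightarrow> w x \<in> bs_torus k"
  shows "continuous_on S (\<lambda>x. f (upd j (of_real (sqrt (2 * real (k j))) * cis (c x)) (w x)))"
  by (rule continuous_on_compose2[OF assms(1)])
     (auto intro!: upd_continuous continuous_intros assms upd_bs_torus)

lemma circ_avg_continuous:
  assumes "continuous_on (bs_torus k) f"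
  shows "continuous_on (bs_torus k) (circ_avg (k j) j f)"
proof -
  have "continuous_on (bs_torus k \<times> cbox 0 (2*pi))
      (\<lambda>(w, t). cis (real (k j) * t) * f (upd j (of_real (sqrt (2 * real (k j))) * cis t) w))"
    unfolding split_beta
    by (intro continuous_intros ring_continuous[OF assms]) auto
  from integral_continuous_on_param[OF this] show ?thesis
    unfolding circ_avg_def[abs_def] by (intro continuous_intros) simp
qed

lemma torus_avg_continuous: "continuous_on (bs_torus k) f \<Longrightarrow> continuous_on (bs_torus k) (torus_avg k js f)"
  by (induction js) (simp_all add: circ_avg_continuous)

lemma circ_avg_integrable:
  assumes "continuous_on (bs_torus k) f" "w \<in> bs_torus k"
  shows "(\<lambda>t. cis (real (k j) * t) * f (upd j (of_real (sqrt (2 * real (k j))) * cis t) w)) integrable_on {0..2*pi}"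
  by (intro integrable_continuous_real continuous_intros ring_continuous[OF assms(1)]) (use assms in auto)

lemma circ_avg_lincomb:
  assumes "continuous_on (bs_torus k) f" "continuous_on (bs_torus k) g" "w \<in> bs_torus k"
  shows "circ_avg (k j) j (\<lambda>w. a * f w + b * g w) w = a * circ_avg (k j) j f w + b * circ_avg (k j) j g w"
proof -
  let ?I = "\<lambda>f t. cis (real (k j) * t) * f (upd j (of_real (sqrt (2 * real (k j))) * cis t) w)"
  have "integral {0..2*pi} (?I (\<lambda>w. a * f w + b * g w)) = integral {0..2*pi} (\<lambda>t. a * ?I f t + b * ?I g t)"
    by (simp add: algebra_simps)
  also have "\<dots> = a * integral {0..2*pi} (?I f) + b * integral {0..2*pi} (?I g)"
    by (subst integral_add) (auto intro!: integrable_on_mult_right circ_avg_integrable assms)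
  finally show ?thesis by (simp add: circ_avg_def field_simps)
qed

lemma torus_avg_lincomb:
  assumes "continuous_on (bs_torus k) f" "continuous_on (bs_torus k) g" "w \<in> bs_torus k"
  shows "torus_avg k js (\<lambda>w. a * f w + b * g w) w = a * torus_avg k js f w + b * torus_avg k js g w"
  using assms(3)
proof (induction js arbitrary: w)
  case (Cons j js)
  have "circ_avg (k j) j (torus_avg k js (\<lambda>w. a * f w + b * g w)) w = circ_avg (k j) j (\<lambda>w. a * torus_avg k js f w + b * torus_avg k js g w) w"
    unfolding circ_avg_def by (simp add: Cons upd_bs_torus)
  also have "\<dots> = a * circ_avg (k j) j (torus_avg k js f) w + b * circ_avg (k j) j (torus_avg k js g) w"
    by (rule circ_avg_lincomb) (intro torus_avg_continuous assms Cons.prems)+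
  finally show ?case by simp
qed simp

lemma torus_avg_zero: "torus_avg k js (\<lambda>_. 0) w = 0"
  by (induction js arbitrary: w) (simp_all add: circ_avg_def)

lemma torus_avg_sum:
  assumes "finite I" "\<And>i. i \<in> I \<Longrightarrow> continuous_on (bs_torus k) (f i)" "w \<in> bs_torus k"
  shows "torus_avg k js (\<lambda>w. \<Sum>i\<in>I. f i w) w = (\<Sum>i\<in>I. torus_avg k js (f i) w)"
  using assms(1,2)
proof (induction I)
  case (insert i I)
  have "continuous_on (bs_torus k) (\<lambda>w. \<Sum>i\<in>I. f i w)" by (intro continuous_intros insert.prems) simp
  then show ?case
    using torus_avg_lincomb[of k "f i" "\<lambda>w. \<Sum>i\<in>I. f i w" w js 1 1] insert assms(3) by simp
qed (simp add: torus_avg_zero)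

lemma torus_avg_bound:
  assumes "continuous_on (bs_torus k) f" "\<And>w. w \<in> bs_torus k \<Longrightarrow> norm (f w) \<le> B" "w \<in> bs_torus k"
  shows "norm (torus_avg k js f w) \<le> B"
  using assms(3)
proof (induction js arbitrary: w)
  case (Cons j js)
  have "norm (integral {0..2*pi} (\<lambda>t. cis (real (k j) * t) * torus_avg k js f (upd j (of_real (sqrt (2 * real (k j))) * cis t) w)))
     \<le> B * (2 * pi - 0)"
    by (rule integral_bound)
       (auto intro!: continuous_intros ring_continuous[OF torus_avg_continuous[OF assms(1)]] Cons upd_bs_torus simp: norm_mult)
  then show ?case by (simp add: circ_avg_def norm_mult norm_divide field_simps)
qed (simp add: assms)

lemma circ_avg_swap:
  assumes "continuous_on (bs_torus k) f" "w \<in> bs_torus k"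
  shows "circ_avg (k i) i (circ_avg (k j) j f) w = circ_avg (k j) j (circ_avg (k i) i f) w"
proof (cases "i = j")
  case False
  let ?u = "\<lambda>j t w. upd j (of_real (sqrt (2 * real (k j))) * cis t) w"
  let ?F = "\<lambda>s t. cis (real (k i) * s) * (cis (real (k j) * t) * f (?u j t (?u i s w)))"
  have uu: "?u j t (?u i s w) = ?u i s (?u j t w)" for s t using False by (simp add: vec_eq_iff)
  have "continuous_on (cbox (0, 0) (2*pi, 2*pi)) (\<lambda>(s, t). ?F s t)"
    unfolding split_beta
    by (intro continuous_intros ring_continuous[OF assms(1)] upd_continuous) (auto intro: upd_bs_torus assms(2))
  from integral_swap_continuous[OF this]
  have sw: "integral {0..2*pi} (\<lambda>s. integral {0..2*pi} (\<lambda>t. ?F s t))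
     = integral {0..2*pi} (\<lambda>t. integral {0..2*pi} (\<lambda>s. ?F s t))" by simp
  have "circ_avg (k i) i (circ_avg (k j) j f) w = (1 / (2*pi)) * ((1 / (2*pi)) * integral {0..2*pi} (\<lambda>s. integral {0..2*pi} (\<lambda>t. ?F s t)))"
    unfolding circ_avg_def by (simp only: mult.left_commute[of "cis _" "complex_of_real _"] integral_mult_right)
  also have "\<dots> = (1 / (2*pi)) * ((1 / (2*pi)) * integral {0..2*pi} (\<lambda>t. integral {0..2*pi} (\<lambda>s.
      cis (real (k j) * t) * (cis (real (k i) * s) * f (?u i s (?u j t w))))))"
    by (subst sw) (simp only: uu mult.left_commute)
  also have "\<dots> = circ_avg (k j) j (circ_avg (k i) i f) w"
    unfolding circ_avg_def by (simp only: mult.left_commute[of "cis _" "complex_of_real _"] integral_mult_right)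
  finally show ?thesis .
qed simp

lemma torus_avg_commute:
  assumes "continuous_on (bs_torus k) f" "w \<in> bs_torus k"
  shows "circ_avg (k j) j (torus_avg k js f) w = torus_avg k js (circ_avg (k j) j f) w"
  using assms(2)
proof (induction js arbitrary: w)
  case (Cons i js)
  have "circ_avg (k j) j (circ_avg (k i) i (torus_avg k js f)) w = circ_avg (k i) i (circ_avg (k j) j (torus_avg k js f)) w"
    by (rule circ_avg_swap[OF torus_avg_continuous[OF assms(1)] Cons.prems])
  also have "\<dots> = circ_avg (k i) i (torus_avg k js (circ_avg (k j) j f)) w"
    unfolding circ_avg_def[of "k i"] by (simp add: Cons upd_bs_torus)
  finally show ?case by simp
qed simp

text \<open>
  The circle averages commute by Fubini, so the one that vanishes may be carried out first.
\<close>

lemma torus_avg_vanish: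
  assumes "continuous_on (bs_torus k) f" "\<And>w. w \<in> bs_torus k \<Longrightarrow> circ_avg (k j) j f w = 0" "j \<in> set js" "w \<in> bs_torus k"
  shows "torus_avg k js f w = 0"
  using assms(3,4)
proof (induction js arbitrary: w)
  case (Cons i js)
  show ?case
  proof (cases "i = j")
    case True
    have "torus_avg k (i # js) f w = torus_avg k js (circ_avg (k j) j f) w"
      using torus_avg_commute[OF assms(1) Cons.prems(2)] True by simp
    also have "\<dots> = torus_avg k js (\<lambda>_. 0) w" by (rule torus_avg_cong[OF assms(2) Cons.prems(2)])
    finally show ?thesis by (simp add: torus_avg_zero)
  next
    case False
    then show ?thesis using Cons by (simp add: circ_avg_def upd_bs_torus)
  qed
qed simp

lemma compact_bs_torus: "compact (bs_torus k)"
proof -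
  have "bs_torus k = (\<Inter>j. {w. act j w = real (k j)})" by (auto simp: bs_torus_def)
  moreover have "closed (\<Inter>j. {w. act j w = real (k j)})"
    by (intro closed_INT ballI closed_Collect_eq continuous_intros)
  moreover have "bounded (bs_torus k)"
    by (rule bounded_act[of _ "\<lambda>j. real (k j)"]) (simp add: bs_torus_def)
  ultimately show ?thesis by (simp add: compact_eq_bounded_closed)
qed

subsection \<open>The circle average of a divergence\<close>

text \<open>
  \<open>(y1, y2)\<close> are the components of a field in the \<open>j\<close>-th plane, with complex coefficients, tangent to
  the circles around the origin. On the circle of radius \<open>\<rho> > 0\<close> the field is \<open>q / \<rho>\<^sup>2\<close> times the
  generator of rotations, where \<open>q = x y2 - y y1\<close>, and its divergence is the angular derivative of
  \<open>q / \<rho>\<^sup>2\<close>. Together with the connection term, the average becomes the integral of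
  \<open>(d/dt) (exp(i k t) q / \<rho>\<^sup>2)\<close>. At the origin, tangency makes \<open>y1\<close> vanish on the real axis and \<open>y2\<close>
  on the imaginary axis, so that both terms of the divergence are zero.
\<close>

lemma circle_average_zero:
  fixes y1 y2 :: "complex^'n \<Rightarrow> complex"
  assumes S: "open S" and T: "bs_torus k \<subseteq> S" and s1: "smooth_on S y1" and s2: "smooth_on S y2"
    and tan: "\<And>w. w \<in> S \<Longrightarrow> Re (w $ j) *\<^sub>R y1 w + Im (w $ j) *\<^sub>R y2 w = 0"
    and fix0: "\<And>w. w \<in> S \<Longrightarrow> w $ j = 0 \<Longrightarrow> y1 w = 0 \<and> y2 w = 0"
    and w: "w \<in> bs_torus k"
  defines "n \<equiv> \<lambda>w. partial_deriv (axis j 1) y1 w + partial_deriv (axis j \<i>) y2 w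
      + \<i> / 2 * (Re (w $ j) *\<^sub>R y2 w - Im (w $ j) *\<^sub>R y1 w)"
  shows "circ_avg (k j) j n w = 0"
proof (cases "k j = 0")
  case True
  define z where "z = upd j 0 w"
  have z: "z \<in> bs_torus k" using upd_bs_torus[OF w, of j 0] by (simp add: z_def True)
  then have zS: "z \<in> S" using T by blast
  have part0: "partial_deriv (axis j c) y z = 0"
    if sy: "smooth_on S y" and v: "\<And>r. upd j (r *\<^sub>R c) z \<in> S \<Longrightarrow> y (upd j (r *\<^sub>R c) z) = 0" for y :: "complex^'n \<Rightarrow> complex" and c
  proof -
    have u0: "upd j (0 *\<^sub>R c) z = z" by (simp add: z_def vec_eq_iff)
    have "((\<lambda>r. r *\<^sub>R c) has_vector_derivative c) (at (0::real))"
      by (auto intro!: derivative_eq_intros simp: has_vector_derivative_def)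
    from chain_vector_derivative[OF upd_has_vector_derivative[OF this, of j z], of y]
    have 1: "((\<lambda>r. y (upd j (r *\<^sub>R c) z)) has_vector_derivative partial_deriv (axis j c) y z) (at 0)"
      using smooth_on_differentiable[OF sy zS] by (simp add: u0[simplified] partial_deriv_def)
    let ?R = "(\<lambda>r. upd j (r *\<^sub>R c) z) -` S"
    have "open ?R" by (rule open_vimage[OF S]) (intro upd_continuous continuous_intros)
    moreover have "0 \<in> ?R" using zS u0 by simp
    ultimately have "((\<lambda>r. 0) has_vector_derivative partial_deriv (axis j c) y z) (at 0)"
      by (rule has_vector_derivative_transform_within_open[OF 1]) (use v in auto)
    then show ?thesis using has_vector_derivative_const vector_derivative_unique_at by blast
  qed
  have "partial_deriv (axis j 1) y1 z = 0"
  proof (rule part0[OF s1])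
    fix r assume "upd j (r *\<^sub>R 1) z \<in> S"
    then show "y1 (upd j (r *\<^sub>R 1) z) = 0" using tan[of "upd j (r *\<^sub>R 1) z"] fix0[of "upd j (r *\<^sub>R 1) z"]
      by (cases "r = 0") auto
  qed
  moreover have "partial_deriv (axis j \<i>) y2 z = 0"
  proof (rule part0[OF s2])
    fix r assume "upd j (r *\<^sub>R \<i>) z \<in> S"
    then show "y2 (upd j (r *\<^sub>R \<i>) z) = 0" using tan[of "upd j (r *\<^sub>R \<i>) z"] fix0[of "upd j (r *\<^sub>R \<i>) z"]
      by (cases "r = 0") auto
  qed
  ultimately have "n z = 0" by (simp add: n_def z_def)
  then show ?thesis by (simp add: circ_avg_def True z_def)
next
  case False
  define \<rho> where "\<rho> = sqrt (2 * real (k j))"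
  have \<rho>2: "\<rho>\<^sup>2 = 2 * real (k j)" by (simp add: \<rho>_def)
  define c where "c t = upd j (of_real \<rho> * cis t) w" for t
  have cT: "c t \<in> bs_torus k" for t using upd_bs_torus[OF w, of j t] by (simp add: c_def \<rho>_def)
  then have cS: "c t \<in> S" for t using T by blast
  define q where "q w = Re (w $ j) *\<^sub>R y2 w - Im (w $ j) *\<^sub>R y1 w" for w
  define p where "p w = Re (w $ j) *\<^sub>R y1 w + Im (w $ j) *\<^sub>R y2 w" for w
  have sq: "smooth_on S q" and sp: "smooth_on S p"
    unfolding q_def[abs_def] p_def[abs_def] by (intro smooth_intros S s1 s2)+
  have sR: "smooth_on S (\<lambda>w. Re (w $ j) *\<^sub>R y w)" "smooth_on S (\<lambda>w. Im (w $ j) *\<^sub>R y w)"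
    if "smooth_on S y" for y :: "complex^'n \<Rightarrow> complex"
    by (intro smooth_intros that S)+
  note d = smooth_on_differentiable
  have dq: "((\<lambda>t. q (c t)) has_vector_derivative of_real (\<rho>\<^sup>2) *
     (partial_deriv (axis j 1) y1 (c t) + partial_deriv (axis j \<i>) y2 (c t))) (at t)" for t
  proof -
    let ?z = "c t"
    let ?x = "complex_of_real (Re (?z $ j))" and ?y = "complex_of_real (Im (?z $ j))"
    let ?a = "partial_deriv (axis j 1) y1 ?z" and ?b = "partial_deriv (axis j \<i>) y1 ?z"
    let ?e = "partial_deriv (axis j 1) y2 ?z" and ?f = "partial_deriv (axis j \<i>) y2 ?z"
    note zS = cS[of t]
    have "((\<lambda>t. of_real \<rho> * cis t) has_vector_derivative \<i> * (of_real \<rho> * cis t)) (at t)"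
      unfolding has_vector_derivative_def
      by (auto intro!: derivative_eq_intros simp: scaleR_conv_of_real)
    from chain_vector_derivative[OF upd_has_vector_derivative[OF this, of j w], of q]
    have 1: "((\<lambda>t. q (c t)) has_vector_derivative frechet_derivative q (at ?z) (axis j (\<i> * (of_real \<rho> * cis t)))) (at t)"
      using d[OF sq zS] by (simp add: c_def)
    have zj: "\<i> * (of_real \<rho> * cis t) = \<i> * (?z $ j)" by (simp add: c_def)
    have 2: "frechet_derivative q (at ?z) (axis j (\<i> * (of_real \<rho> * cis t)))
      = ?x * partial_deriv (axis j \<i>) q ?z - ?y * partial_deriv (axis j 1) q ?z"
      unfolding zj by (simp add: frechet_axis[OF d[OF sq zS]] scaleR_conv_of_real)
    have q1: "partial_deriv (axis j 1) q ?z = y2 ?z + ?x * ?e - ?y * ?a"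
      unfolding q_def[abs_def]
      by (simp add: partial_diff partial_Re_scaleR partial_Im_scaleR d[OF s1 zS] d[OF s2 zS]
          d[OF sR(1)[OF s2] zS] d[OF sR(2)[OF s1] zS]) (simp add: scaleR_conv_of_real)
    have q2: "partial_deriv (axis j \<i>) q ?z = ?x * ?f - (y1 ?z + ?y * ?b)"
      unfolding q_def[abs_def]
      by (simp add: partial_diff partial_Re_scaleR partial_Im_scaleR d[OF s1 zS] d[OF s2 zS]
          d[OF sR(1)[OF s2] zS] d[OF sR(2)[OF s1] zS]) (simp add: scaleR_conv_of_real)
    \<comment> \<open>The derivatives of the tangency condition eliminate the terms that are not in the divergence.\<close>
    have p0: "partial_deriv b p ?z = 0" for b
      by (rule partial_deriv_zero[OF S zS]) (simp add: p_def tan)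
    have p1: "y1 ?z + ?x * ?a + ?y * ?e = 0"
      using p0[of "axis j 1"] unfolding p_def[abs_def]
      by (simp add: partial_add partial_Re_scaleR partial_Im_scaleR d[OF s1 zS] d[OF s2 zS]
          d[OF sR(1)[OF s1] zS] d[OF sR(2)[OF s2] zS]) (simp add: scaleR_conv_of_real)
    have p2: "?x * ?b + (y2 ?z + ?y * ?f) = 0"
      using p0[of "axis j \<i>"] unfolding p_def[abs_def]
      by (simp add: partial_add partial_Re_scaleR partial_Im_scaleR d[OF s1 zS] d[OF s2 zS]
          d[OF sR(1)[OF s1] zS] d[OF sR(2)[OF s2] zS]) (simp add: scaleR_conv_of_real)
    have "cmod (?z $ j) = \<rho>" by (simp add: c_def norm_mult \<rho>_def)
    then have "(Re (?z $ j))\<^sup>2 + (Im (?z $ j))\<^sup>2 = \<rho>\<^sup>2" by (metis cmod_power2)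
    then have r: "?x * ?x + ?y * ?y = of_real (\<rho>\<^sup>2)"
      by (metis of_real_add of_real_mult power2_eq_square)
    have y1: "y1 ?z = - (?x * ?a) - ?y * ?e" using p1 by (simp add: algebra_simps eq_neg_iff_add_eq_0)
    have y2: "y2 ?z = - (?x * ?b) - ?y * ?f" using p2 by (simp add: algebra_simps eq_neg_iff_add_eq_0)
    have "?x * (?x * ?f - (y1 ?z + ?y * ?b)) - ?y * (y2 ?z + ?x * ?e - ?y * ?a) = (?x * ?x + ?y * ?y) * (?a + ?f)"
      unfolding y1 y2 by (simp add: algebra_simps)
    then show ?thesis using 1 unfolding 2 q1 q2 r by simp
  qed
  define G where "G t = cis (real (k j) * t) * q (c t) / (2 * real (k j))" for t
  have "(G has_vector_derivative cis (real (k j) * t) * n (c t)) (at t)" for t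
  proof -
    have "((\<lambda>t. cis (real (k j) * t)) has_vector_derivative \<i> * real (k j) * cis (real (k j) * t)) (at t)"
      unfolding has_vector_derivative_def
      by (auto intro!: derivative_eq_intros simp: scaleR_conv_of_real)
    from has_vector_derivative_divide[OF has_vector_derivative_mult[OF this dq[of t]], of "of_real (2 * real (k j))"]
    show ?thesis
      unfolding G_def[abs_def] \<rho>2 using False
      by (rule_tac has_vector_derivative_eq_rhs) (auto simp: n_def q_def field_simps)
  qed
  then have "((\<lambda>t. cis (real (k j) * t) * n (c t)) has_integral G (2*pi) - G 0) {0..2*pi}"
    by (intro fundamental_theorem_of_calculus) (auto intro: has_vector_derivative_at_within)
  moreover have "G (2*pi) = G 0"
  proof -
    have "cis (real (k j) * (2 * pi)) = cis (real (k j) * 0)"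
      using cis_multiple_2pi[of "real (k j)"] by (simp add: mult.commute)
    moreover have "c (2 * pi) = c 0" by (simp only: c_def cis_2pi cis_zero)
    ultimately show ?thesis by (simp only: G_def)
  qed
  ultimately show ?thesis by (simp add: circ_avg_def c_def[symmetric] \<rho>_def[symmetric] integral_unique)
qed

subsection \<open>Means of nonnegative functions\<close>

definition circ_mean :: "nat \<Rightarrow> 'n \<Rightarrow> (complex^'n \<Rightarrow> real) \<Rightarrow> complex^'n \<Rightarrow> real" where
  "circ_mean k j g w = (1 / (2 * pi)) * integral {0..2*pi} (\<lambda>t. g (upd j (of_real (sqrt (2 * real k)) * cis t) w))"

text \<open>
  The conjugate of the parallel section \<open>exp(i k \<bullet> \<theta>)\<close> in the \<open>j\<close>-th coordinate, extended smoothly off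
  the torus. For \<open>k j = 0\<close> it is \<open>1\<close>, the value of \<open>0 ^ 0\<close>.
\<close>

definition weight :: "('n \<Rightarrow> nat) \<Rightarrow> 'n \<Rightarrow> complex^'n \<Rightarrow> complex" where
  "weight k j w = (cnj (w $ j) * of_real (inverse (sqrt (2 * real (k j))))) ^ k j"

lemma circ_mean_continuous:
  assumes "continuous_on (bs_torus k) B"
  shows "continuous_on (bs_torus k) (circ_mean (k j) j B)"
proof -
  have "continuous_on (bs_torus k \<times> cbox 0 (2*pi)) (\<lambda>(w, t). B (upd j (of_real (sqrt (2 * real (k j))) * cis t) w))"
    unfolding split_beta by (intro continuous_intros ring_continuous[OF assms]) auto
  from integral_continuous_on_param[OF this] show ?thesis
    unfolding circ_mean_def[abs_def] by (intro continuous_intros) simp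
qed

lemma circ_mean_nonneg:
  assumes "\<And>w. w \<in> bs_torus k \<Longrightarrow> B w \<ge> 0" "w \<in> bs_torus k"
  shows "circ_mean (k j) j B w \<ge> 0"
proof -
  have "integral {0..2*pi} (\<lambda>t. B (upd j (of_real (sqrt (2 * real (k j))) * cis t) w)) \<ge> 0"
  proof (cases "(\<lambda>t. B (upd j (of_real (sqrt (2 * real (k j))) * cis t) w)) integrable_on {0..2*pi}")
    case True
    then show ?thesis by (rule integral_nonneg) (simp add: assms upd_bs_torus)
  qed (simp add: not_integrable_integral)
  then show ?thesis by (simp add: circ_mean_def)
qed

lemma circ_mean_pos:
  assumes B: "continuous_on (bs_torus k) B" "\<And>w. w \<in> bs_torus k \<Longrightarrow> B w \<ge> 0"
    and w: "w \<in> bs_torus k" and w0: "w0 \<in> bs_torus k" "B (upd j (w0 $ j) w) > 0"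
  shows "circ_mean (k j) j B w > 0"
proof -
  let ?f = "\<lambda>t. B (upd j (of_real (sqrt (2 * real (k j))) * cis t) w)"
  have cf: "continuous_on {0..2*pi} ?f"
    by (intro ring_continuous[OF B(1)] continuous_intros) (simp add: w)
  have "(cmod (w0 $ j))\<^sup>2 = 2 * real (k j)" using w0(1) by (simp add: bs_torus_def act_def field_simps)
  then have \<rho>: "cmod (w0 $ j) = sqrt (2 * real (k j))" by (metis norm_ge_zero real_sqrt_abs abs_of_nonneg)
  define t0 where "t0 = Arg2pi (w0 $ j)"
  have t0: "0 \<le> t0" "t0 \<le> 2 * pi" "w0 $ j = of_real (sqrt (2 * real (k j))) * cis t0"
    using Arg2pi[of "w0 $ j"] by (auto simp: t0_def \<rho>[symmetric] cis_conv_exp is_Arg_def)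
  have "integral {0..2*pi} ?f \<noteq> 0"
  proof
    assume "integral {0..2*pi} ?f = 0"
    moreover have "integral {0..2*pi} ?f = 0 \<longleftrightarrow> (\<forall>t\<in>{0..2*pi}. ?f t = 0)"
      by (rule integral_eq_0_iff[OF cf]) (simp_all add: B(2) upd_bs_torus w)
    ultimately have "?f t0 = 0" using t0 by simp
    then show False using w0(2) t0(3) by simp
  qed
  moreover have "circ_mean (k j) j B w \<ge> 0" by (rule circ_mean_nonneg[OF B(2) w])
  ultimately show ?thesis by (simp add: circ_mean_def less_le)
qed

fun torus_mean :: "('n \<Rightarrow> nat) \<Rightarrow> 'n list \<Rightarrow> (complex^'n \<Rightarrow> real) \<Rightarrow> complex^'n \<Rightarrow> real" where
  "torus_mean k [] g = g"
| "torus_mean k (j # js) g = circ_mean (k j) j (torus_mean k js g)"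

text \<open>
  Each circle through a torus point that agrees with \<open>w0\<close> in the coordinates still to be averaged
  meets a point where the function averaged so far is positive.
\<close>

lemma torus_mean_props:
  assumes B: "continuous_on (bs_torus k) B" "\<And>w. w \<in> bs_torus k \<Longrightarrow> B w \<ge> 0"
    and w0: "w0 \<in> bs_torus k" "B w0 > 0"
  shows "continuous_on (bs_torus k) (torus_mean k js B) \<and> (\<forall>w\<in>bs_torus k. torus_mean k js B w \<ge> 0)
    \<and> (\<forall>w\<in>bs_torus k. (\<forall>i. i \<notin> set js \<longrightarrow> w $ i = w0 $ i) \<longrightarrow> torus_mean k js B w > 0)"
proof (induction js)
  case Nil
  have "w = w0" if "\<forall>i. w $ i = w0 $ i" for w using that by (simp add: vec_eq_iff)
  then show ?case using assms by auto
next
  case (Cons j js)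
  have "circ_mean (k j) j (torus_mean k js B) w > 0"
    if w: "w \<in> bs_torus k" and eq: "\<forall>i. i \<notin> set (j # js) \<longrightarrow> w $ i = w0 $ i" for w
  proof (rule circ_mean_pos[OF _ _ w w0(1)])
    have "upd j (w0 $ j) w \<in> bs_torus k" using w w0(1) by (simp add: bs_torus_def act_upd) (simp add: act_def)
    then show "torus_mean k js B (upd j (w0 $ j) w) > 0" using Cons eq by auto
  qed (use Cons in auto)
  then show ?case using Cons by (auto intro: circ_mean_continuous circ_mean_nonneg)
qed

lemma torus_mean_continuous: "continuous_on (bs_torus k) B \<Longrightarrow> continuous_on (bs_torus k) (torus_mean k js B)"
  by (induction js) (simp_all add: circ_mean_continuous)

lemma circ_avg_weight:
  assumes B: "continuous_on (bs_torus k) B" and "finite I" "j \<in> I" "w \<in> bs_torus k"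
  shows "circ_avg (k j) j (\<lambda>w. of_real (B w) * (\<Prod>i\<in>I. weight k i w)) w
     = of_real (circ_mean (k j) j B w) * (\<Prod>i\<in>I - {j}. weight k i w)"
proof -
  let ?u = "\<lambda>t. upd j (of_real (sqrt (2 * real (k j))) * cis t) w"
  have cB: "continuous_on {0..2*pi} (\<lambda>t. B (?u t))"
    by (intro ring_continuous[OF B] continuous_intros) (use assms in simp)
  have "cis (real (k j) * t) * (of_real (B (?u t)) * (\<Prod>i\<in>I. weight k i (?u t)))
     = of_real (B (?u t)) * (\<Prod>i\<in>I - {j}. weight k i w)" for t
  proof -
    have "(\<Prod>i\<in>I. weight k i (?u t)) = weight k j (?u t) * (\<Prod>i\<in>I - {j}. weight k i (?u t))"
      using assms by (simp add: prod.remove)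
    also have "(\<Prod>i\<in>I - {j}. weight k i (?u t)) = (\<Prod>i\<in>I - {j}. weight k i w)"
      by (intro prod.cong) (auto simp: weight_def)
    finally have "(\<Prod>i\<in>I. weight k i (?u t)) = weight k j (?u t) * (\<Prod>i\<in>I - {j}. weight k i w)" .
    then have "cis (real (k j) * t) * (of_real (B (?u t)) * (\<Prod>i\<in>I. weight k i (?u t)))
       = of_real (B (?u t)) * ((cis (real (k j) * t) * weight k j (?u t)) * (\<Prod>i\<in>I - {j}. weight k i w))"
      by (simp only: mult_ac)
    also have "cis (real (k j) * t) * weight k j (?u t) = 1"
    proof (cases "k j = 0")
      case False
      then have "cnj (?u t $ j) * of_real (inverse (sqrt (2 * real (k j)))) = cis (- t)"
        by (simp add: cis_cnj)
      then show ?thesis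
        using Complex.DeMoivre[of "-t" "k j"] by (simp add: weight_def cis_mult)
    qed (simp add: weight_def)
    finally show ?thesis by simp
  qed
  then have "integral {0..2*pi} (\<lambda>t. cis (real (k j) * t) * (of_real (B (?u t)) * (\<Prod>i\<in>I. weight k i (?u t))))
     = integral {0..2*pi} (\<lambda>t. of_real (B (?u t)) * (\<Prod>i\<in>I - {j}. weight k i w))"
    by (simp only:)
  also have "\<dots> = integral {0..2*pi} (\<lambda>t. of_real (B (?u t))) * (\<Prod>i\<in>I - {j}. weight k i w)"
    by (rule integral_mult_left)
  also have "integral {0..2*pi} (\<lambda>t. of_real (B (?u t))) = (of_real (integral {0..2*pi} (\<lambda>t. B (?u t))) :: complex)"
    by (rule integral_linear[unfolded o_def, OF integrable_continuous_real[OF cB] bounded_linear_of_real])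
  finally have "integral {0..2*pi} (\<lambda>t. cis (real (k j) * t) * (of_real (B (?u t)) * (\<Prod>i\<in>I. weight k i (?u t))))
     = of_real (integral {0..2*pi} (\<lambda>t. B (?u t))) * (\<Prod>i\<in>I - {j}. weight k i w)" .
  then show ?thesis by (simp add: circ_avg_def circ_mean_def)
qed

text \<open>
  The weights cancel the oscillating factors in \<open>circ_avg\<close>, leaving the plain mean of \<open>B\<close>.
\<close>

lemma torus_avg_weight:
  assumes B: "continuous_on (bs_torus k) B" and "distinct js" "finite I" "set js \<subseteq> I" "w \<in> bs_torus k"
  shows "torus_avg k js (\<lambda>w. of_real (B w) * (\<Prod>i\<in>I. weight k i w)) w
     = of_real (torus_mean k js B w) * (\<Prod>i\<in>I - set js. weight k i w)"
  using assms(2,4,5)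
proof (induction js arbitrary: w)
  case (Cons j js)
  have IH: "torus_avg k js (\<lambda>w. of_real (B w) * (\<Prod>i\<in>I. weight k i w)) w
     = of_real (torus_mean k js B w) * (\<Prod>i\<in>I - set js. weight k i w)" if "w \<in> bs_torus k" for w
    by (rule Cons.IH) (use Cons.prems that in auto)
  have "torus_avg k (j # js) (\<lambda>w. of_real (B w) * (\<Prod>i\<in>I. weight k i w)) w
     = circ_avg (k j) j (\<lambda>w. of_real (torus_mean k js B w) * (\<Prod>i\<in>I - set js. weight k i w)) w"
    unfolding torus_avg.simps circ_avg_def by (simp only: IH[OF upd_bs_torus[OF Cons.prems(3)]])
  also have "\<dots> = of_real (circ_mean (k j) j (torus_mean k js B) w) * (\<Prod>i\<in>I - set js - {j}. weight k i w)"
  proof (rule circ_avg_weight[OF torus_mean_continuous[OF B]])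
    show "finite (I - set js)" using assms(3) by (rule finite_Diff)
    show "j \<in> I - set js" using Cons.prems by simp
  qed (rule Cons.prems)
  also have "I - set js - {j} = I - set (j # js)" by auto
  finally show ?case by simp
qed simp

subsection \<open>The Liouville density\<close>

lemma sum_UNIV_Plus:
  fixes f :: "'a::finite + 'b::finite \<Rightarrow> 'c::comm_monoid_add"
  shows "(\<Sum>c\<in>UNIV. f c) = (\<Sum>i\<in>UNIV. f (Inl i)) + (\<Sum>i\<in>UNIV. f (Inr i))"
  using sum.Plus[of "UNIV :: 'a set" "UNIV :: 'b set" f] by (simp add: UNIV_Plus_UNIV o_def)

lemma liouville_nonzero: "liouville_density (w :: complex^'n) \<noteq> 0"
proof -
  let ?M = "(\<chi> a b. omega w (real_frame a) (real_frame b)) :: real^('n + 'n)^('n + 'n)"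
  have e: "omega w (real_frame (Inl i)) (real_frame (Inl j)) = 0"
    "omega w (real_frame (Inr i)) (real_frame (Inr j)) = 0"
    "omega w (real_frame (Inl i)) (real_frame (Inr j)) = (if i = j then 1 else 0)"
    "omega w (real_frame (Inr i)) (real_frame (Inl j)) = (if i = j then -1 else 0)" for i j
    by (simp_all add: omega_def real_frame_def axis_def if_distrib[of Re] if_distrib[of Im] if_distrib[of "\<lambda>x. x * _"]
        if_distrib[of uminus] cong: if_cong)
  have orth: "(\<Sum>c\<in>UNIV. omega w (real_frame a) (real_frame c) * omega w (real_frame b) (real_frame c))
      = (if a = b then 1 else 0)" for a b :: "'n + 'n"
  proof (cases a)
    case a: (Inl i)
    show ?thesis
    proof (cases b)
      case (Inl j)
      then show ?thesis using a by (simp add: sum_UNIV_Plus e mult_delta_left mult_delta_right)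
    next
      case (Inr j)
      then show ?thesis using a by (simp add: sum_UNIV_Plus e)
    qed
  next
    case a: (Inr i)
    show ?thesis
    proof (cases b)
      case (Inl j)
      then show ?thesis using a by (simp add: sum_UNIV_Plus e)
    next
      case (Inr j)
      then show ?thesis using a by (simp add: sum_UNIV_Plus e mult_delta_left mult_delta_right)
    qed
  qed
  have "(?M ** transpose ?M) $ a $ b = (mat 1 :: real^('n + 'n)^('n + 'n)) $ a $ b" for a b
    unfolding matrix_matrix_mult_def transpose_def mat_def vec_lambda_beta by (rule orth)
  then have "?M ** transpose ?M = mat 1" by (simp add: vec_eq_iff)
  then have "det (?M ** transpose ?M) = det (mat 1 :: real^('n + 'n)^('n + 'n))" by (rule arg_cong)
  then have "det ?M * det (transpose ?M) = 1" by (simp only: det_mul det_I)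
  then have "det ?M \<noteq> 0" by auto
  then show ?thesis by (simp add: liouville_density_def)
qed

lemma sum_Basis_axis:
  fixes F :: "complex^'n \<Rightarrow> 'b::comm_monoid_add"
  shows "(\<Sum>b\<in>Basis. F b) = (\<Sum>j\<in>UNIV. F (axis j 1) + F (axis j \<i>))"
proof -
  have B: "(Basis :: (complex^'n) set) = (\<lambda>(j, c). axis j c) ` (UNIV \<times> {1, \<i>})"
    by (auto simp: Basis_vec_def Basis_complex_def)
  have "inj_on (\<lambda>(j, c). axis j c :: complex^'n) (UNIV \<times> {1, \<i>})"
    by (auto simp: inj_on_def axis_eq_axis)
  then have "(\<Sum>b\<in>Basis. F b) = (\<Sum>(j, c)\<in>UNIV \<times> {1, \<i>}. F (axis j c))"
    unfolding B by (subst sum.reindex) (auto simp: split_beta o_def)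
  also have "\<dots> = (\<Sum>j\<in>UNIV. \<Sum>c\<in>{1, \<i>}. F (axis j c))"
    by (rule sum.cartesian_product[symmetric])
  also have "\<dots> = (\<Sum>j\<in>UNIV. F (axis j 1) + F (axis j \<i>))"
    by (intro sum.cong) (auto simp: complex_eq_iff)
  finally show ?thesis .
qed

lemma divergence_eq:
  fixes w :: "complex^'n"
  assumes "smooth_on S X'" "open S" "w \<in> S"
  shows "divergence X' w = (\<Sum>j\<in>UNIV. partial_deriv (axis j 1) (\<lambda>z. Re (X' z $ j)) w
      + partial_deriv (axis j \<i>) (\<lambda>z. Im (X' z $ j)) w)"
proof -
  have "partial_deriv b (\<lambda>z. liouville_density z * (X' z \<bullet> b)) w
      = liouville_density w * partial_deriv b (\<lambda>z. X' z \<bullet> b) w" for b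
  proof -
    let ?c = "liouville_density w"
    have "smooth_on S (\<lambda>z. X' z \<bullet> b)" by (intro smooth_intros assms)
    from smooth_on_has_derivative[OF this assms(3)]
    have "((\<lambda>z. ?c * (X' z \<bullet> b)) has_derivative (\<lambda>u. ?c * frechet_derivative (\<lambda>z. X' z \<bullet> b) (at w) u)) (at w)"
      by (rule has_derivative_mult_right)
    moreover have "(\<lambda>z. liouville_density z * (X' z \<bullet> b)) = (\<lambda>z. ?c * (X' z \<bullet> b))"
    proof
      fix z :: "complex^'n"
      have "liouville_density z = ?c" by (rule trans[OF liouville_const liouville_const[symmetric]])
      then show "liouville_density z * (X' z \<bullet> b) = ?c * (X' z \<bullet> b)" by (simp only:)
    qed
    ultimately show ?thesis by (simp add: has_derivative_partial partial_deriv_def[of b "\<lambda>z. X' z \<bullet> b"])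
  qed
  then have "divergence X' w = (\<Sum>b\<in>Basis. partial_deriv b (\<lambda>z. X' z \<bullet> b) w)"
    using liouville_nonzero[of w] by (simp add: divergence_def flip: sum_distrib_left)
  also have "\<dots> = (\<Sum>j\<in>UNIV. partial_deriv (axis j 1) (\<lambda>z. X' z \<bullet> axis j 1) w
      + partial_deriv (axis j \<i>) (\<lambda>z. X' z \<bullet> axis j \<i>) w)"
    by (rule sum_Basis_axis)
  finally show ?thesis by (simp add: inner_axis inner_complex_def)
qed

section \<open>The Bohr-Sommerfeld sections are covariantly constant\<close>

context delzant_polytope
begin

lemma local_rep_continuous_bs_torus:
  assumes m: "m \<in> P \<inter> int_lattice" and \<phi>: "\<phi> \<in> smooth_sections"
  shows "continuous_on (bs_torus (bs_idx m)) (local_rep \<phi> (chosen_vertex m))"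
  using smooth_on_continuous_on[OF sec_smooth[OF \<phi>]] chosen_vertex(1)[of m] m bs_torus_Omega[OF m]
  by (auto intro: continuous_on_subset)

lemma bs_section_lincomb:
  assumes m: "m \<in> P \<inter> int_lattice" and \<phi>: "\<phi> \<in> smooth_sections" and \<psi>: "\<psi> \<in> smooth_sections"
  shows "bs_section m (\<lambda>v p. a * \<phi> v p + b * \<psi> v p) = a * bs_section m \<phi> + b * bs_section m \<psi>"
  using torus_avg_lincomb[OF local_rep_continuous_bs_torus[OF m \<phi>] local_rep_continuous_bs_torus[OF m \<psi>] bs_point_bs_torus, of coord_list a b]
    sec_lincomb[OF \<phi> \<psi>, of a b]
  by (simp add: bs_section_def \<phi> \<psi>)

lemma seminorm_upper:
  assumes "\<phi> \<in> smooth_sections" "v \<in> vertices" "compact K" "K \<subseteq> Omega v" "set bs \<subseteq> Basis"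
  shows "bdd_above (insert 0 ((\<lambda>w. norm (iter_deriv bs (local_rep \<phi> v) w)) ` K))"
proof -
  have "continuous_on K (\<lambda>w. norm (iter_deriv bs (local_rep \<phi> v) w))"
    by (intro continuous_on_norm continuous_on_subset[OF smooth_on_iter_continuous[OF sec_smooth[OF assms(1,2)] assms(5)] assms(4)])
  then have "bounded ((\<lambda>w. norm (iter_deriv bs (local_rep \<phi> v) w)) ` K)"
    by (intro compact_imp_bounded compact_continuous_image assms(3))
  then show ?thesis by (simp add: bounded_imp_bdd_above)
qed

lemma seminorm_nonneg:
  assumes "\<phi> \<in> smooth_sections" "(v, K, bs) \<in> seminorm_indices"
  shows "seminorm v K bs \<phi> \<ge> 0"
  unfolding seminorm_def
  by (rule cSup_upper[OF _ seminorm_upper]) (use assms in \<open>auto simp: seminorm_indices_def chart_image\<close>)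

lemma bs_section_bound:
  assumes m: "m \<in> P \<inter> int_lattice" and \<phi>: "\<phi> \<in> smooth_sections"
  shows "norm (bs_section m \<phi>) \<le> seminorm (chosen_vertex m) (bs_torus (bs_idx m)) [] \<phi>"
proof -
  have v: "chosen_vertex m \<in> vertices" using m chosen_vertex by blast
  have "norm (local_rep \<phi> (chosen_vertex m) w) \<le> seminorm (chosen_vertex m) (bs_torus (bs_idx m)) [] \<phi>" if "w \<in> bs_torus (bs_idx m)" for w
    unfolding seminorm_def
    by (rule cSup_upper[OF _ seminorm_upper[OF \<phi> v compact_bs_torus bs_torus_Omega[OF m]]])
       (use that in \<open>auto simp: iter_deriv_def\<close>)
  from torus_avg_bound[OF local_rep_continuous_bs_torus[OF m \<phi>] this bs_point_bs_torus] show ?thesis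
    by (simp add: bs_section_def \<phi>)
qed

lemma test_sections_smooth: "\<phi> \<in> test_sections U \<Longrightarrow> \<phi> \<in> smooth_sections"
  by (simp add: test_sections_def)

lemma bs_torus_index:
  "m \<in> P \<inter> int_lattice \<Longrightarrow> (chosen_vertex m, bs_torus (bs_idx m), []) \<in> seminorm_indices"
  using chosen_vertex(1)[of m] bs_torus_Omega[of m] by (auto simp: seminorm_indices_def compact_bs_torus chart_image)

lemma bs_section_comb_distribution:
  assumes M: "finite M" "M \<subseteq> P \<inter> int_lattice"
  shows "(\<lambda>\<phi>. \<Sum>m\<in>M. c m * bs_section m \<phi>) \<in> distributional_sections X"
  unfolding distributional_sections_def mem_Collect_eq test_sections_X
proof (intro conjI allI ballI impI)
  show "(\<Sum>m\<in>M. c m * bs_section m \<phi>) = 0" if "\<phi> \<notin> smooth_sections" for \<phi>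
    using that by (simp add: bs_section_def)
  show "(\<Sum>m\<in>M. c m * bs_section m (\<lambda>v p. a * \<phi> v p + b * \<psi> v p))
     = a * (\<Sum>m\<in>M. c m * bs_section m \<phi>) + b * (\<Sum>m\<in>M. c m * bs_section m \<psi>)"
    if "\<phi> \<in> smooth_sections" "\<psi> \<in> smooth_sections" for \<phi> \<psi> a b
  proof -
    have "(\<Sum>m\<in>M. c m * bs_section m (\<lambda>v p. a * \<phi> v p + b * \<psi> v p))
       = (\<Sum>m\<in>M. a * (c m * bs_section m \<phi>) + b * (c m * bs_section m \<psi>))"
      using M(2) that by (intro sum.cong refl) (simp add: bs_section_lincomb subset_iff algebra_simps)
    then show ?thesis by (simp add: sum.distrib sum_distrib_left)
  qed
  fix K assume "compactin X_top K \<and> K \<subseteq> X"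
  let ?I = "(\<lambda>m. (chosen_vertex m, bs_torus (bs_idx m), [] :: (complex^'n) list)) ` M" and ?C = "\<Sum>m\<in>M. norm (c m)"
  show "\<exists>C I. finite I \<and> I \<subseteq> seminorm_indices \<and>
      (\<forall>\<phi>\<in>smooth_sections. section_support \<phi> \<subseteq> K \<longrightarrow>
         norm (\<Sum>m\<in>M. c m * bs_section m \<phi>) \<le> C * (\<Sum>(v, K', bs)\<in>I. seminorm v K' bs \<phi>))"
  proof (intro exI conjI ballI impI)
    show "finite ?I" using M by simp
    show I: "?I \<subseteq> seminorm_indices" using M bs_torus_index by auto
    fix \<phi> assume \<phi>: "\<phi> \<in> smooth_sections"
    let ?S = "\<Sum>(v, K', bs)\<in>?I. seminorm v K' bs \<phi>"
    have le: "norm (bs_section m \<phi>) \<le> ?S" if "m \<in> M" for m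
    proof -
      have "norm (bs_section m \<phi>) \<le> (\<lambda>(v, K', bs). seminorm v K' bs \<phi>) (chosen_vertex m, bs_torus (bs_idx m), [])"
        using bs_section_bound[OF _ \<phi>] that M by auto
      also have "\<dots> \<le> ?S"
      proof (rule member_le_sum)
        show "(chosen_vertex m, bs_torus (bs_idx m), []) \<in> ?I" using that by (rule imageI)
        show "finite ?I" using M by simp
        fix i assume "i \<in> ?I - {(chosen_vertex m, bs_torus (bs_idx m), [])}"
        then have "i \<in> seminorm_indices" using I by blast
        then show "0 \<le> (case i of (v, K', bs) \<Rightarrow> seminorm v K' bs \<phi>)"
          using seminorm_nonneg[OF \<phi>] by (cases i) auto
      qed
      finally show ?thesis .
    qed
    have "norm (\<Sum>m\<in>M. c m * bs_section m \<phi>) \<le> (\<Sum>m\<in>M. norm (c m) * ?S)"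
      by (rule order_trans[OF norm_sum]) (intro sum_mono, simp add: norm_mult mult_left_mono le)
    then show "norm (\<Sum>m\<in>M. c m * bs_section m \<phi>) \<le> ?C * ?S" by (simp only: sum_distrib_right)
  qed
qed

lemma support_zero:
  assumes "v \<in> vertices" "w \<in> Omega v" "chart_inv v w \<notin> section_support \<phi>"
  shows "local_rep \<phi> v w = 0"
proof (rule ccontr)
  assume ne: "local_rep \<phi> v w \<noteq> 0"
  let ?N = "{p \<in> X. \<exists>v\<in>vertices. p \<in> V v \<and> \<phi> v p \<noteq> 0}"
  have "?N \<subseteq> X_top closure_of ?N" by (rule closure_of_subset) (simp add: topspace_X)
  moreover have "chart_inv v w \<in> ?N"
    by (intro CollectI conjI bexI[of _ v]) (use assms ne in auto)
  ultimately show False using assms(3) unfolding section_support_def by blast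
qed

lemma open_off_support:
  assumes "v \<in> vertices"
  shows "open {w \<in> Omega v. chart_inv v w \<notin> section_support \<phi>}"
proof -
  have "openin X_top (topspace X_top - section_support \<phi>)"
    unfolding section_support_def by (rule openin_diff[OF openin_topspace closedin_closure_of])
  from openin_chart[OF this assms] show ?thesis
    using assms by (simp add: topspace_X cong: conj_cong)
qed

text \<open>
  Multiplying the field \<open>\<xi>\<close> by the test section gives a field with complex coefficients on the whole
  chart, still tangent to the orbits. The transposed covariant derivative is its divergence together
  with the contraction of the connection form. Both are sums over the coordinate planes, and
  \<open>circle_average_zero\<close> applies to each summand.
\<close>

lemma bs_section_transpose_nabla:
  assumes m: "m \<in> P \<inter> int_lattice" and W: "openin X_top W" and \<xi>: "\<xi> \<in> polarized_fields W"
    and \<phi>: "\<phi> \<in> test_sections W" and sm: "transpose_nabla W \<xi> \<phi> \<in> smooth_sections"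
  shows "bs_section m (transpose_nabla W \<xi> \<phi>) = 0"
proof -
  let ?v = "chosen_vertex m" and ?k = "bs_idx m"
  have v: "?v \<in> vertices" using m chosen_vertex by blast
  note \<phi>s = test_sections_smooth[OF \<phi>]
  define O' where "O' = {w \<in> Omega ?v. chart_inv ?v w \<in> W}"
  define Z where "Z = {w \<in> Omega ?v. chart_inv ?v w \<notin> section_support \<phi>}"
  have oO: "open O'" unfolding O'_def by (rule openin_chart[OF W v])
  have oZ: "open Z" unfolding Z_def by (rule open_off_support[OF v])
  have OZ: "O' \<union> Z = Omega ?v" using \<phi> by (auto simp: O'_def Z_def test_sections_def)
  define f where "f = local_rep \<phi> ?v"
  have sf: "smooth_on (Omega ?v) f" unfolding f_def by (rule sec_smooth[OF \<phi>s v])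
  then have sfO: "smooth_on O' f" by (rule smooth_on_subset) (auto simp: O'_def)
  have fZ: "f w = 0" if "w \<in> Z" for w
    using support_zero[OF v, of w \<phi>] that by (simp add: Z_def f_def)
  define F where "F = (\<lambda>w. \<xi> ?v (chart_inv ?v w))"
  have \<xi>1: "\<forall>v\<in>vertices. smooth_on (chart v ` (W \<inter> V v)) (\<lambda>w. \<xi> v (chart_inv v w))"
    and \<xi>2: "\<forall>v\<in>vertices. \<forall>p\<in>W \<inter> V v. fst (\<xi> v p) \<in> orbit_tangent v (chart v p)
        \<and> snd (\<xi> v p) \<in> orbit_tangent v (chart v p)"
    using \<xi> unfolding polarized_fields_def mem_Collect_eq by blast+
  have O'_eq: "chart ?v ` (W \<inter> V ?v) = O'" unfolding O'_def by (rule chart_image_Int[OF v])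
  have sF: "smooth_on O' F" using bspec[OF \<xi>1 v] unfolding F_def O'_eq .
  define X1 X2 where "X1 w = fst (F w)" and "X2 w = snd (F w)" for w
  have sX: "smooth_on O' X1" "smooth_on O' X2"
    unfolding X1_def[abs_def] X2_def[abs_def] by (intro smooth_intros oO sF)+
  have tX: "\<exists>s. X1 w = rot_field s w" "\<exists>s. X2 w = rot_field s w" if w: "w \<in> O'" for w
  proof -
    have wO: "w \<in> Omega ?v" and "chart_inv ?v w \<in> W \<inter> V ?v" using w v by (auto simp: O'_def)
    then have "fst (\<xi> ?v (chart_inv ?v w)) \<in> orbit_tangent ?v w" "snd (\<xi> ?v (chart_inv ?v w)) \<in> orbit_tangent ?v w"
      using bspec[OF bspec[OF \<xi>2 v], of "chart_inv ?v w"] v by auto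
    then show "\<exists>s. X1 w = rot_field s w" "\<exists>s. X2 w = rot_field s w"
      by (auto simp: X1_def X2_def F_def orbit_tangent_eq[OF v wO])
  qed
  define \<zeta>1 \<zeta>2 where "\<zeta>1 j w = complex_of_real (Re (X1 w $ j)) + \<i> * of_real (Re (X2 w $ j))"
    and "\<zeta>2 j w = complex_of_real (Im (X1 w $ j)) + \<i> * of_real (Im (X2 w $ j))" for j w
  \<comment> \<open>The support of the test section lies in W, so extension by zero is smooth on the whole chart.\<close>
  define y1 y2 where "y1 j w = (if w \<in> O' then - (f w * \<zeta>1 j w) else 0)"
    and "y2 j w = (if w \<in> O' then - (f w * \<zeta>2 j w) else 0)" for j w
  have s\<zeta>: "smooth_on O' (\<zeta>1 j)" "smooth_on O' (\<zeta>2 j)" for j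
    unfolding \<zeta>1_def[abs_def] \<zeta>2_def[abs_def] by (intro smooth_intros oO sX)+
  have sy: "smooth_on (Omega ?v) (y1 j)" "smooth_on (Omega ?v) (y2 j)" for j
  proof -
    have "smooth_on O' (\<lambda>w. - (f w * \<zeta>1 j w))" "smooth_on O' (\<lambda>w. - (f w * \<zeta>2 j w))"
      by (intro smooth_intros oO sfO s\<zeta>)+
    then have "smooth_on O' (y1 j)" "smooth_on O' (y2 j)"
      by (auto intro: smooth_on_cong[OF oO] simp: y1_def y2_def)
    then show "smooth_on (Omega ?v) (y1 j)" "smooth_on (Omega ?v) (y2 j)"
      using fZ by (auto intro!: smooth_on_zero_off[OF oO oZ OZ] simp: y1_def y2_def)
  qed
  have tan: "Re (w $ j) *\<^sub>R y1 j w + Im (w $ j) *\<^sub>R y2 j w = 0"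
    and fix0: "w $ j = 0 \<Longrightarrow> y1 j w = 0 \<and> y2 j w = 0" for j w
  proof -
    have "Re (w $ j) *\<^sub>R y1 j w + Im (w $ j) *\<^sub>R y2 j w = 0 \<and> (w $ j = 0 \<longrightarrow> y1 j w = 0 \<and> y2 j w = 0)"
    proof (cases "w \<in> O'")
      case True
      obtain s s' where s: "X1 w = rot_field s w" "X2 w = rot_field s' w" using tX[OF True] by blast
      have z: "\<zeta>1 j w = - (of_real (Im (w $ j)) * (of_real (s $ j) + \<i> * of_real (s' $ j)))"
        "\<zeta>2 j w = of_real (Re (w $ j)) * (of_real (s $ j) + \<i> * of_real (s' $ j))"
        by (simp_all add: \<zeta>1_def \<zeta>2_def s rot_field_def complex_eq_iff)
      show ?thesis using True by (simp add: y1_def y2_def z scaleR_conv_of_real algebra_simps)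
    qed (simp add: y1_def y2_def)
    then show "Re (w $ j) *\<^sub>R y1 j w + Im (w $ j) *\<^sub>R y2 j w = 0"
      "w $ j = 0 \<Longrightarrow> y1 j w = 0 \<and> y2 j w = 0" by auto
  qed
  define n where "n j w = partial_deriv (axis j 1) (y1 j) w + partial_deriv (axis j \<i>) (y2 j) w
      + \<i> / 2 * (Re (w $ j) *\<^sub>R y2 j w - Im (w $ j) *\<^sub>R y1 j w)" for j w
  have avg0: "circ_avg (?k j) j (n j) w = 0" if "w \<in> bs_torus ?k" for j w
    unfolding n_def[abs_def]
    by (rule circle_average_zero[OF open_Omega bs_torus_Omega[OF m] sy tan fix0 that])
  have sn: "smooth_on (Omega ?v) (n j)" for j
    unfolding n_def[abs_def] by (intro smooth_intros smooth_on_partial sy) simp_all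
  have cn: "continuous_on (bs_torus ?k) (n j)" for j
    by (rule continuous_on_subset[OF smooth_on_continuous_on[OF sn] bs_torus_Omega[OF m]])
  have eq: "local_rep (transpose_nabla W \<xi> \<phi>) ?v w = (\<Sum>j\<in>UNIV. n j w)" if w: "w \<in> Omega ?v" for w
  proof (cases "w \<in> O'")
    case False
    then have wZ: "w \<in> Z" using w OZ by blast
    have z: "y1 j z = 0" "y2 j z = 0" if "z \<in> Z" for j z using fZ[OF that] by (simp_all add: y1_def y2_def)
    have "n j w = 0" for j
      using partial_deriv_zero[OF oZ wZ, of "y1 j" "axis j 1"] partial_deriv_zero[OF oZ wZ, of "y2 j" "axis j \<i>"] z wZ
      by (simp add: n_def)
    moreover have "local_rep (transpose_nabla W \<xi> \<phi>) ?v w = 0"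
      using False w by (simp add: transpose_nabla_def O'_def)
    ultimately show ?thesis by simp
  next
    case True
    have df: "f differentiable (at w)" by (rule smooth_on_differentiable[OF sf w])
    have dR: "((\<lambda>w. Re (X' w $ j)) has_derivative frechet_derivative (\<lambda>w. Re (X' w $ j)) (at w)) (at w)"
      "((\<lambda>w. Im (X' w $ j)) has_derivative frechet_derivative (\<lambda>w. Im (X' w $ j)) (at w)) (at w)"
      if "smooth_on O' X'" for X' :: "complex^'n \<Rightarrow> complex^'n" and j
      by (rule smooth_on_has_derivative[OF _ True], intro smooth_intros oO that)+
    have \<zeta>d: "(\<zeta>1 j has_derivative (\<lambda>u. of_real (frechet_derivative (\<lambda>w. Re (X1 w $ j)) (at w) u)
        + \<i> * of_real (frechet_derivative (\<lambda>w. Re (X2 w $ j)) (at w) u))) (at w)"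
      "(\<zeta>2 j has_derivative (\<lambda>u. of_real (frechet_derivative (\<lambda>w. Im (X1 w $ j)) (at w) u)
        + \<i> * of_real (frechet_derivative (\<lambda>w. Im (X2 w $ j)) (at w) u))) (at w)" for j
      unfolding \<zeta>1_def[abs_def] \<zeta>2_def[abs_def]
      by (intro has_derivative_add has_derivative_of_real has_derivative_mult_right dR sX)+
    have py: "partial_deriv b (y1 j) w = - (f w * (of_real (partial_deriv b (\<lambda>w. Re (X1 w $ j)) w)
        + \<i> * of_real (partial_deriv b (\<lambda>w. Re (X2 w $ j)) w)) + partial_deriv b f w * \<zeta>1 j w)"
      "partial_deriv b (y2 j) w = - (f w * (of_real (partial_deriv b (\<lambda>w. Im (X1 w $ j)) w)
        + \<i> * of_real (partial_deriv b (\<lambda>w. Im (X2 w $ j)) w)) + partial_deriv b f w * \<zeta>2 j w)" for j b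
    proof -
      note d1 = has_derivative_minus[OF has_derivative_mult[OF df[unfolded frechet_derivative_works] \<zeta>d(1)[of j]]]
      note d2 = has_derivative_minus[OF has_derivative_mult[OF df[unfolded frechet_derivative_works] \<zeta>d(2)[of j]]]
      have "(y1 j has_derivative (\<lambda>h. - (f w * (of_real (frechet_derivative (\<lambda>w. Re (X1 w $ j)) (at w) h)
        + \<i> * of_real (frechet_derivative (\<lambda>w. Re (X2 w $ j)) (at w) h)) + frechet_derivative f (at w) h * \<zeta>1 j w))) (at w)"
        by (rule has_derivative_transform_within_open[OF d1 oO True]) (simp add: y1_def)
      from has_derivative_partial[OF this]
      show "partial_deriv b (y1 j) w = - (f w * (of_real (partial_deriv b (\<lambda>w. Re (X1 w $ j)) w)
        + \<i> * of_real (partial_deriv b (\<lambda>w. Re (X2 w $ j)) w)) + partial_deriv b f w * \<zeta>1 j w)"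
        by (simp add: partial_deriv_def)
      have "(y2 j has_derivative (\<lambda>h. - (f w * (of_real (frechet_derivative (\<lambda>w. Im (X1 w $ j)) (at w) h)
        + \<i> * of_real (frechet_derivative (\<lambda>w. Im (X2 w $ j)) (at w) h)) + frechet_derivative f (at w) h * \<zeta>2 j w))) (at w)"
        by (rule has_derivative_transform_within_open[OF d2 oO True]) (simp add: y2_def)
      from has_derivative_partial[OF this]
      show "partial_deriv b (y2 j) w = - (f w * (of_real (partial_deriv b (\<lambda>w. Im (X1 w $ j)) w)
        + \<i> * of_real (partial_deriv b (\<lambda>w. Im (X2 w $ j)) w)) + partial_deriv b f w * \<zeta>2 j w)"
        by (simp add: partial_deriv_def)
    qed
    have fr: "frechet_derivative f (at w) (X' w)
        = (\<Sum>j\<in>UNIV. of_real (Re (X' w $ j)) * partial_deriv (axis j 1) f w + of_real (Im (X' w $ j)) * partial_deriv (axis j \<i>) f w)"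
      for X' :: "complex^'n \<Rightarrow> complex^'n"
      unfolding frechet_derivative_partial[OF df] sum_Basis_axis
      by (simp add: inner_axis inner_complex_def scaleR_conv_of_real)
    have ac: "of_real (action_form w (X' w))
        = (\<Sum>j\<in>UNIV. of_real (Re (w $ j) * Im (X' w $ j) - Im (w $ j) * Re (X' w $ j)) / (2::complex))"
      for X' :: "complex^'n \<Rightarrow> complex^'n"
      by (simp add: action_form_def algebra_simps)
    have dv: "of_real (divergence X' w) = (\<Sum>j\<in>UNIV. complex_of_real (partial_deriv (axis j 1) (\<lambda>z. Re (X' z $ j)) w)
        + of_real (partial_deriv (axis j \<i>) (\<lambda>z. Im (X' z $ j)) w))"
      if "smooth_on O' X'" for X' :: "complex^'n \<Rightarrow> complex^'n"
      using divergence_eq[OF that oO True] by simp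
    have p: "?v \<in> vertices \<and> chart_inv ?v w \<in> W \<inter> V ?v" using True v by (simp add: O'_def)
    have FF: "(\<lambda>w. fst (\<xi> ?v (chart_inv ?v w))) = X1" "(\<lambda>w. snd (\<xi> ?v (chart_inv ?v w))) = X2"
      "fst (\<xi> ?v (chart_inv ?v w)) = X1 w" "snd (\<xi> ?v (chart_inv ?v w)) = X2 w"
      by (simp_all add: X1_def[abs_def] X2_def[abs_def] F_def)
    have "local_rep (transpose_nabla W \<xi> \<phi>) ?v w = - ((of_real (divergence X1 w) + \<i> * of_real (divergence X2 w)) * f w
       + (frechet_derivative f (at w) (X1 w) + \<i> * frechet_derivative f (at w) (X2 w))
       + \<i> * (of_real (action_form w (X1 w)) + \<i> * of_real (action_form w (X2 w))) * f w)"
      unfolding transpose_nabla_def if_P[OF p] dual_connection_def cdivergence_def cderiv_def connection_form_def FF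
      using w v by (simp add: f_def algebra_simps)
    also have "\<dots> = (\<Sum>j\<in>UNIV. n j w)"
      unfolding dv[OF sX(1)] dv[OF sX(2)] fr ac sum_distrib_left sum_distrib_right sum.distrib[symmetric] sum_negf[symmetric]
    proof (rule sum.cong[OF refl])
      fix j
      have yy: "y1 j w = - (f w * \<zeta>1 j w)" "y2 j w = - (f w * \<zeta>2 j w)" using True by (simp_all add: y1_def y2_def)
      show "- ((complex_of_real (partial_deriv (axis j 1) (\<lambda>z. Re (X1 z $ j)) w) +
             complex_of_real (partial_deriv (axis j \<i>) (\<lambda>z. Im (X1 z $ j)) w) +
             \<i> * (complex_of_real (partial_deriv (axis j 1) (\<lambda>z. Re (X2 z $ j)) w) +
               complex_of_real (partial_deriv (axis j \<i>) (\<lambda>z. Im (X2 z $ j)) w))) * f w +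
            (complex_of_real (Re (X1 w $ j)) * partial_deriv (axis j 1) f w +
             complex_of_real (Im (X1 w $ j)) * partial_deriv (axis j \<i>) f w +
             \<i> * (complex_of_real (Re (X2 w $ j)) * partial_deriv (axis j 1) f w +
               complex_of_real (Im (X2 w $ j)) * partial_deriv (axis j \<i>) f w)) +
            \<i> * (complex_of_real (Re (w $ j) * Im (X1 w $ j) - Im (w $ j) * Re (X1 w $ j)) / 2 +
              \<i> * (complex_of_real (Re (w $ j) * Im (X2 w $ j) - Im (w $ j) * Re (X2 w $ j)) / 2)) * f w) = n j w"
        unfolding n_def py yy \<zeta>1_def \<zeta>2_def by (simp add: scaleR_conv_of_real field_simps)
    qed
    finally show ?thesis .
  qed
  have "bs_section m (transpose_nabla W \<xi> \<phi>) = torus_avg ?k coord_list (local_rep (transpose_nabla W \<xi> \<phi>) ?v) (bs_point ?k)"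
    using sm by (simp add: bs_section_def)
  also have "\<dots> = torus_avg ?k coord_list (\<lambda>w. \<Sum>j\<in>UNIV. n j w) (bs_point ?k)"
    by (rule torus_avg_cong[OF eq bs_point_bs_torus]) (use bs_torus_Omega[OF m] in auto)
  also have "\<dots> = (\<Sum>j\<in>UNIV. torus_avg ?k coord_list (n j) (bs_point ?k))"
    by (rule torus_avg_sum[OF finite cn bs_point_bs_torus])
  also have "\<dots> = 0"
    by (intro sum.neutral ballI torus_avg_vanish[OF cn avg0 _ bs_point_bs_torus]) (simp_all add: coord_list)
  finally show ?thesis .
qed

lemma bs_section_comb_Q_real:
  assumes M: "finite M" "M \<subseteq> P \<inter> int_lattice"
  shows "(\<lambda>\<phi>. \<Sum>m\<in>M. c m * bs_section m \<phi>) \<in> Q_real"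
  unfolding Q_real_def mem_Collect_eq
proof (intro conjI allI impI ballI ext)
  show "(\<lambda>\<phi>. \<Sum>m\<in>M. c m * bs_section m \<phi>) \<in> distributional_sections X" by (rule bs_section_comb_distribution[OF M])
  fix W \<xi> \<phi> assume W: "openin X_top W" and \<xi>: "\<xi> \<in> polarized_fields W"
  show "nabla_dist W \<xi> (restrict_dist W (\<lambda>\<phi>. \<Sum>m\<in>M. c m * bs_section m \<phi>)) \<phi> = 0"
  proof (cases "\<phi> \<in> test_sections W \<and> transpose_nabla W \<xi> \<phi> \<in> test_sections W")
    case True
    then have "bs_section m (transpose_nabla W \<xi> \<phi>) = 0" if "m \<in> M" for m
      using bs_section_transpose_nabla[OF _ W \<xi>] that M test_sections_smooth by blast
    then show ?thesis by (simp add: nabla_dist_def restrict_dist_def)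
  qed (auto simp: nabla_dist_def restrict_dist_def)
qed

section \<open>Supports\<close>

text \<open>
  Test sections supported off the fiber vanish on the torus over which the average is taken.
\<close>

lemma bs_section_support_subset:
  assumes m: "m \<in> P \<inter> int_lattice" shows "dist_support (bs_section m) \<subseteq> moment_fiber m"
proof
  fix p assume p: "p \<in> dist_support (bs_section m)"
  let ?U = "{p \<in> X. moment p \<in> - {m}}"
  have v: "chosen_vertex m \<in> vertices" using m chosen_vertex by blast
  have "restrict_dist ?U (bs_section m) = (\<lambda>_. 0)"
  proof
    fix \<phi>
    show "restrict_dist ?U (bs_section m) \<phi> = 0"
    proof (cases "\<phi> \<in> test_sections ?U")
      case True
      have "local_rep \<phi> (chosen_vertex m) w = 0" if w: "w \<in> bs_torus (bs_idx m)" for w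
      proof (rule support_zero[OF v])
        show wO: "w \<in> Omega (chosen_vertex m)" using w bs_torus_Omega[OF m] by blast
        have "moment (chart_inv (chosen_vertex m) w) = m" using wO v moment_at_bs_torus[OF m w] by simp
        then show "chart_inv (chosen_vertex m) w \<notin> section_support \<phi>" using True by (auto simp: test_sections_def)
      qed
      then have "torus_avg (bs_idx m) coord_list (local_rep \<phi> (chosen_vertex m)) (bs_point (bs_idx m)) = torus_avg (bs_idx m) coord_list (\<lambda>_. 0) (bs_point (bs_idx m))"
        by (rule torus_avg_cong[OF _ bs_point_bs_torus])
      then show ?thesis by (simp add: restrict_dist_def bs_section_def torus_avg_zero)
    qed (simp add: restrict_dist_def)
  qed
  moreover have "openin X_top ?U" by (rule openin_moment) (simp add: open_Compl)
  ultimately have "p \<notin> ?U" using p by (auto simp: dist_support_def)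
  moreover have "p \<in> X" using p by (simp add: dist_support_def)
  ultimately show "p \<in> moment_fiber m" by (simp add: moment_fiber_def)
qed

text \<open>
  Compact subsets of a chart are closed in the manifold. Near a point of the chart this is the
  continuity of the change of charts; a point outside the chart is separated by the moment map,
  whose values outside \<open>P_at v\<close> avoid a compact subset of \<open>P_at v\<close>.
\<close>

lemma closed_chart_ball:
  assumes v: "v \<in> vertices" and C: "compact C" "C \<subseteq> Omega v"
  shows "closedin X_top (chart_inv v ` C)"
proof -
  let ?Q = "chart_inv v ` C"
  have QX: "?Q \<subseteq> X" using C(2) v by auto
  have memQ: "q \<in> ?Q \<longleftrightarrow> q \<in> V v \<and> chart v q \<in> C" for q
  proof
    assume "q \<in> ?Q"
    then show "q \<in> V v \<and> chart v q \<in> C" using C(2) v by auto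
  next
    assume "q \<in> V v \<and> chart v q \<in> C"
    then show "q \<in> ?Q" using v by (intro image_eqI[of _ _ "chart v q"]) auto
  qed
  let ?K = "moment_at v ` C"
  have K: "compact ?K" by (rule compact_continuous_image[OF _ C(1)]) (intro continuous_intros)
  have KP: "?K \<subseteq> P_at v" using C(2) moment_at_P_at[OF v] by blast
  have "open_in_X (X - ?Q)"
    unfolding open_in_X_iff
  proof (intro conjI ballI)
    fix v' assume v': "v' \<in> vertices"
    let ?G = "{w \<in> overlap v' v. chart v (chart_inv v' w) \<in> - C}"
    have "{w \<in> Omega v'. chart_inv v' w \<in> X - ?Q} = {w \<in> Omega v'. moment_at v' w \<notin> ?K} \<union> ?G"
    proof (intro equalityI subsetI)
      fix w assume w: "w \<in> {w \<in> Omega v'. chart_inv v' w \<in> X - ?Q}"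
      then have wO: "w \<in> Omega v'" by simp
      show "w \<in> {w \<in> Omega v'. moment_at v' w \<notin> ?K} \<union> ?G"
      proof (cases "chart_inv v' w \<in> V v")
        case True
        then have "chart v (chart_inv v' w) \<notin> C" using w memQ by blast
        then show ?thesis using True wO by (simp add: overlap_def)
      next
        case False
        then have "moment_at v' w \<notin> P_at v" using wO v' by (simp add: V_def)
        then show ?thesis using KP wO by blast
      qed
    next
      fix w assume w: "w \<in> {w \<in> Omega v'. moment_at v' w \<notin> ?K} \<union> ?G"
      then have wO: "w \<in> Omega v'" by (auto simp: overlap_def)
      have "chart_inv v' w \<notin> ?Q"
      proof
        assume "chart_inv v' w \<in> ?Q"
        then have q: "chart_inv v' w \<in> V v" "chart v (chart_inv v' w) \<in> C" using memQ by auto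
        then have "moment_at v' w = moment_at v (chart v (chart_inv v' w))" using v v' wO by (simp add: moment_at_chart)
        then show False using w q by auto
      qed
      then show "w \<in> {w \<in> Omega v'. chart_inv v' w \<in> X - ?Q}" using wO v' by simp
    qed
    moreover have "open ?G"
    proof -
      have "continuous_on (overlap v' v) (\<lambda>w. chart v (chart_inv v' w))"
        by (rule smooth_on_continuous_on[OF smooth_transition[OF v' v]])
      then have "open ((\<lambda>w. chart v (chart_inv v' w)) -` (- C) \<inter> overlap v' v)"
        using open_overlap[OF v' v] compact_imp_closed[OF C(1)] by (simp add: continuous_on_open_vimage open_Compl)
      moreover have "?G = (\<lambda>w. chart v (chart_inv v' w)) -` (- C) \<inter> overlap v' v" by auto
      ultimately show ?thesis by simp
    qed
    ultimately show "open {w \<in> Omega v'. chart_inv v' w \<in> X - ?Q}"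
      using open_moment_at_Compl[OF K, of v'] by (simp only: open_Un)
  qed auto
  then show ?thesis using QX by (simp add: closedin_def topspace_X openin_X_top)
qed

text \<open>
  At any point of the fiber, the test section is a bump function times the conjugate of the parallel
  section; the average is then the mean of the bump function over the torus.
\<close>

lemma bs_section_support_superset:
  assumes m: "m \<in> P \<inter> int_lattice" shows "moment_fiber m \<subseteq> dist_support (bs_section m)"
proof
  let ?v = "chosen_vertex m" and ?k = "bs_idx m"
  have v: "?v \<in> vertices" and mv: "m \<in> P_at ?v" using m chosen_vertex by auto
  fix p assume "p \<in> moment_fiber m"
  then have pX: "p \<in> X" and pm: "moment p = m" by (auto simp: moment_fiber_def)
  then have pV: "p \<in> V ?v" using mv by (simp add: V_def)
  have False if U: "openin X_top U" "restrict_dist U (bs_section m) = (\<lambda>_. 0)" "p \<in> U" for U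
  proof -
    let ?w0 = "chart ?v p"
    have w0O: "?w0 \<in> Omega ?v" by (rule chart_Omega[OF v pV])
    have w0: "?w0 \<in> bs_torus ?k"
      using ell_moment_at[OF v, of _ ?w0] by (simp add: bs_torus_def moment_at_chart[OF v pV] pm bs_idx[OF m])
    have "open {w \<in> Omega ?v. chart_inv ?v w \<in> U}" by (rule openin_chart[OF U(1) v])
    moreover have "?w0 \<in> {w \<in> Omega ?v. chart_inv ?v w \<in> U}" using w0O v pV U(3) by simp
    ultimately obtain r where r: "r > 0" "cball ?w0 r \<subseteq> {w \<in> Omega ?v. chart_inv ?v w \<in> U}"
      using open_contains_cball by blast
    let ?C = "cball ?w0 r"
    have CO: "?C \<subseteq> Omega ?v" using r by blast
    define B where "B w = cutoff ((norm (w - ?w0))\<^sup>2 * inverse (r\<^sup>2))" for w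
    define g where "g w = of_real (B w) * (\<Prod>j\<in>UNIV. weight ?k j w)" for w
    have sB: "smooth_on UNIV B"
      unfolding B_def[abs_def] by (intro smooth_intros) simp_all
    have sg: "smooth_on UNIV g"
      unfolding g_def[abs_def] weight_def by (intro smooth_intros sB) simp_all
    have B0: "B w = 0" if "w \<notin> ?C" for w
    proof -
      have "r\<^sup>2 \<le> (norm (w - ?w0))\<^sup>2"
        using that r(1) by (intro power_mono) (auto simp: dist_norm norm_minus_commute)
      then have "1 \<le> (norm (w - ?w0))\<^sup>2 * inverse (r\<^sup>2)" using r(1) by (simp add: field_simps)
      then show ?thesis by (simp add: B_def cutoff_zero)
    qed
    have gC: "w \<in> ?C" if "g w \<noteq> 0" for w using that B0[of w] by (auto simp: g_def)
    have K: "compact (moment_at ?v ` ?C)" "moment_at ?v ` ?C \<subseteq> P_at ?v" "\<And>w. g w \<noteq> 0 \<Longrightarrow> moment_at ?v w \<in> moment_at ?v ` ?C"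
      using gC CO moment_at_P_at[OF v]
      by (auto intro!: compact_continuous_image continuous_intros)
    define \<phi> where "\<phi> = extend ?v g"
    have \<phi>: "\<phi> \<in> smooth_sections"
      unfolding \<phi>_def by (rule extend_smooth[OF v smooth_on_subset[OF sg] K]) simp
    let ?Q = "chart_inv ?v ` ?C"
    have "section_support \<phi> \<subseteq> ?Q"
      unfolding section_support_def
    proof (rule closure_of_minimal[OF _ closed_chart_ball[OF v compact_cball CO]])
      show "{p \<in> X. \<exists>v\<in>vertices. p \<in> V v \<and> \<phi> v p \<noteq> 0} \<subseteq> ?Q"
      proof
        fix q assume "q \<in> {p \<in> X. \<exists>v\<in>vertices. p \<in> V v \<and> \<phi> v p \<noteq> 0}"
        then obtain v' where "\<phi> v' q \<noteq> 0" by blast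
        then have "q \<in> V ?v" "g (chart ?v q) \<noteq> 0" by (auto simp: \<phi>_def extend_def split: if_splits)
        then show "q \<in> ?Q" using gC v by (intro image_eqI[of _ _ "chart ?v q"]) auto
      qed
    qed
    also have "?Q \<subseteq> U" using r(2) by blast
    finally have "section_support \<phi> \<subseteq> U" .
    moreover have "\<phi> \<in> test_sections X" using \<phi> by (simp add: test_sections_X)
    ultimately have "\<phi> \<in> test_sections U" by (simp add: test_sections_def)
    then have "bs_section m \<phi> = 0" using fun_cong[OF U(2), of \<phi>] by (simp add: restrict_dist_def)
    moreover have "bs_section m \<phi> = of_real (torus_mean ?k coord_list B (bs_point ?k))"
    proof -
      have "local_rep \<phi> ?v w = g w" if "w \<in> bs_torus ?k" for w
        using bs_torus_Omega[OF m] that v by (auto simp: \<phi>_def extend_def)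
      then have "bs_section m \<phi> = torus_avg ?k coord_list g (bs_point ?k)"
        using torus_avg_cong[OF _ bs_point_bs_torus, of ?k "local_rep \<phi> ?v" g coord_list] by (simp add: bs_section_def \<phi>)
      also have "\<dots> = of_real (torus_mean ?k coord_list B (bs_point ?k)) * (\<Prod>i\<in>UNIV - set coord_list. weight ?k i (bs_point ?k))"
        unfolding g_def[abs_def]
        by (rule torus_avg_weight[OF continuous_on_subset[OF smooth_on_continuous_on[OF sB]]])
           (simp_all add: coord_list bs_point_bs_torus)
      finally show ?thesis by (simp add: coord_list)
    qed
    moreover have "torus_mean ?k coord_list B (bs_point ?k) > 0"
    proof -
      have "continuous_on (bs_torus ?k) B" by (rule continuous_on_subset[OF smooth_on_continuous_on[OF sB]]) simp
      moreover have "B ?w0 > 0" by (simp add: B_def cutoff_one)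
      ultimately show ?thesis
        using torus_mean_props[of ?k B ?w0 coord_list] w0 bs_point_bs_torus[of ?k] by (simp add: coord_list B_def cutoff_nonneg)
    qed
    ultimately show False by simp
  qed
  then show "p \<in> dist_support (bs_section m)" using pX unfolding dist_support_def by blast
qed

end

section \<open>The space of covariantly constant sections\<close>

theorem theorem1p1:
  fixes d :: nat and \<nu> :: "nat \<Rightarrow> int^'n" and lam :: "nat \<Rightarrow> int"
    and ord :: "real^'n \<Rightarrow> 'n \<Rightarrow> nat"
  assumes "delzant_polytope d \<nu> lam ord"
  shows "\<exists>\<delta> :: real^'n \<Rightarrow> (real^'n \<Rightarrow> 'n toric_point \<Rightarrow> complex) \<Rightarrow> complex.
    (\<forall>m \<in> toric_data.P d \<nu> lam \<inter> int_lattice.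
       \<delta> m \<in> toric_data.Q_real d \<nu> lam ord \<and>
       toric_data.dist_support d \<nu> lam ord (\<delta> m) = toric_data.moment_fiber d \<nu> lam m) \<and>
    toric_data.Q_real d \<nu> lam ord =
      module.span (\<lambda>(c::complex) \<sigma> \<phi>. c * \<sigma> \<phi>) (\<delta> ` (toric_data.P d \<nu> lam \<inter> int_lattice))"
proof -
  interpret delzant_polytope d \<nu> lam ord by (rule assms)
  let ?M = "P \<inter> int_lattice"
  let ?s = "\<lambda>(c::complex) (\<sigma> :: (real^'n \<Rightarrow> 'n toric_point \<Rightarrow> complex) \<Rightarrow> complex) \<phi>. c * \<sigma> \<phi>"
  interpret sp: module ?s
    by unfold_locales (auto simp: fun_eq_iff algebra_simps)
  have sum_eval: "(\<Sum>i\<in>I. ?s (c i) (\<sigma> i)) = (\<lambda>\<phi>. \<Sum>i\<in>I. c i * \<sigma> i \<phi>)" for I :: "(real^'n) set" and c \<sigma>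
    by (induction I rule: infinite_finite_induct) (auto simp: fun_eq_iff)
  have one: "bs_section m \<in> Q_real" if "m \<in> ?M" for m
    using bs_section_comb_Q_real[of "{m}" "\<lambda>_. 1"] that by simp
  have span: "sp.span (bs_section ` ?M) = range (\<lambda>c. \<Sum>m\<in>?M. ?s (c m) (bs_section m))"
  proof (intro equalityI subsetI)
    fix \<sigma> assume "\<sigma> \<in> sp.span (bs_section ` ?M)"
    then show "\<sigma> \<in> range (\<lambda>c. \<Sum>m\<in>?M. ?s (c m) (bs_section m))"
    proof (induction rule: sp.span_induct_alt)
      case base
      show ?case by (rule image_eqI[of _ _ "\<lambda>_. 0"]) (auto simp: sum_eval fun_eq_iff)
    next
      case (step a x \<tau>)
      then obtain m c where m: "m \<in> ?M" "x = bs_section m" and c: "\<tau> = (\<Sum>m\<in>?M. ?s (c m) (bs_section m))" by blast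
      have "(\<Sum>i\<in>?M. (c(m := c m + a)) i * bs_section i \<phi>) = a * bs_section m \<phi> + (\<Sum>i\<in>?M. c i * bs_section i \<phi>)" for \<phi>
      proof -
        have "(\<Sum>i\<in>?M. (c(m := c m + a)) i * bs_section i \<phi>)
            = (\<Sum>i\<in>?M. (if i = m then a * bs_section m \<phi> else 0) + c i * bs_section i \<phi>)"
          by (intro sum.cong) (auto simp: algebra_simps)
        then show ?thesis using m(1) finite_lattice_points by (simp add: sum.distrib)
      qed
      then show ?case
        by (intro image_eqI[of _ _ "c(m := c m + a)"]) (auto simp: sum_eval m c fun_eq_iff simp del: fun_upd_apply)
    qed
  next
    fix \<sigma> assume "\<sigma> \<in> range (\<lambda>c. \<Sum>m\<in>?M. ?s (c m) (bs_section m))"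
    then obtain c where "\<sigma> = (\<Sum>m\<in>?M. ?s (c m) (bs_section m))" by blast
    then show "\<sigma> \<in> sp.span (bs_section ` ?M)"
      by (simp only:) (intro sp.span_sum sp.span_scale sp.span_base imageI)
  qed
  have "Q_real = sp.span (bs_section ` ?M)"
  proof (intro equalityI subsetI)
    fix \<sigma> assume "\<sigma> \<in> Q_real"
    from Q_real_expansion[OF this] show "\<sigma> \<in> sp.span (bs_section ` ?M)"
      unfolding span sum_eval by (rule range_eqI[where x = "coefficient \<sigma>"])
  next
    fix \<sigma> assume "\<sigma> \<in> sp.span (bs_section ` ?M)"
    then obtain c where "\<sigma> = (\<lambda>\<phi>. \<Sum>m\<in>?M. c m * bs_section m \<phi>)" unfolding span sum_eval by blast
    then show "\<sigma> \<in> Q_real" using bs_section_comb_Q_real[OF finite_lattice_points] by simp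
  qed
  moreover have "dist_support (bs_section m) = moment_fiber m" if "m \<in> ?M" for m
    using bs_section_support_subset[OF that] bs_section_support_superset[OF that] by (rule subset_antisym)
  ultimately show ?thesis using one by (intro exI[of _ bs_section]) simp
qed

end
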